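(* Let $f\in\mathbb{R}_{\ge0}[x_1^{\pm1},\dots,x_m^{\pm1}]$, $m\ge1$, be a convenient Laurent polynomial with nonnegative coefficients. Let $r=r(f)\ge1$ be the unique natural number such that $\mathrm{Cst}(f^n)=0$ if $r\nmid n$ and $\mathrm{Cst}(f^{rn})>0$ for all but finitely many $n\ge0$, and let $T_{\mathrm{con}}=\min_{\mathbf x\in(\mathbb{R}_{>0})^m}f(\mathbf x)$ be the conifold value. Then $$\lim_{n\to\infty}\big(\mathrm{Cst}(f^{rn})\big)^{1/(rn)}=T_{\mathrm{con}}.$$ In particular, the convergence radius of the constant term series $\widehat G(t):=\sum_{n=0}^\infty\mathrm{Cst}(f^n)t^n$ equals $T_{\mathrm{con}}^{-1}$. Furthermore, $\widehat G(t)$ can be extended to a multi-valued analytic function on a punctured neighbourhood of $t=T_{\mathrm{con}}^{-1}$ and has nontrivial monodromy at $T_{\mathrm{con}}^{-1}$.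
   Context: $\mathrm{Cst}(g)$ denotes the constant term of a Laurent polynomial $g$. A Laurent polynomial is convenient if its Newton polytope (the convex hull in $\mathbb{R}^m$ of the exponents with nonzero coefficient) contains the origin in its interior. For convenient $f$ with nonnegative coefficients the integer $r(f)$ exists and is unique, and $f|_{(\mathbb{R}_{>0})^m}$ attains a positive minimum, at its unique critical point. *)

theory Defs
  imports "HOL-Analysis.Analysis" "HOL-Library.Poly_Mapping"
begin

text \<open>
  Real Laurent polynomials in the variables \<open>x\<^sub>i\<close>, \<open>i :: 'm\<close>, form the group algebra of \<open>int ^ 'm\<close>:
  \<open>lookup f k\<close> is the coefficient of the monomial with exponent vector \<open>k\<close>, and multiplication of
  \<open>poly_mapping\<close> is convolution. The number of variables is \<open>CARD('m)\<close>, which is at least 1.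
\<close>

type_synonym 'm laurent_poly = "(int ^ 'm) \<Rightarrow>\<^sub>0 real"

definition laurent_eval :: "'m::finite laurent_poly \<Rightarrow> real ^ 'm \<Rightarrow> real" where
  "laurent_eval f x = (\<Sum>k\<in>Poly_Mapping.keys f. Poly_Mapping.lookup f k * (\<Prod>i\<in>UNIV. (x $ i) powi (k $ i)))"

definition Cst :: "'m::finite laurent_poly \<Rightarrow> real" where
  "Cst g = Poly_Mapping.lookup g 0"

definition newton_polytope :: "'m::finite laurent_poly \<Rightarrow> (real ^ 'm) set" where
  "newton_polytope f = convex hull ((\<lambda>k. \<chi> i. real_of_int (k $ i)) ` Poly_Mapping.keys f)"

definition convenient :: "'m::finite laurent_poly \<Rightarrow> bool" where
  "convenient f \<longleftrightarrow> 0 \<in> interior (newton_polytope f)"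

definition is_cst_period :: "'m::finite laurent_poly \<Rightarrow> nat \<Rightarrow> bool" where
  "is_cst_period f r \<longleftrightarrow> r \<ge> 1 \<and> (\<forall>n. \<not> r dvd n \<longrightarrow> Cst (f ^ n) = 0)
     \<and> finite {n. \<not> Cst (f ^ (r * n)) > 0}"

definition cst_period :: "'m::finite laurent_poly \<Rightarrow> nat" where
  "cst_period f = (THE r. is_cst_period f r)"

text \<open>The least element of the set of values is the minimum (not merely the infimum).\<close>

definition conifold_value :: "'m::finite laurent_poly \<Rightarrow> real" where
  "conifold_value f = (LEAST v. v \<in> laurent_eval f ` {x. \<forall>i. x $ i > 0})"

text \<open>This is the sum of the constant term series only inside its disc of convergence; elsewhere
  \<open>suminf\<close> is an unspecified value.\<close>

definition cst_series :: "'m::finite laurent_poly \<Rightarrow> complex \<Rightarrow> complex" where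
  "cst_series f t = suminf (\<lambda>n. of_real (Cst (f ^ n)) * t ^ n)"

definition same_germ :: "complex \<Rightarrow> (complex \<Rightarrow> complex) \<Rightarrow> (complex \<Rightarrow> complex) \<Rightarrow> bool" where
  "same_germ a g h \<longleftrightarrow> (\<forall>\<^sub>F z in nhds a. g z = h z)"

text \<open>
  Analytic continuation of the germ of \<open>g\<close> at \<open>\<gamma> 0\<close> along the path \<open>\<gamma>\<close>. Only the germ of \<open>F s\<close> at
  \<open>\<gamma> s\<close> matters. For \<open>s\<close> near \<open>s0\<close> the point \<open>\<gamma> s\<close> lies in a disc around \<open>\<gamma> s0\<close> on which
  \<open>F s0\<close> is holomorphic, and there \<open>F s\<close> must have the germ of \<open>F s0\<close>.
\<close>

definition analytic_continuation ::
    "(complex \<Rightarrow> complex) \<Rightarrow> (real \<Rightarrow> complex) \<Rightarrow> (real \<Rightarrow> complex \<Rightarrow> complex) \<Rightarrow> bool" where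
  "analytic_continuation g \<gamma> F \<longleftrightarrow>
     path \<gamma> \<and> same_germ (\<gamma> 0) (F 0) g
     \<and> (\<forall>s0\<in>{0..1}. F s0 analytic_on {\<gamma> s0}
          \<and> (\<forall>\<^sub>F s in at s0 within {0..1}. same_germ (\<gamma> s) (F s) (F s0)))"

text \<open>
  An analytic function \<open>g\<close> on \<open>D\<close> extends to a multi-valued analytic function on \<open>U\<close>: its germs
  continue along every path in \<open>U\<close> that starts in \<open>D\<close>. The definition is meant for \<open>D \<inter> U\<close>
  nonempty and connected and \<open>U\<close> connected, so that all germs of \<open>g\<close> at points of \<open>D \<inter> U\<close> are
  continuations of each other inside \<open>U\<close>.
\<close>

definition extends_multivalued ::
    "(complex \<Rightarrow> complex) \<Rightarrow> complex set \<Rightarrow> complex set \<Rightarrow> bool" where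
  "extends_multivalued g D U \<longleftrightarrow>
     (\<forall>\<gamma>. path \<gamma> \<and> path_image \<gamma> \<subseteq> U \<and> pathstart \<gamma> \<in> D \<longrightarrow> (\<exists>F. analytic_continuation g \<gamma> F))"

definition nontrivial_monodromy ::
    "(complex \<Rightarrow> complex) \<Rightarrow> complex set \<Rightarrow> complex set \<Rightarrow> bool" where
  "nontrivial_monodromy g D U \<longleftrightarrow>
     (\<exists>\<gamma> F. path \<gamma> \<and> path_image \<gamma> \<subseteq> U \<and> pathstart \<gamma> \<in> D \<and> pathfinish \<gamma> = pathstart \<gamma>
        \<and> analytic_continuation g \<gamma> F \<and> \<not> same_germ (\<gamma> 1) (F 1) (F 0))"

end

theory Submission
  imports Defs "HOL-Complex_Analysis.Complex_Analysis"
begin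

text \<open>
  Let \<open>x\<^sub>0\<close> be the minimiser of \<open>f = \<Sum> c\<^sub>k x\<^sup>k\<close> on the positive orthant and \<open>T = f(x\<^sub>0)\<close>. The
  weights \<open>p\<^sub>k = c\<^sub>k x\<^sub>0\<^sup>k / T\<close> are a probability distribution on the exponents. Its mean is zero
  because \<open>x\<^sub>0\<close> is a critical point, and it is not supported on a hyperplane because \<open>f\<close> is convenient. If
  \<open>\<phi>(\<theta>) = \<Sum> p\<^sub>k exp(i k\<cdot>\<theta>)\<close> is its characteristic function, then \<open>Cst(f\<^sup>n) / T\<^sup>n\<close> is the
  mean of \<open>\<phi>\<^sup>n\<close> over a period cell of the torus: the probability that a random walk with steps \<open>p\<close> is back
  at the origin at time \<open>n\<close>. Hence the constant term series at \<open>z / T\<close> is the mean of \<open>1 / (1 - z \<phi>)\<close>,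
  the Green function of that walk at the origin. As \<open>\<bar>\<phi>\<bar> \<le> 1\<close>, the series converges for
  \<open>\<bar>z\<bar> < 1\<close>, and it remains to understand it near \<open>z = 1\<close>.
  
  Only neighbourhoods of the points with \<open>\<phi> = 1\<close> matter there. These points form a discrete group of
  periods of \<open>\<phi>\<close>, so all of them contribute the same amount. In polar coordinates \<open>\<theta> = s y\<close> one has
  \<open>1 - \<phi>(s y) = s\<^sup>2 q\<^sub>y(s)\<close> with \<open>q\<^sub>y(0) > 0\<close>, and the radial integral
  \<open>\<integral> s\<^sup>m\<^sup>-\<^sup>1 ds / (1 - z \<phi>(s y))\<close> has two poles that pinch the end point \<open>s = 0\<close> as
  \<open>z \<rightarrow> 1\<close>. The substitution \<open>u = s \<surd>q\<^sub>y(s)\<close> reduces it to integrals of \<open>du / (1 - z + z u\<^sup>2)\<close>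
  and \<open>u du / (1 - z + z u\<^sup>2)\<close>, an arc tangent and a logarithm. After integration over \<open>y\<close> the series is
  \<open>A(z) + B(z) / \<surd>(1 - z) + C(z) log (1 - z)\<close> with \<open>A, B, C\<close> holomorphic near \<open>z = 1\<close>
  (\<open>resolvent_integral_expansion\<close>, based on \<open>radial_integral_expansion\<close>). The lowest order coefficient of \<open>B\<close> (for
  odd \<open>m\<close>) or of \<open>C\<close> (for even \<open>m\<close>) is a multiple of
  \<open>\<integral> q\<^sub>y(0)\<^sup>-\<^sup>m\<^sup>/\<^sup>2 dy > 0\<close>, so the singular part does not vanish
  (\<open>singular_part_nontrivial\<close>).
  
  All claims follow from this expansion. In the coordinate \<open>\<zeta>\<close> with \<open>1 - z = exp \<zeta>\<close> the
  expansion is a holomorphic function on a half-plane, which gives the continuation along paths; it is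
  not periodic under \<open>\<zeta> \<mapsto> \<zeta> + 2 \<pi> i\<close>, which gives the monodromy and also shows that the series has no
  holomorphic extension across \<open>1 / T\<close>, so that its radius of convergence is exactly \<open>1 / T\<close>. Finally,
  \<open>Cst(f\<^sup>m\<^sup>+\<^sup>n) \<ge> Cst(f\<^sup>m) Cst(f\<^sup>n)\<close>; for such a sequence the indices of positive terms have a
  period, and along the period the roots converge to their upper limit, the inverse of the radius.
\<close>

section \<open>Integrals with a parameter\<close>


text \<open>
  The integrals over balls, shells, intervals and circles below are all integrals over a Euclidean space
  against an integrable weight \<open>v\<close> that vanishes off a compact set. This form covers indicator functions as well as
  the discontinuous cutoffs that arise from polar coordinates.
\<close>

lemma integrable_weighted:
  fixes v :: "'b::euclidean_space \<Rightarrow> real" and F :: "'b \<Rightarrow> complex"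
  assumes "integrable lborel v" "\<And>k. k \<notin> K \<Longrightarrow> v k = 0" "compact K" "continuous_on K F"
  shows "integrable lborel (\<lambda>k. v k *\<^sub>R F k)"
proof -
  obtain M where M: "\<And>k. k \<in> K \<Longrightarrow> norm (F k) \<le> M"
    using compact_imp_bounded[OF compact_continuous_image[OF assms(4,3)]] by (auto simp: bounded_iff)
  have [measurable]: "(\<lambda>k. indicator K k *\<^sub>R F k) \<in> borel_measurable borel"
    using assms by (intro borel_measurable_continuous_on_indicator) (auto intro: borel_compact)
  have [measurable]: "v \<in> borel_measurable borel" using assms(1) by auto
  have eq: "v k *\<^sub>R F k = v k *\<^sub>R (indicator K k *\<^sub>R F k)" for k
    using assms(2)[of k] by (auto simp: indicator_def)
  show ?thesis
  proof (rule Bochner_Integration.integrable_bound[of _ "\<lambda>k. M * v k"])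
    show "integrable lborel (\<lambda>k. M * v k)" using assms(1) by simp
    show "(\<lambda>k. v k *\<^sub>R F k) \<in> borel_measurable lborel" unfolding eq by measurable
    show "AE k in lborel. norm (v k *\<^sub>R F k) \<le> norm (M * v k)"
    proof (intro AE_I2)
      fix k
      show "norm (v k *\<^sub>R F k) \<le> norm (M * v k)"
      proof (cases "k \<in> K")
        case True
        hence "norm (F k) \<le> \<bar>M\<bar>" using M[of k] by simp
        from mult_left_mono[OF this, of "\<bar>v k\<bar>"] show ?thesis
          by (simp add: abs_mult mult.commute)
      qed (use assms(2) in auto)
    qed
  qed
qed

lemma continuous_on_weighted_integral:
  fixes v :: "'b::euclidean_space \<Rightarrow> real" and F :: "'c::heine_borel \<Rightarrow> 'b \<Rightarrow> complex"
  assumes v: "integrable lborel v" "\<And>k. k \<notin> K \<Longrightarrow> v k = 0" and K: "compact K"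
    and F: "continuous_on (P \<times> K) (\<lambda>x. F (fst x) (snd x))"
  shows "continuous_on P (\<lambda>p. \<integral>k. v k *\<^sub>R F p k \<partial>lborel)"
  unfolding continuous_on_sequentially
proof (intro allI ballI impI, elim conjE)
  fix x a assume a: "a \<in> P" and x: "\<forall>n. x n \<in> P" "x \<longlonglongrightarrow> a"
  have FK: "continuous_on K (F p)" if "p \<in> P" for p
    using that by (intro continuous_on_compose2[OF F, of K "\<lambda>k. (p, k)", simplified] continuous_intros) auto
  define S where "S = insert a (range x)"
  have "compact (S \<times> K)"
    unfolding S_def using x(2) K by (intro compact_Times compact_sequence_with_limit)
  moreover have "continuous_on (S \<times> K) (\<lambda>x. F (fst x) (snd x))"
    by (rule continuous_on_subset[OF F]) (use a x in \<open>auto simp: S_def\<close>)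
  ultimately have "bounded ((\<lambda>x. F (fst x) (snd x)) ` (S \<times> K))"
    by (intro compact_imp_bounded compact_continuous_image)
  then obtain M where "\<forall>y\<in>(\<lambda>x. F (fst x) (snd x)) ` (S \<times> K). norm y \<le> M"
    by (auto simp: bounded_iff)
  hence M: "norm (F p k) \<le> M" if "p \<in> S" "k \<in> K" for p k
    using that by force
  have "(\<lambda>n. \<integral>k. v k *\<^sub>R F (x n) k \<partial>lborel) \<longlonglongrightarrow> (\<integral>k. v k *\<^sub>R F a k \<partial>lborel)"
  proof (rule integral_dominated_convergence[where w = "\<lambda>k. \<bar>M\<bar> * \<bar>v k\<bar>"])
    show "(\<lambda>k. v k *\<^sub>R F a k) \<in> borel_measurable lborel"
      using integrable_weighted[OF v K FK[OF a]] by auto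
    show "(\<lambda>k. v k *\<^sub>R F (x n) k) \<in> borel_measurable lborel" for n
      using integrable_weighted[OF v K FK[of "x n"]] x(1) by auto
    show "integrable lborel (\<lambda>k. \<bar>M\<bar> * \<bar>v k\<bar>)" using v(1) by simp
    show "AE k in lborel. (\<lambda>n. v k *\<^sub>R F (x n) k) \<longlonglongrightarrow> v k *\<^sub>R F a k"
    proof (intro AE_I2)
      fix k
      show "(\<lambda>n. v k *\<^sub>R F (x n) k) \<longlonglongrightarrow> v k *\<^sub>R F a k"
      proof (cases "k \<in> K")
        case True
        have "continuous_on P (\<lambda>p. F p k)"
          using True by (intro continuous_on_compose2[OF F, of P "\<lambda>p. (p, k)", simplified] continuous_intros) auto
        hence "(\<lambda>n. F (x n) k) \<longlonglongrightarrow> F a k"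
          using a x unfolding continuous_on_sequentially o_def by blast
        thus ?thesis by (intro tendsto_intros)
      qed (use v(2) in auto)
    qed
    show "AE k in lborel. norm (v k *\<^sub>R F (x n) k) \<le> \<bar>M\<bar> * \<bar>v k\<bar>" for n
    proof (intro AE_I2)
      fix k
      show "norm (v k *\<^sub>R F (x n) k) \<le> \<bar>M\<bar> * \<bar>v k\<bar>"
      proof (cases "k \<in> K")
        case True
        hence "norm (F (x n) k) \<le> \<bar>M\<bar>" using M[of "x n" k] by (simp add: S_def)
        from mult_left_mono[OF this, of "\<bar>v k\<bar>"] show ?thesis
          by (simp add: mult.commute)
      qed (use v(2) in auto)
    qed
  qed
  thus "((\<lambda>p. \<integral>k. v k *\<^sub>R F p k \<partial>lborel) \<circ> x) \<longlonglongrightarrow> (\<integral>k. v k *\<^sub>R F a k \<partial>lborel)"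
    by (simp add: o_def)
qed

text \<open>
  Difference quotients of a family of holomorphic functions with a common bound are bounded by Cauchy's
  inequality. This is the dominating function for differentiation under the integral sign.
\<close>

lemma holomorphic_bound_imp_lipschitz_at:
  assumes "f holomorphic_on U" "open U" "cball z0 (2 * r) \<subseteq> U" "r > 0"
    and M: "\<And>z. z \<in> cball z0 (2 * r) \<Longrightarrow> norm (f z) \<le> M" and z: "z \<in> cball z0 r"
  shows "norm (f z - f z0) \<le> M / r * norm (z - z0)"
proof (rule field_differentiable_bound[where S = "cball z0 r" and f' = "deriv f"])
  fix w assume w: "w \<in> cball z0 r"
  have sub: "cball w r \<subseteq> cball z0 (2 * r)"
    using w by (simp add: cball_subset_cball_iff dist_commute)
  hence holw: "f holomorphic_on cball w r"
    using assms(1,3) holomorphic_on_subset by blast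
  have "norm ((deriv ^^ 1) f w) \<le> fact 1 * M / r ^ 1"
  proof (rule Cauchy_inequality)
    show "f holomorphic_on ball w r" using holw by (rule holomorphic_on_subset) auto
    show "continuous_on (cball w r) f" using holw by (rule holomorphic_on_imp_continuous_on)
    show "norm (f x) \<le> M" if "norm (w - x) = r" for x
      using that sub by (intro M) (auto simp: dist_norm subset_eq)
  qed (use assms in auto)
  thus "norm (deriv f w) \<le> M / r" by simp
  have "w \<in> cball w r" using assms(4) by simp
  hence "w \<in> U" using sub assms(3) by blast
  thus "(f has_field_derivative deriv f w) (at w within cball z0 r)"
    by (rule holomorphic_derivI[OF assms(1,2)])
qed (use assms in auto)

lemma holomorphic_on_weighted_integral:
  fixes v :: "'b::euclidean_space \<Rightarrow> real" and F :: "complex \<Rightarrow> 'b \<Rightarrow> complex"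
  assumes v: "integrable lborel v" "\<And>k. k \<notin> K \<Longrightarrow> v k = 0" and K: "compact K" and U: "open U"
    and F: "continuous_on (U \<times> K) (\<lambda>x. F (fst x) (snd x))"
    and hol: "\<And>k. k \<in> K \<Longrightarrow> (\<lambda>z. F z k) holomorphic_on U"
  shows "(\<lambda>z. \<integral>k. v k *\<^sub>R F z k \<partial>lborel) holomorphic_on U"
proof -
  let ?I = "\<lambda>z. \<integral>k. v k *\<^sub>R F z k \<partial>lborel"
  have "\<exists>D. (?I has_field_derivative D) (at z0)" if z0: "z0 \<in> U" for z0
  proof -
    obtain e where e: "e > 0" "cball z0 e \<subseteq> U" using U z0 open_contains_cball by blast
    define r where "r = e / 2"
    have r: "r > 0" "cball z0 (2 * r) \<subseteq> U" using e by (auto simp: r_def)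
    have FK: "continuous_on K (F p)" if "p \<in> U" for p
      using that by (intro continuous_on_compose2[OF F, of K "\<lambda>k. (p, k)", simplified] continuous_intros) auto
    have int: "integrable lborel (\<lambda>k. v k *\<^sub>R F p k)" if "p \<in> U" for p
      by (rule integrable_weighted[OF v K FK[OF that]])
    have "bounded ((\<lambda>x. F (fst x) (snd x)) ` (cball z0 (2 * r) \<times> K))"
      by (intro compact_imp_bounded compact_continuous_image continuous_on_subset[OF F] compact_Times K)
         (use r in auto)
    then obtain M where "\<forall>y\<in>(\<lambda>x. F (fst x) (snd x)) ` (cball z0 (2 * r) \<times> K). norm y \<le> M"
      by (auto simp: bounded_iff)
    hence M: "norm (F p k) \<le> M" if "p \<in> cball z0 (2 * r)" "k \<in> K" for p k
      using that by force
    define D where "D k = v k *\<^sub>R deriv (\<lambda>z. F z k) z0" for k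
    have quot: "(\<lambda>n. (?I (z0 + X n) - ?I z0) / X n) \<longlonglongrightarrow> (\<integral>k. D k \<partial>lborel)"
      if X: "X \<longlonglongrightarrow> 0" "\<And>n. X n \<noteq> 0" "\<And>n. norm (X n) < r" for X
    proof -
      have XU: "z0 + X n \<in> U" for n
      proof -
        have "z0 + X n \<in> cball z0 (2 * r)" using X(3)[of n] r(1) by (simp add: dist_norm)
        thus ?thesis using r(2) by blast
      qed
      have eq: "(?I (z0 + X n) - ?I z0) / X n = (\<integral>k. v k *\<^sub>R ((F (z0 + X n) k - F z0 k) / X n) \<partial>lborel)" for n
      proof -
        have "?I (z0 + X n) - ?I z0 = (\<integral>k. v k *\<^sub>R F (z0 + X n) k - v k *\<^sub>R F z0 k \<partial>lborel)"
          using int[OF XU[of n]] int[OF z0] by (rule Bochner_Integration.integral_diff[symmetric])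
        also have "\<dots> / X n = (\<integral>k. (v k *\<^sub>R F (z0 + X n) k - v k *\<^sub>R F z0 k) / X n \<partial>lborel)"
          by simp
        finally show ?thesis by (simp add: scaleR_diff_right scaleR_conv_of_real algebra_simps)
      qed
      have meas: "(\<lambda>k. v k *\<^sub>R ((F (z0 + X n) k - F z0 k) / X n)) \<in> borel_measurable lborel" for n
        using FK[OF XU[of n]] FK[OF z0] X(2)
        by (intro borel_measurable_integrable integrable_weighted[OF v K] continuous_intros) auto
      have lim: "(\<lambda>n. v k *\<^sub>R ((F (z0 + X n) k - F z0 k) / X n)) \<longlonglongrightarrow> D k" for k
      proof (cases "k \<in> K")
        case True
        have "((\<lambda>z. F z k) has_field_derivative deriv (\<lambda>z. F z k) z0) (at z0)"
          using hol[OF True] U z0 by (rule holomorphic_derivI)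
        hence "((\<lambda>h. (F (z0 + h) k - F z0 k) / h) \<longlongrightarrow> deriv (\<lambda>z. F z k) z0) (at 0)"
          by (simp add: DERIV_def)
        hence "(\<lambda>n. (F (z0 + X n) k - F z0 k) / X n) \<longlonglongrightarrow> deriv (\<lambda>z. F z k) z0"
          using X by (auto simp: tendsto_at_iff_sequentially o_def)
        thus ?thesis unfolding D_def by (intro tendsto_intros)
      qed (use v(2) in \<open>auto simp: D_def\<close>)
      show ?thesis
        unfolding eq
      proof (rule integral_dominated_convergence[where w = "\<lambda>k. \<bar>M / r\<bar> * \<bar>v k\<bar>"])
        show "D \<in> borel_measurable lborel"
          by (rule borel_measurable_LIMSEQ_metric[OF meas lim])
        show "integrable lborel (\<lambda>k. \<bar>M / r\<bar> * \<bar>v k\<bar>)" using v(1) by simp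
        show "AE k in lborel. norm (v k *\<^sub>R ((F (z0 + X n) k - F z0 k) / X n)) \<le> \<bar>M / r\<bar> * \<bar>v k\<bar>" for n
        proof (intro AE_I2)
          fix k
          show "norm (v k *\<^sub>R ((F (z0 + X n) k - F z0 k) / X n)) \<le> \<bar>M / r\<bar> * \<bar>v k\<bar>"
          proof (cases "k \<in> K")
            case True
            have "norm (F (z0 + X n) k - F z0 k) \<le> M / r * norm (z0 + X n - z0)"
              by (rule holomorphic_bound_imp_lipschitz_at[OF hol[OF True] U r(2,1) M[OF _ True]])
                 (use X(3)[of n] in \<open>auto simp: dist_norm\<close>)
            hence "norm ((F (z0 + X n) k - F z0 k) / X n) \<le> M / r"
              using X(2)[of n] by (simp add: norm_divide divide_le_eq)
            hence "norm ((F (z0 + X n) k - F z0 k) / X n) \<le> \<bar>M / r\<bar>" by linarith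
            from mult_left_mono[OF this, of "\<bar>v k\<bar>"] show ?thesis
              unfolding norm_scaleR by (simp add: mult.commute)
          qed (use v(2) in auto)
        qed
      qed (use meas lim in auto)
    qed
    have "((\<lambda>h. (?I (z0 + h) - ?I z0) / h) \<longlongrightarrow> (\<integral>k. D k \<partial>lborel)) (at 0)"
      unfolding tendsto_at_iff_sequentially
    proof (intro allI impI)
      fix X :: "nat \<Rightarrow> complex" assume X: "\<forall>i. X i \<in> UNIV - {0}" "X \<longlonglongrightarrow> 0"
      from X(2) r(1) obtain N where N: "\<And>n. n \<ge> N \<Longrightarrow> norm (X n) < r"
        unfolding LIMSEQ_iff by auto
      have "(\<lambda>n. (?I (z0 + X (n + N)) - ?I z0) / X (n + N)) \<longlonglongrightarrow> (\<integral>k. D k \<partial>lborel)"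
        by (rule quot) (use X N LIMSEQ_ignore_initial_segment in auto)
      hence "(\<lambda>n. (?I (z0 + X n) - ?I z0) / X n) \<longlonglongrightarrow> (\<integral>k. D k \<partial>lborel)"
        by (rule LIMSEQ_offset)
      thus "((\<lambda>h. (?I (z0 + h) - ?I z0) / h) \<circ> X) \<longlonglongrightarrow> (\<integral>k. D k \<partial>lborel)"
        by (simp add: o_def)
    qed
    thus ?thesis by (auto simp: DERIV_def)
  qed
  thus ?thesis
    using U by (auto simp: holomorphic_on_open)
qed

text \<open>
  This is \<open>1 / (2 \<pi> i)\<close> times the contour integral of \<open>F(s) / s\<close> over the circle of radius \<open>R\<close>, written as an
  integral over the unit interval so that the lemmas on weighted integrals apply to it.
\<close>

definition circle_mean :: "real \<Rightarrow> (complex \<Rightarrow> complex) \<Rightarrow> complex" where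
  "circle_mean R F = (\<integral>\<alpha>. indicat_real {0..1} \<alpha> *\<^sub>R F (of_real R * cis (2 * pi * \<alpha>)) \<partial>lborel)"

lemma on_circle: "R > 0 \<Longrightarrow> of_real R * cis t \<in> sphere 0 R"
  by (simp add: norm_mult)

lemma integrable_indicator_unit: "integrable lborel (indicat_real {a..b::real})"
  by (simp add: integrable_indicator_iff emeasure_lborel_Icc_eq)

lemma circle_mean_cong:
  assumes "R > 0" "\<And>s. s \<in> sphere 0 R \<Longrightarrow> F s = G s"
  shows "circle_mean R F = circle_mean R G"
  unfolding circle_mean_def
  by (intro Bochner_Integration.integral_cong refl arg_cong2[of _ _ _ _ "(*\<^sub>R)"] assms(2) on_circle assms(1))

lemma integrable_circle:
  fixes F :: "complex \<Rightarrow> complex"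
  assumes "R > 0" "continuous_on (sphere 0 R) F"
  shows "integrable lborel (\<lambda>\<alpha>. indicat_real {0..1} \<alpha> *\<^sub>R F (of_real R * cis (2 * pi * \<alpha>)))"
proof (rule integrable_weighted[OF integrable_indicator_unit])
  show "continuous_on {0..1} (\<lambda>\<alpha>. F (of_real R * cis (2 * pi * \<alpha>)))"
    using assms by (intro continuous_on_compose2[OF assms(2)] continuous_intros) (auto simp: norm_mult)
qed auto

lemma circle_mean_add:
  assumes "R > 0" "continuous_on (sphere 0 R) F" "continuous_on (sphere 0 R) G"
  shows "circle_mean R (\<lambda>s. F s + G s) = circle_mean R F + circle_mean R G"
  unfolding circle_mean_def scaleR_add_right
  using assms by (intro Bochner_Integration.integral_add integrable_circle)

lemma circle_mean_mult: "circle_mean R (\<lambda>s. c * F s) = c * circle_mean R F"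
  unfolding circle_mean_def mult_scaleR_right[symmetric] by (rule integral_mult_right_zero)

lemma continuous_on_circle_mean:
  fixes F :: "'c::heine_borel \<Rightarrow> complex \<Rightarrow> complex"
  assumes "R > 0" "continuous_on (P \<times> sphere 0 R) (\<lambda>x. F (fst x) (snd x))"
  shows "continuous_on P (\<lambda>p. circle_mean R (F p))"
  unfolding circle_mean_def
proof (rule continuous_on_weighted_integral[OF integrable_indicator_unit])
  show "continuous_on (P \<times> {0..1}) (\<lambda>x. F (fst x) (of_real R * cis (2 * pi * snd x)))"
    by (rule continuous_on_compose2[OF assms(2), of _ "\<lambda>x. (fst x, of_real R * cis (2 * pi * snd x))", simplified])
       (use assms(1) in \<open>auto simp: norm_mult intro!: continuous_intros\<close>)
qed auto

lemma holomorphic_on_circle_mean: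
  assumes "R > 0" "open U" "continuous_on (U \<times> sphere 0 R) (\<lambda>x. F (fst x) (snd x))"
    and "\<And>s. s \<in> sphere 0 R \<Longrightarrow> (\<lambda>z. F z s) holomorphic_on U"
  shows "(\<lambda>z. circle_mean R (F z)) holomorphic_on U"
  unfolding circle_mean_def
proof (rule holomorphic_on_weighted_integral[OF integrable_indicator_unit])
  show "continuous_on (U \<times> {0..1}) (\<lambda>x. F (fst x) (of_real R * cis (2 * pi * snd x)))"
    by (rule continuous_on_compose2[OF assms(3), of _ "\<lambda>x. (fst x, of_real R * cis (2 * pi * snd x))", simplified])
       (use assms(1) in \<open>auto simp: norm_mult intro!: continuous_intros\<close>)
  show "(\<lambda>z. F z (of_real R * cis (2 * pi * \<alpha>))) holomorphic_on U" if "\<alpha> \<in> {0..1}" for \<alpha>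
    using on_circle[OF assms(1)] by (rule assms(4))
qed (use assms in auto)

lemma circle_mean_Cauchy:
  assumes f: "f holomorphic_on ball 0 R'" and R: "0 < R" "R < R'" and s0: "s0 \<in> ball 0 R"
  shows "circle_mean R (\<lambda>s. f s * s / (s - s0)) = f s0"
proof -
  have sub: "cball 0 R \<subseteq> ball 0 R'" using R by auto
  have "((\<lambda>u. f u / (u - s0)) has_contour_integral (2 * of_real pi * \<i> * f s0)) (circlepath 0 R)"
    using Cauchy_integral_circlepath_simple[of f 0 R s0] holomorphic_on_subset[OF f sub] s0
    by (simp add: dist_norm)
  hence H: "((\<lambda>x. f (circlepath 0 R x) / (circlepath 0 R x - s0) *
      vector_derivative (circlepath 0 R) (at x within {0..1})) has_integral (2 * of_real pi * \<i> * f s0)) {0..1}"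
    by (simp add: has_contour_integral_def)
  have c: "circlepath 0 R x = of_real R * cis (2 * pi * x)" for x
    by (simp add: circlepath cis_conv_exp mult_ac)
  let ?g = "\<lambda>x. f (of_real R * cis (2 * pi * x)) * (of_real R * cis (2 * pi * x)) / (of_real R * cis (2 * pi * x) - s0)"
  have "f (circlepath 0 R x) / (circlepath 0 R x - s0) * vector_derivative (circlepath 0 R) (at x within {0..1})
      = (2 * of_real pi * \<i>) * ?g x" if "x \<in> {0..1}" for x
  proof -
    have "vector_derivative (circlepath 0 R) (at x within {0..1}) = 2 * of_real pi * \<i> * (of_real R * cis (2 * pi * x))"
      using that by (simp add: vector_derivative_circlepath01 cis_conv_exp mult_ac)
    thus ?thesis unfolding c by simp
  qed
  note has_integral_eq[OF this H]
  from has_integral_mult_right[OF this, of "1 / (2 * of_real pi * \<i>)"]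
  have int: "(?g has_integral f s0) {0..1}"
    by simp
  have "continuous_on (sphere 0 R) (\<lambda>s. f s * s / (s - s0))"
    using s0 R by (intro continuous_intros holomorphic_on_imp_continuous_on holomorphic_on_subset[OF f]) auto
  from integrable_circle[OF R(1) this] have "set_integrable lborel {0..1} ?g"
    by (simp add: set_integrable_def)
  from set_borel_integral_eq_integral(2)[OF this] integral_unique[OF int] show ?thesis
    unfolding circle_mean_def set_lebesgue_integral_def by simp
qed

lemma circle_mean_eq_center:
  assumes "f holomorphic_on ball 0 R'" "0 < R" "R < R'"
  shows "circle_mean R f = f 0"
proof -
  have "circle_mean R f = circle_mean R (\<lambda>s. f s * s / (s - 0))"
    using assms(2) by (intro circle_mean_cong) auto
  thus ?thesis using circle_mean_Cauchy[of f R' R 0] assms by simp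
qed

section \<open>Radial integrals with a pair of pinching poles\<close>

text \<open>
  The derivative of the left-hand side vanishes on the right half-plane, and the value at \<open>1\<close> is \<open>\<pi> / 2\<close>. The identity
  splits an arc tangent of large argument into its limit and a part that is regular at infinity.
\<close>

lemma Arctan_add_Arctan_inverse:
  assumes "Re z > 0"
  shows "Arctan z + Arctan (1 / z) = of_real (pi / 2)"
proof -
  let ?S = "{z. Re z > 0}"
  have "(\<lambda>z. Arctan z + Arctan (1 / z)) constant_on ?S"
  proof (rule has_field_derivative_0_imp_constant_on)
    fix w assume w: "w \<in> ?S"
    hence nz: "w \<noteq> 0" by auto
    have inv: "Re (1 / w) > 0" using w by (simp add: Re_divide sum_power2_gt_zero_iff)
    have sq: "1 + w\<^sup>2 \<noteq> 0"
    proof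
      assume "1 + w\<^sup>2 = 0"
      hence "w\<^sup>2 = - 1" by (simp add: eq_neg_iff_add_eq_0 add.commute)
      hence "Re (w\<^sup>2) = -1" "Im (w\<^sup>2) = 0" by simp_all
      thus False using w by (auto simp: power2_eq_square) (metis add.inverse_inverse mult_zero_right not_square_less_zero mult_minus_right zero_less_one neg_0_less_iff_less)
    qed
    have "((\<lambda>z. Arctan z + Arctan (1 / z)) has_field_derivative
        inverse (1 + w\<^sup>2) + inverse (1 + (1 / w)\<^sup>2) * (- 1 / w\<^sup>2)) (at w)"
      using w inv nz by (auto intro!: derivative_eq_intros simp: power2_eq_square)
    moreover have "inverse (1 + w\<^sup>2) + inverse (1 + (1 / w)\<^sup>2) * (- 1 / w\<^sup>2) = 0"
    proof -
      have "1 + (1 / w)\<^sup>2 = (1 + w\<^sup>2) / w\<^sup>2" using nz by (simp add: field_simps)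
      thus ?thesis using nz sq by (simp add: field_simps)
    qed
    ultimately show "((\<lambda>z. Arctan z + Arctan (1 / z)) has_field_derivative 0) (at w)" by simp
  qed (simp_all add: convex_connected convex_halfspace_Re_gt open_halfspace_Re_gt)
  moreover have "Arctan 1 = of_real (pi / 4)"
  proof -
    have "Arctan (of_real 1) = of_real (arctan 1)"
      by (metis arctan_eq_Re_Arctan Im_Arctan_of_real complex_of_real_def complex_surj of_real_def)
    thus ?thesis by (simp add: arctan_one)
  qed
  ultimately show ?thesis
    using assms unfolding constant_on_def
    by (metis (mono_tags, lifting) div_by_1 field_sum_of_halves mem_Collect_eq of_real_add one_complex.simps(1) zero_less_one add_divide_distrib divide_divide_eq_left mult_2 numeral_Bit0 of_real_divide)
qed

lemma integral_linear_combination: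
  fixes f1 f2 f3 :: "'b \<Rightarrow> complex"
  assumes "integrable M f1" "integrable M f2" "integrable M f3"
  shows "(\<integral>t. f1 t + (b * f2 t + c * f3 t) \<partial>M) = integral\<^sup>L M f1 + (b * integral\<^sup>L M f2 + c * integral\<^sup>L M f3)"
  using assms by simp

text \<open>
  The radial integrals are \<open>\<integral> s\<^sup>m\<^sup>-\<^sup>1 ds / (1 - z + z s\<^sup>2 q\<^sub>y(s))\<close> over \<open>s \<in> [0, \<delta>]\<close>, with a
  direction \<open>y\<close> in a compact set \<open>Y\<close>. The last assumption says that \<open>1 - s\<^sup>2 q\<^sub>y(s)\<close>, a characteristic function in the
  application, has modulus at most one on the real axis; it keeps the denominator away from zero for \<open>0 < z < 1\<close>.
\<close>

locale ray_family =
  fixes Y :: "'a::euclidean_space set" and q q' :: "'a \<Rightarrow> complex \<Rightarrow> complex" and \<kappa> :: "'a \<Rightarrow> real" and m :: nat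
  assumes Y: "compact Y" "emeasure lborel Y > 0" and m: "m > 0"
    and q_cont: "continuous_on (Y \<times> UNIV) (\<lambda>x. q (fst x) (snd x))"
    and q'_cont: "continuous_on (Y \<times> UNIV) (\<lambda>x. q' (fst x) (snd x))"
    and q_deriv: "\<And>y s. y \<in> Y \<Longrightarrow> (q y has_field_derivative q' y s) (at s)"
    and q_0: "\<And>y. y \<in> Y \<Longrightarrow> q y 0 = of_real (\<kappa> y)" and \<kappa>_pos: "\<And>y. y \<in> Y \<Longrightarrow> \<kappa> y > 0"
    and real_bound: "\<And>y t. y \<in> Y \<Longrightarrow> norm (1 - (of_real t)\<^sup>2 * q y (of_real t)) \<le> 1"
begin

text \<open>
  The function \<open>\<psi>\<^sub>y\<close> is the local coordinate in which \<open>g\<^sub>y\<close> is exactly quadratic; \<open>r'\<close> and \<open>\<psi>'\<close> are the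
  derivatives of \<open>r\<close> and \<open>\<psi>\<close>.
\<close>

definition "g y s = s\<^sup>2 * q y s"
definition "r y s = csqrt (q y s)"
definition "r' y s = q' y s / (2 * r y s)"
definition "\<psi> y s = s * r y s"
definition "\<psi>' y s = r y s + s * r' y s"

lemma g_eq: "g y s = (\<psi> y s)\<^sup>2"
  by (simp add: g_def \<psi>_def r_def power_mult_distrib)

lemma continuous_on_q: "continuous_on S u \<Longrightarrow> continuous_on S v \<Longrightarrow> u ` S \<subseteq> Y \<Longrightarrow> continuous_on S (\<lambda>x. q (u x) (v x))"
  by (rule continuous_on_compose2[OF q_cont, of S "\<lambda>x. (u x, v x)", simplified]) (auto intro!: continuous_intros)

lemma continuous_on_q': "continuous_on S u \<Longrightarrow> continuous_on S v \<Longrightarrow> u ` S \<subseteq> Y \<Longrightarrow> continuous_on S (\<lambda>x. q' (u x) (v x))"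
  by (rule continuous_on_compose2[OF q'_cont, of S "\<lambda>x. (u x, v x)", simplified]) (auto intro!: continuous_intros)

lemma has_field_derivative_r:
  assumes "y \<in> Y" "Re (q y s) > 0"
  shows "(r y has_field_derivative r' y s) (at s)"
  unfolding r_def r'_def
  by (rule DERIV_chain2[OF has_field_derivative_csqrt q_deriv, THEN DERIV_cong])
     (use assms in \<open>auto simp: field_simps complex_nonpos_Reals_iff\<close>)

lemma Re_q_pos_near_0:
  obtains R a where "R > 0" "a > 0" "\<And>y s. y \<in> Y \<Longrightarrow> s \<in> cball 0 R \<Longrightarrow> Re (q y s) \<ge> a"
proof -
  have "Y \<noteq> {}" using Y(2) by auto
  have "continuous_on Y (\<lambda>y. Re (q y 0))"
    by (intro continuous_intros continuous_on_q) auto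
  then obtain y0 where y0: "y0 \<in> Y" "\<And>y. y \<in> Y \<Longrightarrow> Re (q y0 0) \<le> Re (q y 0)"
    using continuous_attains_inf[OF Y(1) \<open>Y \<noteq> {}\<close>] by blast
  define a where "a = Re (q y0 0) / 2"
  have a: "a > 0" using q_0[OF y0(1)] \<kappa>_pos[OF y0(1)] by (simp add: a_def)
  have "uniformly_continuous_on (Y \<times> cball 0 1) (\<lambda>x. q (fst x) (snd x))"
    by (intro compact_uniformly_continuous compact_Times Y compact_cball continuous_on_subset[OF q_cont]) auto
  then obtain d where d: "d > 0" and d': "\<And>x x'. x \<in> Y \<times> cball 0 1 \<Longrightarrow> x' \<in> Y \<times> cball 0 1 \<Longrightarrow> dist x' x < d \<Longrightarrow>
      dist (q (fst x') (snd x')) (q (fst x) (snd x)) < a"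
    by (rule uniformly_continuous_onE[OF _ a]) (rule that; assumption)
  show thesis
  proof (rule that[of "min (d / 2) 1" a])
    fix y and s :: complex assume y: "y \<in> Y" and s: "s \<in> cball 0 (min (d / 2) 1)"
    have "dist (q y s) (q y 0) < a"
      using d'[of "(y, 0)" "(y, s)"] y s d by (auto simp: dist_Pair_Pair)
    hence "\<bar>Re (q y s - q y 0)\<bar> < a"
      using abs_Re_le_cmod[of "q y s - q y 0"] by (simp add: dist_norm)
    moreover have "Re (q y 0) \<ge> 2 * a" using y0(2)[OF y] by (simp add: a_def)
    ultimately show "Re (q y s) \<ge> a" by simp
  qed (use a d in auto)
qed

end

text \<open>
  A choice of radii for which the coordinate change \<open>\<psi>\<^sub>y\<close> is injective on a disc, uniformly in \<open>y\<close>. The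
  numbers \<open>\<eta>\<close> and \<open>\<epsilon>\<close> separate three scales: on the ray \<open>\<bar>g\<bar> \<le> \<eta>\<close>, on the circle of radius \<open>R\<close> \<open>\<bar>g\<bar> \<ge> 4 \<eta>\<close>, and at the end
  of the ray \<open>g\<close> is still large compared to \<open>\<bar>1 - z\<bar> < \<epsilon>\<close>. So for these \<open>z\<close> the two zeros of \<open>1 - z + z g\<close> in the disc are
  inside the circle and away from the end of the ray.
\<close>

locale ray_disc = ray_family +
  fixes R' R \<delta> \<eta> \<epsilon> :: real
  assumes radii: "0 < R" "R < R'" "0 < \<delta>" "\<delta> < R" and \<eta>_pos: "\<eta> > 0"
    and Re_q_pos: "\<And>y s. y \<in> Y \<Longrightarrow> s \<in> ball 0 R' \<Longrightarrow> Re (q y s) > 0"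
    and inj: "\<And>y. y \<in> Y \<Longrightarrow> inj_on (\<psi> y) (ball 0 R')"
    and g_circle: "\<And>y s. y \<in> Y \<Longrightarrow> s \<in> sphere 0 R \<Longrightarrow> norm (g y s) \<ge> 4 * \<eta>"
    and g_ray: "\<And>y t. y \<in> Y \<Longrightarrow> t \<in> {0..\<delta>} \<Longrightarrow> norm (g y (of_real t)) \<le> \<eta>"
    and g_end: "\<And>y. y \<in> Y \<Longrightarrow> Re (g y (of_real \<delta>)) \<ge> 4 * \<epsilon>"
    and \<epsilon>: "0 < \<epsilon>" "\<epsilon> \<le> 1 / 2" "\<epsilon> \<le> \<eta>"
begin

abbreviation "U \<equiv> ball (1 :: complex) \<epsilon>"

lemma q_not_nonpos: "y \<in> Y \<Longrightarrow> s \<in> ball 0 R' \<Longrightarrow> q y s \<notin> \<real>\<^sub>\<le>\<^sub>0"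
  using Re_q_pos[of y s] by (auto simp: complex_nonpos_Reals_iff)

lemma r_nz: "y \<in> Y \<Longrightarrow> s \<in> ball 0 R' \<Longrightarrow> r y s \<noteq> 0"
  using Re_q_pos[of y s] by (auto simp: r_def)

lemma Re_r_pos: "y \<in> Y \<Longrightarrow> s \<in> ball 0 R' \<Longrightarrow> Re (r y s) > 0"
proof -
  assume "y \<in> Y" "s \<in> ball 0 R'"
  hence "Re (q y s) > 0" by (rule Re_q_pos)
  hence "cmod (q y s) + Re (q y s) > 0" by (simp add: add_nonneg_pos)
  thus ?thesis by (simp add: r_def)
qed

lemma continuous_on_r: "continuous_on S u \<Longrightarrow> continuous_on S v \<Longrightarrow> u ` S \<subseteq> Y \<Longrightarrow> v ` S \<subseteq> ball 0 R' \<Longrightarrow>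
    continuous_on S (\<lambda>x. r (u x) (v x))"
  unfolding r_def
  by (rule continuous_on_compose2[OF continuous_on_csqrt continuous_on_q])
     (use q_not_nonpos in \<open>auto simp: image_subset_iff\<close>)

lemma continuous_on_g: "continuous_on S u \<Longrightarrow> continuous_on S v \<Longrightarrow> u ` S \<subseteq> Y \<Longrightarrow> continuous_on S (\<lambda>x. g (u x) (v x))"
  unfolding g_def by (intro continuous_intros continuous_on_q)

lemma continuous_on_\<psi>: "continuous_on S u \<Longrightarrow> continuous_on S v \<Longrightarrow> u ` S \<subseteq> Y \<Longrightarrow> v ` S \<subseteq> ball 0 R' \<Longrightarrow>
    continuous_on S (\<lambda>x. \<psi> (u x) (v x))"
  unfolding \<psi>_def by (intro continuous_on_mult continuous_on_r)

lemma continuous_on_\<psi>': "continuous_on S u \<Longrightarrow> continuous_on S v \<Longrightarrow> u ` S \<subseteq> Y \<Longrightarrow> v ` S \<subseteq> ball 0 R' \<Longrightarrow>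
    continuous_on S (\<lambda>x. \<psi>' (u x) (v x))"
  unfolding \<psi>'_def r'_def
  by (intro continuous_on_add continuous_on_mult continuous_on_divide continuous_on_const continuous_on_q' continuous_on_r)
     (use r_nz in \<open>auto simp: image_subset_iff\<close>)

lemma r_deriv: "y \<in> Y \<Longrightarrow> s \<in> ball 0 R' \<Longrightarrow> (r y has_field_derivative r' y s) (at s)"
  using has_field_derivative_r Re_q_pos by blast

lemma \<psi>_deriv: "y \<in> Y \<Longrightarrow> s \<in> ball 0 R' \<Longrightarrow> (\<psi> y has_field_derivative \<psi>' y s) (at s)"
  unfolding \<psi>_def \<psi>'_def
  by (rule DERIV_mult[OF DERIV_ident r_deriv, THEN DERIV_cong]) auto

lemma \<psi>_holomorphic: "y \<in> Y \<Longrightarrow> \<psi> y holomorphic_on ball 0 R'"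
  unfolding holomorphic_on_open[OF open_ball] using \<psi>_deriv by blast

lemma \<psi>'_nz: "y \<in> Y \<Longrightarrow> s \<in> ball 0 R' \<Longrightarrow> \<psi>' y s \<noteq> 0"
  using holomorphic_injective_imp_regular[OF \<psi>_holomorphic open_ball inj] DERIV_imp_deriv[OF \<psi>_deriv] by metis

lemma ray_in_disc: "t \<in> {0..\<delta>} \<Longrightarrow> of_real t \<in> ball (0::complex) R" "t \<in> {0..\<delta>} \<Longrightarrow> of_real t \<in> ball (0::complex) R'"
  using radii by auto

lemma circle_in_disc: "sphere 0 R \<subseteq> ball (0::complex) R'"
  using radii by auto

definition "D y z s = 1 - z + z * g y s"

lemma D_nz_circle: "y \<in> Y \<Longrightarrow> z \<in> U \<Longrightarrow> s \<in> sphere 0 R \<Longrightarrow> D y z s \<noteq> 0"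
proof
  assume y: "y \<in> Y" and z: "z \<in> U" and s: "s \<in> sphere 0 R" and "D y z s = 0"
  hence "norm (z * g y s) = norm (1 - z)"
    by (metis D_def add_eq_0_iff norm_minus_cancel)
  moreover have "norm (1 - z) < \<epsilon>" using z by (simp add: dist_norm)
  moreover have "norm z \<ge> 1 / 2"
    using norm_triangle_ineq2[of 1 "1 - z"] \<open>norm (1 - z) < \<epsilon>\<close> \<epsilon> by simp
  hence "norm (z * g y s) \<ge> 1 / 2 * (4 * \<eta>)"
    unfolding norm_mult using g_circle[OF y s] \<eta>_pos by (intro mult_mono) auto
  ultimately show False using \<epsilon> \<eta>_pos by simp
qed

lemma g_diff_nz: "y \<in> Y \<Longrightarrow> t \<in> {0..\<delta>} \<Longrightarrow> s \<in> sphere 0 R \<Longrightarrow> g y s - g y (of_real t) \<noteq> 0"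
  using g_circle[of y s] g_ray[of y t] \<eta>_pos by auto

lemma D_nz_real: "y \<in> Y \<Longrightarrow> x \<in> {1-\<epsilon><..<1} \<Longrightarrow> D y (of_real x) (of_real t) \<noteq> 0"
proof
  assume y: "y \<in> Y" and x: "x \<in> {1-\<epsilon><..<1}" and "D y (of_real x) (of_real t) = 0"
  hence "of_real x * (1 - g y (of_real t)) = 1"
    by (simp add: D_def algebra_simps)
  hence "norm (of_real x * (1 - g y (of_real t))) = 1" by simp
  moreover have "norm (of_real x * (1 - g y (of_real t))) \<le> x * 1"
    unfolding norm_mult using x \<epsilon> real_bound[OF y, of t] by (intro mult_mono) (auto simp: g_def)
  ultimately show False using x by auto
qed

text \<open>
  The kernel \<open>s\<^sup>m\<^sup>-\<^sup>1 ds\<close> is expressed in the coordinate \<open>u = \<psi>(s)\<close> by contour integrals over the circle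
  instead of the inverse function of \<open>\<psi>\<close>. Up to the factor \<open>1 / z\<close>, the functions \<open>b\<close> and \<open>c\<close> are the values of its even and odd part (the latter
  divided by \<open>u\<close>) at the pole \<open>u\<^sup>2 = (z - 1) / z\<close>, and \<open>K\<close> is the divided difference that remains when the pole is split off.
  Since the circle stays away from the zeros of \<open>D\<close>, all three are holomorphic in \<open>z\<close> near \<open>1\<close>.
\<close>

definition "b y z = circle_mean R (\<lambda>s. s ^ m * \<psi> y s / D y z s)"
definition "c y z = circle_mean R (\<lambda>s. s ^ m / D y z s)"
definition "K y z t = circle_mean R (\<lambda>s. s ^ m * (\<psi> y s + \<psi> y t) / (D y z s * (g y s - g y t)))"

lemma continuous_on_D: "continuous_on S u \<Longrightarrow> continuous_on S w \<Longrightarrow> continuous_on S v \<Longrightarrow> u ` S \<subseteq> Y \<Longrightarrow>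
    continuous_on S (\<lambda>x. D (u x) (w x) (v x))"
  unfolding D_def by (intro continuous_intros continuous_on_g)

lemma continuous_on_bc:
  "continuous_on (Y \<times> U) (\<lambda>x. b (fst x) (snd x))" "continuous_on (Y \<times> U) (\<lambda>x. c (fst x) (snd x))"
  unfolding b_def c_def using radii(1) circle_in_disc D_nz_circle
  by (intro continuous_on_circle_mean continuous_on_divide continuous_on_mult continuous_on_power
        continuous_on_\<psi> continuous_on_D continuous_intros; fastforce)+

lemma continuous_on_K:
  "continuous_on ((Y \<times> U) \<times> {0..\<delta>}) (\<lambda>x. K (fst (fst x)) (snd (fst x)) (of_real (snd x)))"
  unfolding K_def using radii(1) circle_in_disc D_nz_circle g_diff_nz ray_in_disc
  by (intro continuous_on_circle_mean continuous_on_divide continuous_on_mult continuous_on_power continuous_on_add continuous_on_diff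
        continuous_on_\<psi> continuous_on_g continuous_on_D continuous_intros; fastforce)

lemma hol_D: "(\<lambda>z. D y z s) holomorphic_on S"
  unfolding D_def by (intro holomorphic_intros)

lemma holomorphic_bc:
  assumes "y \<in> Y"
  shows "b y holomorphic_on U" "c y holomorphic_on U"
proof -
  have "continuous_on (U \<times> sphere 0 R) (\<lambda>x. D y (fst x) (snd x))"
    using assms by (intro continuous_on_D continuous_intros) auto
  moreover have "continuous_on (U \<times> sphere 0 R) (\<lambda>x. \<psi> y (snd x))"
    using assms circle_in_disc by (intro continuous_on_\<psi> continuous_intros) auto
  ultimately show "b y holomorphic_on U" "c y holomorphic_on U"
    unfolding b_def c_def using radii(1) D_nz_circle[OF assms]
    by (intro holomorphic_on_circle_mean continuous_on_divide continuous_on_mult continuous_on_power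
        holomorphic_on_divide hol_D continuous_intros holomorphic_intros; fastforce)+
qed

lemma holomorphic_K:
  assumes "y \<in> Y" "t \<in> {0..\<delta>}"
  shows "(\<lambda>z. K y z (of_real t)) holomorphic_on U"
proof -
  have "continuous_on (U \<times> sphere 0 R) (\<lambda>x. D y (fst x) (snd x))"
    "continuous_on (U \<times> sphere 0 R) (\<lambda>x. g y (snd x))"
    using assms by (intro continuous_on_D continuous_on_g continuous_intros; auto)+
  moreover have "continuous_on (U \<times> sphere 0 R) (\<lambda>x. \<psi> y (snd x))"
    using assms circle_in_disc by (intro continuous_on_\<psi> continuous_intros) auto
  ultimately show ?thesis
    unfolding K_def using radii(1) D_nz_circle[OF assms(1)] g_diff_nz[OF assms]
    by (intro holomorphic_on_circle_mean continuous_on_divide continuous_on_mult continuous_on_power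
        holomorphic_on_divide holomorphic_on_mult hol_D continuous_intros holomorphic_intros; fastforce)
qed


text \<open>
  Cauchy's formula for \<open>s\<^sup>m\<^sup>-\<^sup>1 (s - t) / (\<psi>(s) - \<psi>(t))\<close>, which is holomorphic because \<open>\<psi>\<close> is injective, with value
  \<open>t\<^sup>m\<^sup>-\<^sup>1 / \<psi>'(t)\<close> at \<open>s = t\<close>. Writing \<open>1 / (\<psi>(s) - \<psi>(t))\<close> as \<open>(\<psi>(s) + \<psi>(t)) / (g(s) - g(t))\<close> separates the even and
  odd part in \<open>\<psi>(t)\<close>.
\<close>

lemma Cauchy_ray:
  assumes y: "y \<in> Y" and t: "t \<in> {0..\<delta>}"
  shows "\<psi>' y (of_real t) * circle_mean R (\<lambda>s. s ^ m * (\<psi> y s + \<psi> y (of_real t)) / (g y s - g y (of_real t)))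
    = of_real t ^ (m - 1)"
proof -
  define w where "w = complex_of_real t"
  have w: "w \<in> ball 0 R" "w \<in> ball 0 R'" using ray_in_disc[OF t] by (auto simp: w_def)
  \<comment> \<open>The difference quotient of \<open>\<psi>\<close>, with the removable singularity at \<open>w\<close> filled in.\<close>
  define d where "d s = (if s = w then deriv (\<psi> y) w else (\<psi> y s - \<psi> y w) / (s - w))" for s
  have d_hol: "d holomorphic_on ball 0 R'"
    unfolding d_def by (rule pole_lemma_open[OF \<psi>_holomorphic[OF y] open_ball])
  have dw: "d w = \<psi>' y w"
    using DERIV_imp_deriv[OF \<psi>_deriv[OF y w(2)]] by (simp add: d_def)
  have d_nz: "d s \<noteq> 0" if "s \<in> ball 0 R'" for s
    using \<psi>'_nz[OF y w(2)] dw inj_onD[OF inj[OF y] _ that w(2)] by (cases "s = w") (auto simp: d_def)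
  define f where "f s = s ^ (m - 1) / d s" for s
  have "f holomorphic_on ball 0 R'"
    unfolding f_def using d_nz by (intro holomorphic_intros d_hol)
  from circle_mean_Cauchy[OF this radii(1,2) w(1)]
  have "circle_mean R (\<lambda>s. f s * s / (s - w)) = w ^ (m - 1) / \<psi>' y w"
    by (simp add: f_def dw)
  moreover have "circle_mean R (\<lambda>s. f s * s / (s - w)) = circle_mean R (\<lambda>s. s ^ m * (\<psi> y s + \<psi> y w) / (g y s - g y w))"
  proof (rule circle_mean_cong[OF radii(1)])
    fix s :: complex assume s: "s \<in> sphere 0 R"
    have sw: "s - w \<noteq> 0" using s w(1) by auto
    have "g y s - g y w = (\<psi> y s - \<psi> y w) * (\<psi> y s + \<psi> y w)"
      by (simp add: g_eq power2_eq_square algebra_simps)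
    moreover from this g_diff_nz[OF y t s] have "\<psi> y s - \<psi> y w \<noteq> 0" "\<psi> y s + \<psi> y w \<noteq> 0"
      by (auto simp: w_def)
    moreover have "s ^ m = s ^ (m - 1) * s" using m by (metis power_minus_mult)
    ultimately show "f s * s / (s - w) = s ^ m * (\<psi> y s + \<psi> y w) / (g y s - g y w)"
      using sw by (simp add: f_def d_def)
  qed
  ultimately show ?thesis
    using \<psi>'_nz[OF y w(2)] by (simp add: w_def[symmetric])
qed

lemma Re_D_pos: "y \<in> Y \<Longrightarrow> x \<in> {1-\<epsilon><..<1} \<Longrightarrow> Re (D y (of_real x) (of_real t)) > 0"
proof -
  assume y: "y \<in> Y" and x: "x \<in> {1-\<epsilon><..<1}"
  have "Re (of_real x * (1 - g y (of_real t))) \<le> norm (of_real x * (1 - g y (of_real t)))"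
    by (rule complex_Re_le_cmod)
  also have "\<dots> \<le> x * 1"
    unfolding norm_mult using x \<epsilon> real_bound[OF y, of t] by (intro mult_mono) (auto simp: g_def)
  finally show ?thesis using x by (simp add: D_def algebra_simps)
qed

lemma real_in_U: "x \<in> {1-\<epsilon><..<1} \<Longrightarrow> complex_of_real x \<in> U"
proof -
  assume "x \<in> {1-\<epsilon><..<1}"
  moreover have "dist 1 (complex_of_real x) = \<bar>1 - x\<bar>"
    unfolding dist_norm by (metis norm_of_real of_real_1 of_real_diff)
  ultimately show ?thesis by auto
qed

lemma continuous_on_circle_kernels:
  assumes "y \<in> Y" "z \<in> U" "t \<in> {0..\<delta>}"
  shows "continuous_on (sphere 0 R) (\<lambda>s. s ^ m * \<psi> y s / D y z s)" "continuous_on (sphere 0 R) (\<lambda>s. s ^ m / D y z s)"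
    "continuous_on (sphere 0 R) (\<lambda>s. s ^ m * (\<psi> y s + \<psi> y (of_real t)) / (D y z s * (g y s - g y (of_real t))))"
proof -
  have "continuous_on (sphere 0 R) (D y z)" "continuous_on (sphere 0 R) (g y)"
    using assms by (intro continuous_on_D[where w = "\<lambda>_. z" and u = "\<lambda>_. y"] continuous_on_g[where u = "\<lambda>_. y"] continuous_intros; auto)+
  moreover have "continuous_on (sphere 0 R) (\<psi> y)"
    using assms circle_in_disc by (intro continuous_on_\<psi>[where u = "\<lambda>_. y"] continuous_intros) auto
  ultimately show "continuous_on (sphere 0 R) (\<lambda>s. s ^ m * \<psi> y s / D y z s)" "continuous_on (sphere 0 R) (\<lambda>s. s ^ m / D y z s)"
    "continuous_on (sphere 0 R) (\<lambda>s. s ^ m * (\<psi> y s + \<psi> y (of_real t)) / (D y z s * (g y s - g y (of_real t))))"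
    using D_nz_circle[OF assms(1,2)] g_diff_nz[OF assms(1,3)]
    by (auto intro!: continuous_on_divide continuous_on_mult continuous_on_power continuous_on_add continuous_on_diff continuous_on_const continuous_on_id)
qed

text \<open>
  The denominator in \<open>Cauchy_ray\<close> and the one in the radial integral combine by
  \<open>1 / ((g(s) - g(t)) D(t)) = (1 / (g(s) - g(t)) + z / D(t)) / D(s)\<close>, a consequence of \<open>D(s) - D(t) = z (g(s) - g(t))\<close>. In the
  first summand the pole at \<open>D(t) = 0\<close> has disappeared; the second has the elementary primitives computed below.
\<close>

lemma ray_integrand:
  assumes y: "y \<in> Y" and t: "t \<in> {0..\<delta>}" and x: "x \<in> {1-\<epsilon><..<1}"
  shows "of_real t ^ (m - 1) / D y (of_real x) (of_real t) = \<psi>' y (of_real t) * K y (of_real x) (of_real t)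
    + (of_real x * \<psi>' y (of_real t) / D y (of_real x) (of_real t)) * b y (of_real x)
    + (of_real x * \<psi> y (of_real t) * \<psi>' y (of_real t) / D y (of_real x) (of_real t)) * c y (of_real x)"
proof -
  define w where "w = complex_of_real t"
  define z where "z = complex_of_real x"
  have z: "z \<in> U" using real_in_U[OF x] by (simp add: z_def)
  have Dw: "D y z w \<noteq> 0" using D_nz_real[OF y x] by (simp add: z_def w_def)
  note cont = continuous_on_circle_kernels[OF y z t, folded w_def]
  have "1 / D y z w * circle_mean R (\<lambda>s. s ^ m * (\<psi> y s + \<psi> y w) / (g y s - g y w))
      = circle_mean R (\<lambda>s. 1 / D y z w * (s ^ m * (\<psi> y s + \<psi> y w) / (g y s - g y w)))"
    by (rule circle_mean_mult[symmetric])
  also have "\<dots> = circle_mean R (\<lambda>s. s ^ m * (\<psi> y s + \<psi> y w) / (D y z s * (g y s - g y w))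
      + (z / D y z w * (s ^ m * \<psi> y s / D y z s) + z * \<psi> y w / D y z w * (s ^ m / D y z s)))"
  proof (rule circle_mean_cong[OF radii(1)])
    fix s :: complex assume s: "s \<in> sphere 0 R"
    have nz: "D y z s \<noteq> 0" "g y s - g y w \<noteq> 0"
      using D_nz_circle[OF y z s] g_diff_nz[OF y t s] by (auto simp: w_def)
    have *: "1 / (D y z w * G) = 1 / (D y z s * G) + z / (D y z w * D y z s)" if "G = g y s - g y w" for G
    proof -
      have "D y z s = D y z w + z * G" unfolding D_def that by (simp add: algebra_simps)
      moreover have "1 / (p * G) = 1 / (r * G) + z / (p * r)"
        if "p \<noteq> 0" "r \<noteq> 0" "G \<noteq> 0" "r = p + z * G" for p r :: complex
      proof -
        have "1 / (r * G) + z / (p * r) = (p + z * G) / (p * r * G)"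
          using that(1-3) by (simp add: add_frac_eq) (simp add: field_simps)
        thus ?thesis using that by simp
      qed
      ultimately show ?thesis using nz Dw unfolding that by blast
    qed
    from this[OF refl] show "1 / D y z w * (s ^ m * (\<psi> y s + \<psi> y w) / (g y s - g y w))
        = s ^ m * (\<psi> y s + \<psi> y w) / (D y z s * (g y s - g y w))
        + (z / D y z w * (s ^ m * \<psi> y s / D y z s) + z * \<psi> y w / D y z w * (s ^ m / D y z s))"
      (is "1 / ?p * (?n / ?q) = ?n / (?r * ?q) + ?rest")
    proof -
      have "1 / ?p * (?n / ?q) = ?n * (1 / (?p * ?q))" by simp
      also have "\<dots> = ?n * (1 / (?r * ?q)) + ?n * (z / (?p * ?r))"
        unfolding *[OF refl] by (rule distrib_left)
      also have "?n * (z / (?p * ?r)) = ?rest"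
        by (simp add: add_divide_distrib distrib_left distrib_right mult_ac)
      finally show ?thesis by simp
    qed
  qed
  also have "\<dots> = K y z w + (z / D y z w * b y z + z * \<psi> y w / D y z w * c y z)"
    unfolding K_def b_def c_def circle_mean_mult[symmetric]
    by (subst circle_mean_add[OF radii(1)]; (intro continuous_on_add continuous_on_mult continuous_on_const cont)?)+ simp
  finally have *: "1 / D y z w * circle_mean R (\<lambda>s. s ^ m * (\<psi> y s + \<psi> y w) / (g y s - g y w))
      = K y z w + (z / D y z w * b y z + z * \<psi> y w / D y z w * c y z)" .
  have "w ^ (m - 1) / D y z w = \<psi>' y w * (1 / D y z w * circle_mean R (\<lambda>s. s ^ m * (\<psi> y s + \<psi> y w) / (g y s - g y w)))"
    using Cauchy_ray[OF y t] by (simp add: w_def)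
  also have "\<dots> = \<psi>' y w * K y z w + (z * \<psi>' y w / D y z w) * b y z + (z * \<psi> y w * \<psi>' y w / D y z w) * c y z"
    unfolding * by (simp add: distrib_left mult_ac)
  finally show ?thesis by (simp add: w_def z_def)
qed

lemma Re_\<psi>: "y \<in> Y \<Longrightarrow> t \<in> {0..\<delta>} \<Longrightarrow> t = 0 \<or> Re (\<psi> y (of_real t)) > 0"
  using Re_r_pos[OF _ ray_in_disc(2), of y t] by (auto simp: \<psi>_def zero_less_mult_iff)

lemma continuous_on_ray:
  assumes y: "y \<in> Y"
  shows "continuous_on {0..\<delta>} (\<lambda>t. \<psi> y (of_real t))" "continuous_on {0..\<delta>} (\<lambda>t. \<psi>' y (of_real t))"
    "continuous_on {0..\<delta>} (\<lambda>t. D y z (of_real t))"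
  using y ray_in_disc
  by (auto intro!: continuous_on_\<psi>[where u = "\<lambda>_. y"] continuous_on_\<psi>'[where u = "\<lambda>_. y"]
       continuous_on_D[where u = "\<lambda>_. y" and w = "\<lambda>_. z"] continuous_intros)

text \<open>
  For real \<open>x < 1\<close> close to one the integrals are computed with real square roots and principal values. Other \<open>z\<close> are
  reached only at the very end, by the identity theorem.
\<close>

definition "slope x = complex_of_real (sqrt (x / (1 - x)))"

lemma slope:
  assumes "x \<in> {1-\<epsilon><..<1}"
  shows "(slope x)\<^sup>2 = of_real x / (1 - of_real x)" "slope x \<noteq> 0" "slope x = csqrt (of_real x) / csqrt (1 - of_real x)"
    and "Re w > 0 \<Longrightarrow> Re (slope x * w) > 0" "Re w > 0 \<Longrightarrow> Re (1 / (slope x * w)) > 0"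
proof -
  have x: "0 < x" "x < 1" using assms \<epsilon> by auto
  show "(slope x)\<^sup>2 = of_real x / (1 - of_real x)"
    using x by (simp add: slope_def flip: of_real_power)
  show nz: "slope x \<noteq> 0" using x by (simp add: slope_def)
  have "csqrt (1 - of_real x) = of_real (sqrt (1 - x))"
    using x by (metis csqrt_of_real diff_ge_0_iff_ge less_imp_le of_real_1 of_real_diff)
  thus "slope x = csqrt (of_real x) / csqrt (1 - of_real x)"
    using x by (simp add: slope_def real_sqrt_divide csqrt_of_real)
  have p: "sqrt (x / (1 - x)) > 0" using x by simp
  show *: "Re (slope x * w) > 0" if "Re w > 0" for w
    using that p by (simp add: slope_def)
  show "Re (1 / (slope x * w)) > 0" if "Re w > 0" for w
    using *[OF that] by (auto simp: Re_divide sum_power2_gt_zero_iff)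
qed

text \<open>
  The substitution \<open>u = \<psi>(t)\<close>: the primitive of \<open>x / (1 - x + x u\<^sup>2)\<close> is a multiple of \<open>Arctan (slope x * u)\<close>.
\<close>

lemma sqrt_integral:
  assumes y: "y \<in> Y" and x: "x \<in> {1-\<epsilon><..<1}"
  shows "(\<integral>t. indicat_real {0..\<delta>} t *\<^sub>R (of_real x * \<psi>' y (of_real t) / D y (of_real x) (of_real t)) \<partial>lborel)
    = slope x * Arctan (slope x * \<psi> y (of_real \<delta>))"
proof -
  let ?F = "\<lambda>s. slope x * Arctan (slope x * \<psi> y s)"
  have "(\<integral>t. indicat_real {0..\<delta>} t *\<^sub>R (of_real x * \<psi>' y (of_real t) / D y (of_real x) (of_real t)) \<partial>lborel)
      = ?F (of_real \<delta>) - ?F (of_real 0)"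
  proof (rule integral_FTC_Icc)
    fix t assume "0 \<le> t" "t \<le> \<delta>"
    hence t: "t \<in> {0..\<delta>}" by simp
    have "(?F has_field_derivative slope x * (inverse (1 + (slope x * \<psi> y (of_real t))\<^sup>2) * (slope x * \<psi>' y (of_real t)))) (at (of_real t))"
    proof (intro DERIV_cmult DERIV_chain2[OF has_field_derivative_Arctan] \<psi>_deriv y ray_in_disc t)
      assume 0: "Re (slope x * \<psi> y (of_real t)) = 0"
      have "t = 0" using Re_\<psi>[OF y t] slope(4)[OF x, of "\<psi> y (of_real t)"] 0 by auto
      thus "\<bar>Im (slope x * \<psi> y (of_real t))\<bar> < 1" by (simp add: \<psi>_def)
    qed
    moreover have "slope x * (inverse (1 + (slope x * \<psi> y (of_real t))\<^sup>2) * (slope x * \<psi>' y (of_real t)))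
        = of_real x * \<psi>' y (of_real t) / D y (of_real x) (of_real t)"
    proof -
      have nz: "1 - complex_of_real x \<noteq> 0" using x by auto
      have "D y (of_real x) (of_real t) = (1 - of_real x) * (1 + (slope x * \<psi> y (of_real t))\<^sup>2)"
        using nz by (simp add: D_def g_eq power_mult_distrib slope(1)[OF x] distrib_left)
      hence "of_real x * \<psi>' y (of_real t) / D y (of_real x) (of_real t)
          = of_real x / (1 - of_real x) * \<psi>' y (of_real t) * inverse (1 + (slope x * \<psi> y (of_real t))\<^sup>2)"
        by (simp add: divide_inverse mult_ac)
      thus ?thesis unfolding slope(1)[OF x, symmetric] by (simp add: power2_eq_square mult_ac)
    qed
    ultimately show "((\<lambda>t. ?F (of_real t)) has_vector_derivative of_real x * \<psi>' y (of_real t) / D y (of_real x) (of_real t)) (at t within {0..\<delta>})"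
      by (intro has_vector_derivative_real_field) simp
  next
    show "continuous_on {0..\<delta>} (\<lambda>t. of_real x * \<psi>' y (of_real t) / D y (of_real x) (of_real t))"
      using D_nz_real[OF y x] by (intro continuous_on_divide continuous_on_mult continuous_on_const continuous_on_ray y) auto
  qed (use radii in auto)
  thus ?thesis by (simp add: \<psi>_def)
qed

lemma log_integral:
  assumes y: "y \<in> Y" and x: "x \<in> {1-\<epsilon><..<1}"
  shows "(\<integral>t. indicat_real {0..\<delta>} t *\<^sub>R (of_real x * \<psi> y (of_real t) * \<psi>' y (of_real t) / D y (of_real x) (of_real t)) \<partial>lborel)
    = (Ln (D y (of_real x) (of_real \<delta>)) - Ln (1 - of_real x)) / 2"
proof -
  let ?F = "\<lambda>s. Ln (D y (of_real x) s) / 2"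
  have "(\<integral>t. indicat_real {0..\<delta>} t *\<^sub>R (of_real x * \<psi> y (of_real t) * \<psi>' y (of_real t) / D y (of_real x) (of_real t)) \<partial>lborel)
      = ?F (of_real \<delta>) - ?F (of_real 0)"
  proof (rule integral_FTC_Icc)
    fix t assume "0 \<le> t" "t \<le> \<delta>"
    hence t: "t \<in> {0..\<delta>}" by simp
    have np: "D y (of_real x) (of_real t) \<notin> \<real>\<^sub>\<le>\<^sub>0"
      using Re_D_pos[OF y x, of t] by (auto simp: complex_nonpos_Reals_iff)
    have "(D y (of_real x) has_field_derivative of_real x * (2 * \<psi> y (of_real t) * \<psi>' y (of_real t))) (at (of_real t))"
      unfolding D_def g_eq by (rule derivative_eq_intros \<psi>_deriv y ray_in_disc t refl)+ simp
    hence "(?F has_field_derivative of_real x * \<psi> y (of_real t) * \<psi>' y (of_real t) / D y (of_real x) (of_real t)) (at (of_real t))"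
      using np by (auto intro!: derivative_eq_intros simp: field_simps)
    thus "((\<lambda>t. ?F (of_real t)) has_vector_derivative of_real x * \<psi> y (of_real t) * \<psi>' y (of_real t) / D y (of_real x) (of_real t)) (at t within {0..\<delta>})"
      by (rule has_vector_derivative_real_field)
  next
    show "continuous_on {0..\<delta>} (\<lambda>t. of_real x * \<psi> y (of_real t) * \<psi>' y (of_real t) / D y (of_real x) (of_real t))"
      using D_nz_real[OF y x] by (intro continuous_on_divide continuous_on_mult continuous_on_const continuous_on_ray y) auto
  qed (use radii in auto)
  thus ?thesis by (simp add: D_def g_def diff_divide_distrib)
qed

text \<open>
  This is the integral of \<open>z / (1 - z + z u\<^sup>2)\<close> from the end of the ray to infinity, after \<open>u \<mapsto> \<psi>(\<delta>) / t\<close>. It complements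
  the integral along the ray to the integral over a half-line, which equals \<open>slope x * \<pi> / 2\<close>, and it is holomorphic in \<open>z\<close>
  near \<open>1\<close>.
\<close>

definition "tail y z = (\<integral>t. indicat_real {0..1} t *\<^sub>R
  (z * \<psi> y (of_real \<delta>) / ((1 - z) * (of_real t)\<^sup>2 + z * g y (of_real \<delta>))) \<partial>lborel)"

lemma tail_denominator_nz:
  assumes "y \<in> Y" "z \<in> U" "t \<in> {0..1}"
  shows "(1 - z) * (of_real t)\<^sup>2 + z * g y (of_real \<delta>) \<noteq> 0"
proof
  assume "(1 - z) * (of_real t)\<^sup>2 + z * g y (of_real \<delta>) = 0"
  hence "norm (z * g y (of_real \<delta>)) = norm ((1 - z) * (of_real t)\<^sup>2)"
    by (metis add_eq_0_iff norm_minus_cancel)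
  moreover have z: "norm (1 - z) < \<epsilon>" using assms(2) by (simp add: dist_norm)
  moreover have "norm z \<ge> 1 / 2"
    using norm_triangle_ineq2[of 1 "1 - z"] z \<epsilon> by simp
  moreover have "norm (g y (of_real \<delta>)) \<ge> 4 * \<epsilon>"
    using g_end[OF assms(1)] complex_Re_le_cmod order_trans by blast
  ultimately have "1 / 2 * (4 * \<epsilon>) \<le> norm (1 - z) * norm ((complex_of_real t)\<^sup>2)"
    unfolding norm_mult by (metis \<epsilon>(1) mult_mono mult_nonneg_nonneg norm_ge_zero zero_le_numeral less_imp_le)
  also have "\<dots> \<le> norm (1 - z) * 1"
    using assms(3) by (intro mult_left_mono) (auto simp: norm_power power_le_one)
  finally show False using z \<epsilon> by simp
qed

lemma tail_eq:
  assumes y: "y \<in> Y" and x: "x \<in> {1-\<epsilon><..<1}"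
  shows "slope x * Arctan (1 / (slope x * \<psi> y (of_real \<delta>))) = tail y (of_real x)"
proof -
  define P where "P = \<psi> y (of_real \<delta>)"
  have P: "Re P > 0" using Re_\<psi>[OF y, of \<delta>] radii by (auto simp: P_def)
  hence Pnz: "P \<noteq> 0" by auto
  let ?F = "\<lambda>s. slope x * Arctan (s * (1 / (slope x * P)))"
  have "(\<integral>t. indicat_real {0..1} t *\<^sub>R (of_real x * P / ((1 - of_real x) * (of_real t)\<^sup>2 + of_real x * P\<^sup>2)) \<partial>lborel)
      = ?F (of_real 1) - ?F (of_real 0)"
  proof (rule integral_FTC_Icc)
    fix t :: real assume t: "0 \<le> t" "t \<le> 1"
    have "(?F has_field_derivative slope x * (inverse (1 + (of_real t * (1 / (slope x * P)))\<^sup>2) * (1 / (slope x * P)))) (at (of_real t))"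
    proof (intro DERIV_cmult DERIV_chain2[OF has_field_derivative_Arctan])
      assume "Re (of_real t * (1 / (slope x * P))) = 0"
      moreover have "Re (of_real t * w) = t * Re w" for w by simp
      ultimately have "t = 0" using slope(5)[OF x P] by (metis less_irrefl mult_eq_0_iff)
      thus "\<bar>Im (of_real t * (1 / (slope x * P)))\<bar> < 1" by simp
    qed (auto intro!: derivative_eq_intros simp: slope(2)[OF x] Pnz)
    moreover have "slope x * (inverse (1 + (of_real t * (1 / (slope x * P)))\<^sup>2) * (1 / (slope x * P)))
        = of_real x * P / ((1 - of_real x) * (of_real t)\<^sup>2 + of_real x * P\<^sup>2)"
    proof -
      have nz: "1 - complex_of_real x \<noteq> 0" "complex_of_real x \<noteq> 0" using x \<epsilon> by auto
      have d: "(1 - of_real x) * (of_real t)\<^sup>2 + of_real x * P\<^sup>2 \<noteq> 0"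
        using tail_denominator_nz[OF y real_in_U[OF x], of t] t by (simp add: P_def g_eq)
      have "1 + (of_real t * (1 / (slope x * P)))\<^sup>2 = ((1 - of_real x) * (of_real t)\<^sup>2 + of_real x * P\<^sup>2) / (of_real x * P\<^sup>2)"
        using nz Pnz by (simp add: power_mult_distrib power_divide slope(1)[OF x] field_simps)
      thus ?thesis using slope(2)[OF x] Pnz d nz by (simp add: power2_eq_square)
    qed
    ultimately show "((\<lambda>t. ?F (of_real t)) has_vector_derivative of_real x * P / ((1 - of_real x) * (of_real t)\<^sup>2 + of_real x * P\<^sup>2)) (at t within {0..1})"
      by (intro has_vector_derivative_real_field) simp
  next
    show "continuous_on {0..1} (\<lambda>t::real. of_real x * P / ((1 - of_real x) * (of_real t)\<^sup>2 + of_real x * P\<^sup>2))"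
      using tail_denominator_nz[OF y real_in_U[OF x]]
      by (intro continuous_intros) (simp add: P_def g_eq)
  qed auto
  thus ?thesis by (simp add: tail_def P_def g_eq)
qed


definition "e y z = (\<integral>t. indicat_real {0..\<delta>} t *\<^sub>R (\<psi>' y (of_real t) * K y z (of_real t)) \<partial>lborel)"

text \<open>
  The only terms that are singular at \<open>x = 1\<close> are the explicit square root and logarithm.
\<close>

lemma ray_integral:
  assumes y: "y \<in> Y" and x: "x \<in> {1-\<epsilon><..<1}"
  shows "(\<integral>t. indicat_real {0..\<delta>} t *\<^sub>R (of_real t ^ (m - 1) / D y (of_real x) (of_real t)) \<partial>lborel)
    = e y (of_real x) + b y (of_real x) * (slope x * of_real (pi / 2) - tail y (of_real x))
      + c y (of_real x) * ((Ln (D y (of_real x) (of_real \<delta>)) - Ln (1 - of_real x)) / 2)"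
proof -
  let ?z = "complex_of_real x"
  let ?f1 = "\<lambda>t. \<psi>' y (of_real t) * K y ?z (of_real t)"
  let ?f2 = "\<lambda>t. of_real x * \<psi>' y (of_real t) / D y ?z (of_real t)"
  let ?f3 = "\<lambda>t. of_real x * \<psi> y (of_real t) * \<psi>' y (of_real t) / D y ?z (of_real t)"
  let ?i = "indicat_real {0..\<delta>}"
  note iw = integrable_weighted[OF integrable_indicator_unit, where K = "{0..\<delta>}", OF _ compact_Icc]
  have "continuous_on {0..\<delta>} (\<lambda>t. K y ?z (of_real t))"
    using y real_in_U[OF x]
    by (intro continuous_on_compose2[OF continuous_on_K, of _ "\<lambda>t. ((y, ?z), t)", simplified]) (auto intro!: continuous_intros)
  hence i1: "integrable lborel (\<lambda>t. ?i t *\<^sub>R ?f1 t)"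
    by (intro iw continuous_on_mult continuous_on_ray y) auto
  have i2: "integrable lborel (\<lambda>t. ?i t *\<^sub>R ?f2 t)" and i3: "integrable lborel (\<lambda>t. ?i t *\<^sub>R ?f3 t)"
    using D_nz_real[OF y x]
    by (intro iw continuous_on_divide continuous_on_mult continuous_on_const continuous_on_ray y; auto)+
  have "(\<integral>t. ?i t *\<^sub>R (of_real t ^ (m - 1) / D y ?z (of_real t)) \<partial>lborel)
      = (\<integral>t. ?i t *\<^sub>R ?f1 t + (b y ?z * (?i t *\<^sub>R ?f2 t) + c y ?z * (?i t *\<^sub>R ?f3 t)) \<partial>lborel)"
  proof (rule Bochner_Integration.integral_cong[OF refl])
    fix t
    show "?i t *\<^sub>R (of_real t ^ (m - 1) / D y ?z (of_real t)) = ?i t *\<^sub>R ?f1 t + (b y ?z * (?i t *\<^sub>R ?f2 t) + c y ?z * (?i t *\<^sub>R ?f3 t))"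
      using ray_integrand[OF y _ x, of t] by (cases "t \<in> {0..\<delta>}") (auto simp: mult.commute)
  qed
  also have "\<dots> = e y ?z + (b y ?z * (slope x * Arctan (slope x * \<psi> y (of_real \<delta>)))
      + c y ?z * ((Ln (D y ?z (of_real \<delta>)) - Ln (1 - ?z)) / 2))"
    unfolding sqrt_integral[OF y x, symmetric] log_integral[OF y x, symmetric] e_def
    by (rule integral_linear_combination[OF i1 i2 i3])
  also have "slope x * Arctan (slope x * \<psi> y (of_real \<delta>)) = slope x * of_real (pi / 2) - tail y ?z"
  proof -
    have "Re (slope x * \<psi> y (of_real \<delta>)) > 0"
      using Re_\<psi>[OF y, of \<delta>] radii slope(4)[OF x] by auto
    from Arctan_add_Arctan_inverse[OF this]
    have "Arctan (slope x * \<psi> y (of_real \<delta>)) = of_real (pi / 2) - Arctan (1 / (slope x * \<psi> y (of_real \<delta>)))"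
      by (simp add: eq_diff_eq)
    thus ?thesis unfolding tail_eq[OF y x, symmetric] by (simp add: right_diff_distrib)
  qed
  finally show ?thesis by (simp add: add.assoc)
qed

lemma \<delta>_mem: "\<delta> \<in> {0..\<delta>}" "complex_of_real \<delta> \<in> ball 0 R'"
  using radii by auto

text \<open>
  The logarithm at the end of the ray is a regular term: \<open>D = g - (z - 1) (1 - g)\<close> there, and \<open>Re g\<close> dominates.
\<close>

lemma D_end_not_nonpos: "y \<in> Y \<Longrightarrow> z \<in> U \<Longrightarrow> D y z (of_real \<delta>) \<notin> \<real>\<^sub>\<le>\<^sub>0"
proof -
  assume y: "y \<in> Y" and z: "z \<in> U"
  have "norm ((z - 1) * (1 - g y (of_real \<delta>))) \<le> \<epsilon> * 1"
    unfolding norm_mult using z real_bound[OF y, of \<delta>]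
    using \<epsilon>(1) by (intro mult_mono) (auto simp: g_def dist_norm norm_minus_commute)
  hence "\<bar>Re ((z - 1) * (1 - g y (of_real \<delta>)))\<bar> \<le> \<epsilon>"
    using abs_Re_le_cmod[of "(z - 1) * (1 - g y (of_real \<delta>))"] by linarith
  moreover have "D y z (of_real \<delta>) = g y (of_real \<delta>) - (z - 1) * (1 - g y (of_real \<delta>))"
    by (simp add: D_def algebra_simps)
  ultimately have "Re (D y z (of_real \<delta>)) > 0"
    using g_end[OF y] \<epsilon> by simp
  thus ?thesis by (auto simp: complex_nonpos_Reals_iff)
qed

lemma continuous_on_regular_part:
  "continuous_on (Y \<times> U) (\<lambda>x. e (fst x) (snd x) - b (fst x) (snd x) * tail (fst x) (snd x)
      + c (fst x) (snd x) * Ln (D (fst x) (snd x) (of_real \<delta>)) / 2)"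
proof -
  have "continuous_on ((Y \<times> U) \<times> {0..\<delta>}) (\<lambda>x. \<psi>' (fst (fst x)) (of_real (snd x)))"
    using ray_in_disc by (intro continuous_on_\<psi>' continuous_intros) auto
  hence "continuous_on (Y \<times> U) (\<lambda>x. e (fst x) (snd x))"
    unfolding e_def
    by (intro continuous_on_weighted_integral[OF integrable_indicator_unit, where K = "{0..\<delta>}"] continuous_on_mult continuous_on_K) auto
  moreover have "continuous_on (Y \<times> U) (\<lambda>x. tail (fst x) (snd x))"
  proof -
    have "continuous_on ((Y \<times> U) \<times> {0..1::real}) (\<lambda>x. \<psi> (fst (fst x)) (of_real \<delta>))"
      "continuous_on ((Y \<times> U) \<times> {0..1::real}) (\<lambda>x. g (fst (fst x)) (of_real \<delta>))"
      using \<delta>_mem by (intro continuous_on_\<psi> continuous_on_g continuous_intros; force)+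
    thus ?thesis
      unfolding tail_def using tail_denominator_nz
      by (intro continuous_on_weighted_integral[OF integrable_indicator_unit, where K = "{0..1}"]
           continuous_on_divide continuous_on_mult continuous_on_add continuous_on_diff continuous_on_power
           continuous_on_const continuous_on_fst continuous_on_snd continuous_on_id continuous_on_of_real) auto
  qed
  moreover have "continuous_on (Y \<times> U) (\<lambda>x. Ln (D (fst x) (snd x) (of_real \<delta>)))"
    using D_end_not_nonpos
    by (intro continuous_on_compose2[OF continuous_on_Ln[of "- \<real>\<^sub>\<le>\<^sub>0"] continuous_on_D] continuous_intros) auto
  ultimately show ?thesis
    by (intro continuous_on_add continuous_on_diff continuous_on_mult continuous_on_divide continuous_on_const continuous_on_bc) auto
qed

lemma holomorphic_regular_part:
  assumes y: "y \<in> Y"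
  shows "(\<lambda>z. e y z - b y z * tail y z + c y z * Ln (D y z (of_real \<delta>)) / 2) holomorphic_on U"
proof -
  have "(\<lambda>z. e y z) holomorphic_on U"
    unfolding e_def
  proof (rule holomorphic_on_weighted_integral[OF integrable_indicator_unit, where K = "{0..\<delta>}"])
    have "continuous_on (U \<times> {0..\<delta>}) (\<lambda>x. K y (fst x) (of_real (snd x)))"
      using y by (intro continuous_on_compose2[OF continuous_on_K, of _ "\<lambda>x. ((y, fst x), snd x)", simplified])
        (auto intro!: continuous_intros)
    moreover have "continuous_on (U \<times> {0..\<delta>}) (\<lambda>x. \<psi>' y (of_real (snd x)))"
      using ray_in_disc y by (intro continuous_on_\<psi>'[where u = "\<lambda>_. y"] continuous_intros) auto
    ultimately show "continuous_on (U \<times> {0..\<delta>}) (\<lambda>x. \<psi>' y (of_real (snd x)) * K y (fst x) (of_real (snd x)))"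
      by (intro continuous_on_mult)
    show "(\<lambda>z. \<psi>' y (of_real t) * K y z (of_real t)) holomorphic_on U" if "t \<in> {0..\<delta>}" for t
      by (intro holomorphic_on_mult holomorphic_on_const holomorphic_K y that)
  qed auto
  moreover have "(\<lambda>z. tail y z) holomorphic_on U"
    unfolding tail_def
  proof (rule holomorphic_on_weighted_integral[OF integrable_indicator_unit, where K = "{0..1}"])
    show "continuous_on (U \<times> {0..1::real}) (\<lambda>x. fst x * \<psi> y (of_real \<delta>) / ((1 - fst x) * (of_real (snd x))\<^sup>2 + fst x * g y (of_real \<delta>)))"
      using tail_denominator_nz[OF y]
      by (intro continuous_on_divide continuous_on_mult continuous_on_add continuous_on_diff continuous_on_power
           continuous_on_const continuous_on_fst continuous_on_snd continuous_on_id continuous_on_of_real) auto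
    show "(\<lambda>z. z * \<psi> y (of_real \<delta>) / ((1 - z) * (of_real t)\<^sup>2 + z * g y (of_real \<delta>))) holomorphic_on U" if "t \<in> {0..1}" for t
      using tail_denominator_nz[OF y _ that] by (intro holomorphic_intros)
  qed auto
  moreover have "(\<lambda>z. Ln (D y z (of_real \<delta>))) holomorphic_on U"
    using D_end_not_nonpos[OF y] by (intro holomorphic_on_compose_gen[OF hol_D holomorphic_on_Ln[of "- \<real>\<^sub>\<le>\<^sub>0"], unfolded o_def]) auto
  ultimately show ?thesis
    by (intro holomorphic_on_add holomorphic_on_diff holomorphic_on_mult holomorphic_on_divide holomorphic_on_const holomorphic_bc y) auto
qed

lemma integrable_indicator_Y: "integrable lborel (indicat_real Y)"
  using Y(1) emeasure_compact_finite[OF Y(1)] by (simp add: integrable_indicator_iff borel_compact)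

text \<open>
  The regular part and the coefficients of \<open>1 / \<surd>(1 - z)\<close> and \<open>log (1 - z)\<close>.
\<close>

definition "A z = (\<integral>y. indicat_real Y y *\<^sub>R (e y z - b y z * tail y z + c y z * Ln (D y z (of_real \<delta>)) / 2) \<partial>lborel)"
definition "B z = csqrt z * of_real (pi / 2) * (\<integral>y. indicat_real Y y *\<^sub>R b y z \<partial>lborel)"
definition "C z = - (\<integral>y. indicat_real Y y *\<^sub>R c y z \<partial>lborel) / 2"

lemma U_swap:
  assumes "continuous_on (Y \<times> U) (\<lambda>x. F (fst x) (snd x))"
  shows "continuous_on (U \<times> Y) (\<lambda>x. F (snd x) (fst x))"
proof -
  have "continuous_on (U \<times> Y) (\<lambda>x. (snd x, fst x))" by (intro continuous_intros)
  moreover have "(\<lambda>x. (snd x, fst x)) ` (U \<times> Y) \<subseteq> Y \<times> U" by auto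
  ultimately show ?thesis using continuous_on_compose2[OF assms] by fastforce
qed

lemma U_not_nonpos: "z \<in> U \<Longrightarrow> z \<notin> \<real>\<^sub>\<le>\<^sub>0" "z \<in> U \<Longrightarrow> z \<noteq> 0"
proof -
  assume "z \<in> U"
  hence "\<bar>Re (1 - z)\<bar> < 1"
    using \<epsilon> abs_Re_le_cmod[of "1 - z"] by (auto simp: dist_norm)
  thus "z \<notin> \<real>\<^sub>\<le>\<^sub>0" "z \<noteq> 0" by (auto simp: complex_nonpos_Reals_iff)
qed

lemma holomorphic_ABC: "A holomorphic_on U" "B holomorphic_on U" "C holomorphic_on U"
proof -
  note hw = holomorphic_on_weighted_integral[OF integrable_indicator_Y, where K = Y, OF _ Y(1) open_ball]
  show "A holomorphic_on U"
    unfolding A_def by (intro hw U_swap[OF continuous_on_regular_part] holomorphic_regular_part) auto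
  have "(\<lambda>z. \<integral>y. indicat_real Y y *\<^sub>R b y z \<partial>lborel) holomorphic_on U"
    by (intro hw U_swap[OF continuous_on_bc(1)] holomorphic_bc) auto
  moreover have "csqrt holomorphic_on U"
    using U_not_nonpos by (intro holomorphic_on_subset[OF holomorphic_on_csqrt]) auto
  ultimately show "B holomorphic_on U"
    unfolding B_def by (intro holomorphic_on_mult holomorphic_on_const)
  have "(\<lambda>z. \<integral>y. indicat_real Y y *\<^sub>R c y z \<partial>lborel) holomorphic_on U"
    by (intro hw U_swap[OF continuous_on_bc(2)] holomorphic_bc) auto
  thus "C holomorphic_on U"
    unfolding C_def by (intro holomorphic_on_divide holomorphic_on_minus holomorphic_on_const) auto
qed

lemma radial_integral_expansion:
  assumes x: "x \<in> {1-\<epsilon><..<1}"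
  shows "(\<integral>y. indicat_real Y y *\<^sub>R (\<integral>t. indicat_real {0..\<delta>} t *\<^sub>R (of_real t ^ (m - 1) / D y (of_real x) (of_real t)) \<partial>lborel) \<partial>lborel)
    = A (of_real x) + B (of_real x) / csqrt (1 - of_real x) + C (of_real x) * Ln (1 - of_real x)"
proof -
  let ?z = "complex_of_real x"
  let ?E = "\<lambda>y. e y ?z - b y ?z * tail y ?z + c y ?z * Ln (D y ?z (of_real \<delta>)) / 2"
  have restrict: "continuous_on Y (\<lambda>y. F y ?z)" if "continuous_on (Y \<times> U) (\<lambda>x. F (fst x) (snd x))" for F :: "'a \<Rightarrow> complex \<Rightarrow> complex"
    using real_in_U[OF x] by (intro continuous_on_compose2[OF that, of _ "\<lambda>y. (y, ?z)", simplified]) (auto intro!: continuous_intros)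
  note iw = integrable_weighted[OF integrable_indicator_Y, where K = Y, OF _ Y(1)]
  have i: "integrable lborel (\<lambda>y. indicat_real Y y *\<^sub>R ?E y)" "integrable lborel (\<lambda>y. indicat_real Y y *\<^sub>R b y ?z)"
    "integrable lborel (\<lambda>y. indicat_real Y y *\<^sub>R c y ?z)"
    using restrict[OF continuous_on_regular_part] restrict[OF continuous_on_bc(1)] restrict[OF continuous_on_bc(2)]
    by (intro iw; auto)+
  have "(\<integral>y. indicat_real Y y *\<^sub>R (\<integral>t. indicat_real {0..\<delta>} t *\<^sub>R (of_real t ^ (m - 1) / D y ?z (of_real t)) \<partial>lborel) \<partial>lborel)
    = (\<integral>y. indicat_real Y y *\<^sub>R ?E y + ((slope x * of_real (pi / 2)) * (indicat_real Y y *\<^sub>R b y ?z)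
        + (- Ln (1 - ?z) / 2) * (indicat_real Y y *\<^sub>R c y ?z)) \<partial>lborel)"
  proof (rule Bochner_Integration.integral_cong[OF refl])
    fix y
    show "indicat_real Y y *\<^sub>R (\<integral>t. indicat_real {0..\<delta>} t *\<^sub>R (of_real t ^ (m - 1) / D y ?z (of_real t)) \<partial>lborel)
      = indicat_real Y y *\<^sub>R ?E y + ((slope x * of_real (pi / 2)) * (indicat_real Y y *\<^sub>R b y ?z)
        + (- Ln (1 - ?z) / 2) * (indicat_real Y y *\<^sub>R c y ?z))"
    proof (cases "y \<in> Y")
      case True
      thus ?thesis using ray_integral[OF True x] by (simp add: algebra_simps diff_divide_distrib)
    qed simp
  qed
  also have "\<dots> = A ?z + ((slope x * of_real (pi / 2)) * (\<integral>y. indicat_real Y y *\<^sub>R b y ?z \<partial>lborel)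
       + (- Ln (1 - ?z) / 2) * (\<integral>y. indicat_real Y y *\<^sub>R c y ?z \<partial>lborel))"
    unfolding A_def by (rule integral_linear_combination[OF i])
  finally show ?thesis by (simp add: B_def C_def slope(3)[OF x] mult_ac)
qed


text \<open>
  The residue at the origin of \<open>s\<^sup>m\<^sup>-\<^sup>1 \<psi>\<^sup>a / \<psi>\<^sup>2\<^sup>j\<close>, where \<open>\<psi>(s) = s r(s)\<close>: it vanishes unless the powers of \<open>s\<close>
  cancel down to \<open>1 / s\<close>.
\<close>

lemma circle_mean_power:
  assumes y: "y \<in> Y" and j: "2 * j \<le> m + a"
  shows "circle_mean R (\<lambda>s. s ^ m * \<psi> y s ^ a / g y s ^ j) =
    (if 2 * j = m + a then r y 0 ^ a / r y 0 ^ (2 * j) else 0)"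
proof -
  define f where "f s = s ^ (m + a - 2 * j) * r y s ^ a / r y s ^ (2 * j)" for s
  have "r y holomorphic_on ball 0 R'"
    unfolding holomorphic_on_open[OF open_ball] using r_deriv[OF y] by blast
  hence "f holomorphic_on ball 0 R'"
    unfolding f_def using r_nz[OF y] by (intro holomorphic_intros) auto
  from circle_mean_eq_center[OF this radii(1,2)] have "circle_mean R f = f 0" .
  moreover have "circle_mean R f = circle_mean R (\<lambda>s. s ^ m * \<psi> y s ^ a / g y s ^ j)"
  proof (rule circle_mean_cong[OF radii(1)])
    fix s :: complex assume s: "s \<in> sphere 0 R"
    hence "s \<noteq> 0" using radii by auto
    moreover have "s ^ (m + a) = s ^ (m + a - 2 * j) * s ^ (2 * j)"
      using j by (simp flip: power_add)
    moreover have "g y s ^ j = s ^ (2 * j) * r y s ^ (2 * j)"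
      by (simp add: g_eq \<psi>_def power_mult_distrib power_mult[symmetric])
    moreover have "s ^ m * \<psi> y s ^ a = s ^ (m + a) * r y s ^ a"
      by (simp add: \<psi>_def power_mult_distrib power_add)
    ultimately show "f s = s ^ m * \<psi> y s ^ a / g y s ^ j"
      by (simp add: f_def)
  qed
  ultimately show ?thesis using j by (auto simp: f_def power_0_left)
qed

lemma continuous_on_kernel:
  "continuous_on ((Y \<times> U) \<times> sphere 0 R) (\<lambda>x. snd x ^ m * \<psi> (fst (fst x)) (snd x) ^ a
     / (g (fst (fst x)) (snd x) ^ j * D (fst (fst x)) (snd (fst x)) (snd x)))"
proof -
  have "continuous_on ((Y \<times> U) \<times> sphere 0 R) (\<lambda>x. \<psi> (fst (fst x)) (snd x))"
    using circle_in_disc by (intro continuous_on_\<psi> continuous_intros) auto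
  moreover have "continuous_on ((Y \<times> U) \<times> sphere 0 R) (\<lambda>x. g (fst (fst x)) (snd x))"
    by (intro continuous_on_g continuous_intros) auto
  moreover have "continuous_on ((Y \<times> U) \<times> sphere 0 R) (\<lambda>x. D (fst (fst x)) (snd (fst x)) (snd x))"
    by (intro continuous_on_D continuous_intros) auto
  moreover have "g y s \<noteq> 0" if "y \<in> Y" "s \<in> sphere 0 R" for y s
    using g_circle[OF that] \<eta>_pos by auto
  ultimately show ?thesis
    using D_nz_circle
    by (intro continuous_on_divide continuous_on_mult continuous_on_power continuous_on_snd continuous_on_id) auto
qed

text \<open>
  Each use of \<open>z / (g\<^sup>j D) = (z - 1) / (g\<^sup>j\<^sup>+\<^sup>1 D) + 1 / g\<^sup>j\<^sup>+\<^sup>1\<close> exposes one Taylor coefficient, a mean that vanishes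
  by \<open>circle_mean_power\<close> as long as the order is below \<open>(m + a) / 2\<close>. So the circle mean vanishes to that order at \<open>z = 1\<close>.
\<close>

lemma kernel_recurrence:
  assumes y: "y \<in> Y" and z: "z \<in> U" and j: "2 * j < m + a"
  shows "z ^ j * circle_mean R (\<lambda>s. s ^ m * \<psi> y s ^ a / D y z s) =
    (z - 1) ^ j * circle_mean R (\<lambda>s. s ^ m * \<psi> y s ^ a / (g y s ^ j * D y z s))"
  using j
proof (induction j)
  case (Suc j)
  have cont: "continuous_on (sphere 0 R) (\<lambda>s. s ^ m * \<psi> y s ^ a / (g y s ^ i * D y z s))" for i
    using y z by (intro continuous_on_compose2[OF continuous_on_kernel, of _ "\<lambda>s. ((y, z), s)", simplified])
      (auto intro!: continuous_intros)
  have gnz: "g y s \<noteq> 0" if "s \<in> sphere 0 R" for s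
    using g_circle[OF y that] \<eta>_pos by auto
  have "continuous_on (sphere 0 R) (\<psi> y)"
    using y circle_in_disc by (intro continuous_on_\<psi>[where u = "\<lambda>_. y"] continuous_intros) auto
  moreover have "continuous_on (sphere 0 R) (g y)"
    using y by (intro continuous_on_g[where u = "\<lambda>_. y"] continuous_intros) auto
  ultimately have cont': "continuous_on (sphere 0 R) (\<lambda>s. s ^ m * \<psi> y s ^ a / g y s ^ Suc j)"
    using gnz by (intro continuous_on_divide continuous_on_mult continuous_on_power continuous_on_id) auto
  have "z * circle_mean R (\<lambda>s. s ^ m * \<psi> y s ^ a / (g y s ^ j * D y z s))
      = circle_mean R (\<lambda>s. z * (s ^ m * \<psi> y s ^ a / (g y s ^ j * D y z s)))"
    by (rule circle_mean_mult[symmetric])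
  also have "\<dots> = circle_mean R (\<lambda>s. (z - 1) * (s ^ m * \<psi> y s ^ a / (g y s ^ Suc j * D y z s))
      + s ^ m * \<psi> y s ^ a / g y s ^ Suc j)"
  proof (rule circle_mean_cong[OF radii(1)])
    fix s :: complex assume s: "s \<in> sphere 0 R"
    define G where "G = g y s"
    define d where "d = D y z s"
    have nz: "G \<noteq> 0" "d \<noteq> 0" and d: "d = z * G - (z - 1)"
      using gnz[OF s] D_nz_circle[OF y z s] by (auto simp: G_def d_def D_def)
    have "z / (G ^ j * d) = (z - 1) / (G ^ Suc j * d) + 1 / G ^ Suc j"
    proof -
      have "(z - 1) / (G ^ Suc j * d) + 1 / G ^ Suc j = ((z - 1) + d) / (G ^ Suc j * d)"
        using nz by (simp add: add_divide_distrib)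
      thus ?thesis using nz unfolding d by simp
    qed
    hence "w * (z / (G ^ j * d)) = w * ((z - 1) / (G ^ Suc j * d) + 1 / G ^ Suc j)" for w by simp
    from this[of "s ^ m * \<psi> y s ^ a"]
    show "z * (s ^ m * \<psi> y s ^ a / (g y s ^ j * D y z s))
        = (z - 1) * (s ^ m * \<psi> y s ^ a / (g y s ^ Suc j * D y z s)) + s ^ m * \<psi> y s ^ a / g y s ^ Suc j"
      unfolding G_def[symmetric] d_def[symmetric] by (simp only: distrib_left times_divide_eq_right mult.right_neutral mult_1_left mult.commute mult.left_commute)
  qed
  also have "\<dots> = (z - 1) * circle_mean R (\<lambda>s. s ^ m * \<psi> y s ^ a / (g y s ^ Suc j * D y z s)) + 0"
  proof -
    have 0: "circle_mean R (\<lambda>s. s ^ m * \<psi> y s ^ a / g y s ^ Suc j) = 0"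
      using Suc.prems circle_mean_power[OF y, of "Suc j" a] by simp
    show ?thesis
      by (simp only: circle_mean_add[OF radii(1) continuous_on_mult[OF continuous_on_const cont] cont'] circle_mean_mult 0)
  qed
  finally have "z * circle_mean R (\<lambda>s. s ^ m * \<psi> y s ^ a / (g y s ^ j * D y z s))
      = (z - 1) * circle_mean R (\<lambda>s. s ^ m * \<psi> y s ^ a / (g y s ^ Suc j * D y z s))" by simp
  with Suc show ?case by (simp add: mult_ac)
qed simp

text \<open>
  After division by \<open>((z - 1) / z)\<^sup>i\<close> the integral extends continuously to \<open>z = 1\<close>, with the value
  \<open>\<integral> \<kappa>(y)\<^sup>-\<^sup>m\<^sup>/\<^sup>2 dy > 0\<close>.
\<close>

lemma kernel_integral_nonvanishing:
  assumes i: "m + a = 2 * i + 2"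
  shows "\<exists>z\<in>U - {1}. (\<integral>y. indicat_real Y y *\<^sub>R circle_mean R (\<lambda>s. s ^ m * \<psi> y s ^ a / D y z s) \<partial>lborel) \<noteq> 0"
proof (rule ccontr)
  assume "\<not> ?thesis"
  hence zero: "(\<integral>y. indicat_real Y y *\<^sub>R circle_mean R (\<lambda>s. s ^ m * \<psi> y s ^ a / D y z s) \<partial>lborel) = 0"
    if "z \<in> U" "z \<noteq> 1" for z using that by blast
  define T where "T z = (\<integral>y. indicat_real Y y *\<^sub>R circle_mean R (\<lambda>s. s ^ m * \<psi> y s ^ a / (g y s ^ i * D y z s)) \<partial>lborel)" for z
  \<comment> \<open>If the integrals vanish off \<open>1\<close>, so does \<open>T\<close>, and by continuity also \<open>T 1\<close>.\<close>
  have T0: "T z = 0" if z: "z \<in> U" "z \<noteq> 1" for z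
  proof -
    have "(z - 1) ^ i * T z = (\<integral>y. (z - 1) ^ i * (indicat_real Y y *\<^sub>R circle_mean R (\<lambda>s. s ^ m * \<psi> y s ^ a / (g y s ^ i * D y z s))) \<partial>lborel)"
      unfolding T_def by (rule integral_mult_right_zero[symmetric])
    also have "\<dots> = (\<integral>y. z ^ i * (indicat_real Y y *\<^sub>R circle_mean R (\<lambda>s. s ^ m * \<psi> y s ^ a / D y z s)) \<partial>lborel)"
      by (rule Bochner_Integration.integral_cong[OF refl])
         (use kernel_recurrence[OF _ z(1), of _ i a] i in \<open>auto simp: indicator_def\<close>)
    also have "\<dots> = z ^ i * (\<integral>y. indicat_real Y y *\<^sub>R circle_mean R (\<lambda>s. s ^ m * \<psi> y s ^ a / D y z s) \<partial>lborel)"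
      by (rule integral_mult_right_zero)
    finally show ?thesis using zero[OF z] z(2) by simp
  qed
  have "continuous_on (Y \<times> U) (\<lambda>x. circle_mean R (\<lambda>s. s ^ m * \<psi> (fst x) s ^ a / (g (fst x) s ^ i * D (fst x) (snd x) s)))"
    by (rule continuous_on_circle_mean[OF radii(1) continuous_on_kernel])
  from U_swap[OF this] have "continuous_on U T"
    unfolding T_def by (intro continuous_on_weighted_integral[OF integrable_indicator_Y, where K = Y] Y(1)) auto
  hence "isCont T 1"
    using \<epsilon>(1) by (simp add: continuous_on_eq_continuous_at)
  hence "(T \<longlongrightarrow> T 1) (at 1)" by (simp add: isCont_def)
  moreover have "\<forall>\<^sub>F z in at 1. z \<in> U - {1}"
    using \<epsilon>(1) by (intro eventually_at_in_open) auto
  hence "\<forall>\<^sub>F z in at 1. T z = 0"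
    by eventually_elim (use T0 in auto)
  hence "(T \<longlongrightarrow> 0) (at 1)" by (rule tendsto_eventually)
  ultimately have "T 1 = 0" using LIM_unique by blast
  define h where "h y = sqrt (\<kappa> y) ^ a / sqrt (\<kappa> y) ^ (2 * i + 2)" for y
  have h: "circle_mean R (\<lambda>s. s ^ m * \<psi> y s ^ a / (g y s ^ i * D y 1 s)) = of_real (h y)" if "y \<in> Y" for y
  proof -
    have "r y 0 = of_real (sqrt (\<kappa> y))"
      using q_0[OF that] \<kappa>_pos[OF that] by (simp add: r_def csqrt_of_real)
    moreover have "circle_mean R (\<lambda>s. s ^ m * \<psi> y s ^ a / (g y s ^ i * D y 1 s)) = circle_mean R (\<lambda>s. s ^ m * \<psi> y s ^ a / g y s ^ (i + 1))"
      by (simp add: D_def mult.commute)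
    ultimately show ?thesis using circle_mean_power[OF that, of "i + 1" a] i by (simp add: h_def)
  qed
  have h_pos: "h y > 0" if "y \<in> Y" for y using \<kappa>_pos[OF that] by (simp add: h_def)
  have hc: "continuous_on Y (\<lambda>y. of_real (h y) :: complex)"
  proof -
    have "continuous_on Y (\<lambda>y. Re (q y 0))" by (intro continuous_intros continuous_on_q) auto
    hence "continuous_on Y \<kappa>" by (rule continuous_on_eq) (simp add: q_0)
    thus ?thesis using \<kappa>_pos unfolding h_def by (intro continuous_intros) (auto dest!: \<kappa>_pos)
  qed
  have "T 1 = (\<integral>y. indicat_real Y y *\<^sub>R of_real (h y) \<partial>lborel)"
    unfolding T_def by (rule Bochner_Integration.integral_cong[OF refl]) (use h in \<open>auto simp: indicator_def\<close>)
  also have "\<dots> = (\<integral>y. of_real (indicat_real Y y * h y) \<partial>lborel)"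
    by (simp add: scaleR_conv_of_real)
  also have "\<dots> = of_real (\<integral>y. indicat_real Y y * h y \<partial>lborel)"
    by (rule integral_complex_of_real)
  finally have 0: "(\<integral>y. indicat_real Y y * h y \<partial>lborel) = 0" using \<open>T 1 = 0\<close> by simp
  have "integrable lborel (\<lambda>y. indicat_real Y y *\<^sub>R complex_of_real (h y))"
    by (intro integrable_weighted[OF integrable_indicator_Y, where K = Y] Y(1) hc) auto
  hence "integrable lborel (\<lambda>y. complex_of_real (indicat_real Y y * h y))"
    by (simp add: scaleR_conv_of_real)
  hence int: "integrable lborel (\<lambda>y. indicat_real Y y * h y)"
    by (rule complex_of_real_integrable_eq[THEN iffD1])
  have "AE y in lborel. indicat_real Y y * h y = 0"
    using 0 by (subst (asm) integral_nonneg_eq_0_iff_AE[OF int]) (use h_pos in \<open>auto simp: indicator_def less_imp_le\<close>)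
  hence "AE y in lborel. y \<notin> Y"
    by eventually_elim (use h_pos in \<open>fastforce simp: indicator_def split: if_splits\<close>)
  hence "emeasure lborel Y = 0"
    using Y(1) by (subst (asm) AE_iff_measurable[OF _ refl]) (auto intro: borel_compact)
  thus False using Y(2) by simp
qed

text \<open>
  The exponent \<open>a \<in> {0, 1}\<close> must make \<open>m + a\<close> even, so the parity of \<open>m\<close> decides which of \<open>B\<close> and \<open>C\<close> is shown to be
  nonzero.
\<close>

lemma singular_part_nontrivial: "\<exists>z\<in>U - {1}. B z \<noteq> 0 \<or> C z \<noteq> 0"
proof (cases "even m")
  case True
  then obtain i where "m + 0 = 2 * i + 2"
    using m by (metis add.right_neutral dvd_def gr0_implies_Suc mult_Suc_right mult_zero_right not_gr_zero add.commute)
  from kernel_integral_nonvanishing[OF this] show ?thesis by (auto simp: C_def c_def)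
next
  case False
  then obtain i where "m + 1 = 2 * i + 2" by (metis oddE add.assoc one_add_one)
  from kernel_integral_nonvanishing[OF this] obtain z where z: "z \<in> U - {1}" "(\<integral>y. indicat_real Y y *\<^sub>R b y z \<partial>lborel) \<noteq> 0"
    unfolding b_def power_one_right by blast
  moreover have "csqrt z \<noteq> 0" using z U_not_nonpos by auto
  ultimately show ?thesis by (intro bexI[of _ z]) (auto simp: B_def)
qed

end

context ray_family
begin

text \<open>
  On a small disc \<open>\<psi>(s) = s r(s)\<close> differs from a nonzero multiple of \<open>s\<close> by a function with small Lipschitz constant, hence
  is injective. Compactness of \<open>Y\<close> makes all constants uniform.
\<close>

lemma ray_disc_exists:
  obtains \<delta>0 where "\<delta>0 > 0" "\<And>\<delta>. \<delta> \<in> {0<..\<delta>0} \<Longrightarrow> \<exists>R' R \<eta> \<epsilon>. ray_disc Y q q' \<kappa> m R' R \<delta> \<eta> \<epsilon>"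
    "\<And>y t. y \<in> Y \<Longrightarrow> t \<in> {0<..\<delta>0} \<Longrightarrow> g y (of_real t) \<noteq> 0"
proof -
  obtain R0 a where R0: "R0 > 0" and a: "a > 0" and Re_q: "\<And>y s. y \<in> Y \<Longrightarrow> s \<in> cball 0 R0 \<Longrightarrow> Re (q y s) \<ge> a"
    using Re_q_pos_near_0 by metis
  have bnd: "\<exists>M>0. \<forall>y\<in>Y. \<forall>s\<in>cball 0 R0. norm (F y s) \<le> M"
    if "continuous_on (Y \<times> cball 0 R0) (\<lambda>x. F (fst x) (snd x))" for F :: "'a \<Rightarrow> complex \<Rightarrow> complex"
  proof -
    have "bounded ((\<lambda>x. F (fst x) (snd x)) ` (Y \<times> cball 0 R0))"
      by (intro compact_imp_bounded compact_continuous_image compact_Times Y(1) compact_cball that)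
    then obtain M where "M > 0" "\<forall>x\<in>(\<lambda>x. F (fst x) (snd x)) ` (Y \<times> cball 0 R0). norm x \<le> M"
      by (auto simp: bounded_pos)
    thus ?thesis by force
  qed
  have np: "q y s \<notin> \<real>\<^sub>\<le>\<^sub>0" "q y s \<noteq> 0" if "y \<in> Y" "s \<in> cball 0 R0" for y s
    using Re_q[OF that] a by (auto simp: complex_nonpos_Reals_iff)
  have contq: "continuous_on (Y \<times> cball 0 R0) (\<lambda>x. q (fst x) (snd x))"
    by (rule continuous_on_subset[OF q_cont]) auto
  have contr: "continuous_on (Y \<times> cball 0 R0) (\<lambda>x. r (fst x) (snd x))"
    unfolding r_def by (rule continuous_on_compose2[OF continuous_on_csqrt contq]) (use np in auto)
  have "continuous_on (Y \<times> cball 0 R0) (\<lambda>x. r' (fst x) (snd x))"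
    unfolding r'_def
    by (intro continuous_on_divide continuous_on_mult continuous_on_const contr continuous_on_subset[OF q'_cont])
       (use np in \<open>auto simp: r_def\<close>)
  from bnd[OF this] obtain L where L: "L > 0" "\<And>y s. y \<in> Y \<Longrightarrow> s \<in> cball 0 R0 \<Longrightarrow> norm (r' y s) \<le> L" by blast
  from bnd[OF contq] obtain M where M: "M > 0" "\<And>y s. y \<in> Y \<Longrightarrow> s \<in> cball 0 R0 \<Longrightarrow> norm (q y s) \<le> M" by blast
  define \<beta> where "\<beta> = sqrt a"
  have \<beta>: "\<beta> > 0" using a by (simp add: \<beta>_def)
  have norm_q: "norm (q y s) \<ge> a" if "y \<in> Y" "s \<in> cball 0 R0" for y s
    using Re_q[OF that] complex_Re_le_cmod[of "q y s"] by linarith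
  have norm_r: "norm (r y s) \<ge> \<beta>" if "y \<in> Y" "s \<in> cball 0 R0" for y s
    using norm_q[OF that] by (simp add: r_def \<beta>_def)
  \<comment> \<open>For \<open>R' L \<le> \<beta> / 2\<close> the variation of \<open>r\<close> is dominated by \<open>\<bar>r\<bar> \<ge> \<beta>\<close>, which gives injectivity.\<close>
  define R' where "R' = min R0 (\<beta> / (2 * L))"
  define R where "R = R' / 2"
  define \<eta> where "\<eta> = R\<^sup>2 * a / 4"
  define \<delta>0 where "\<delta>0 = min (R / 2) (sqrt (\<eta> / M))"
  have R': "R' > 0" "R' \<le> R0" "R' * L \<le> \<beta> / 2"
  proof -
    show "R' > 0" "R' \<le> R0" using R0 \<beta> L(1) by (auto simp: R'_def)
    have "R' \<le> \<beta> / (2 * L)" by (simp add: R'_def)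
    from mult_right_mono[OF this, of L] show "R' * L \<le> \<beta> / 2" using L(1) by simp
  qed
  have R: "R > 0" "R < R'" using R' by (auto simp: R_def)
  have \<eta>: "\<eta> > 0" using R a by (simp add: \<eta>_def)
  have \<delta>0: "\<delta>0 > 0" "\<delta>0 \<le> R / 2" "\<delta>0 \<le> sqrt (\<eta> / M)"
    using R \<eta> M(1) by (auto simp: \<delta>0_def)
  have inj: "inj_on (\<psi> y) (ball 0 R')" if y: "y \<in> Y" for y
  proof (rule inj_onI)
    fix s s' assume s: "s \<in> ball 0 R'" "s' \<in> ball 0 R'" and eq: "\<psi> y s = \<psi> y s'"
    have sR: "s \<in> ball 0 R0" "s' \<in> ball 0 R0" using s R' by auto
    have "norm (r y s - r y s') \<le> L * norm (s - s')"
    proof (rule field_differentiable_bound[where S = "ball 0 R0" and f' = "r' y"])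
      fix u :: complex assume "u \<in> ball 0 R0"
      hence u: "u \<in> cball 0 R0" by auto
      show "norm (r' y u) \<le> L" by (rule L(2)[OF y u])
      show "(r y has_field_derivative r' y u) (at u within ball 0 R0)"
        using has_field_derivative_r[OF y, of u] Re_q[OF y u] a by (auto intro: has_field_derivative_at_within)
    qed (use sR in auto)
    have "(s - s') * r y s = - (s' * (r y s - r y s'))"
      using eq by (simp add: \<psi>_def algebra_simps)
    hence "norm (s - s') * norm (r y s) = norm s' * norm (r y s - r y s')"
      by (metis norm_minus_cancel norm_mult)
    also have "\<dots> \<le> R' * (L * norm (s - s'))"
      using s \<open>norm (r y s - r y s') \<le> L * norm (s - s')\<close> R'(1) by (intro mult_mono) auto
    also have "\<dots> \<le> \<beta> / 2 * norm (s - s')"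
      using mult_right_mono[OF R'(3), of "norm (s - s')"] by (simp add: mult_ac)
    finally have "norm (s - s') * norm (r y s) \<le> \<beta> / 2 * norm (s - s')" .
    moreover have "norm (s - s') * \<beta> \<le> norm (s - s') * norm (r y s)"
      using norm_r[OF y, of s] sR by (intro mult_left_mono) auto
    ultimately have "norm (s - s') * \<beta> \<le> 0" by (simp add: mult_ac)
    thus "s = s'" using \<beta> by (simp add: mult_le_0_iff)
  qed
  show thesis
  proof (rule that[OF \<delta>0(1)])
    fix y t assume y: "y \<in> Y" and t: "t \<in> {0<..\<delta>0}"
    have "of_real t \<in> cball (0::complex) R0" using t \<delta>0 R R' by auto
    from np(2)[OF y this] show "g y (of_real t) \<noteq> 0" using t by (auto simp: g_def)
  next
    fix \<delta> assume \<delta>: "\<delta> \<in> {0<..\<delta>0}"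
    define \<epsilon> where "\<epsilon> = min (1 / 2) (min \<eta> (\<delta>\<^sup>2 * a / 4))"
    have "ray_disc Y q q' \<kappa> m R' R \<delta> \<eta> \<epsilon>"
    proof unfold_locales
      show "0 < R" "R < R'" "0 < \<delta>" "\<delta> < R" "\<eta> > 0" using R \<delta> \<delta>0 \<eta> by auto
      show "0 < \<epsilon>" "\<epsilon> \<le> 1 / 2" "\<epsilon> \<le> \<eta>" using \<eta> \<delta> a by (auto simp: \<epsilon>_def)
      show "inj_on (\<psi> y) (ball 0 R')" if "y \<in> Y" for y by (rule inj[OF that])
      fix y assume y: "y \<in> Y"
      show "Re (q y s) > 0" if "s \<in> ball 0 R'" for s
        using Re_q[OF y, of s] that R' a by auto
      show "norm (g y s) \<ge> 4 * \<eta>" if "s \<in> sphere 0 R" for s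
        using norm_q[OF y, of s] that R R' by (auto simp: g_def norm_mult norm_power \<eta>_def intro!: mult_left_mono)
      show "norm (g y (of_real t)) \<le> \<eta>" if t: "t \<in> {0..\<delta>}" for t
      proof -
        have "t \<le> sqrt (\<eta> / M)" using t \<delta> \<delta>0 by auto
        hence "t\<^sup>2 \<le> \<eta> / M" using t \<eta> M(1) by (metis atLeastAtMost_iff real_le_rsqrt real_sqrt_le_iff real_sqrt_pow2 power_mono divide_nonneg_pos less_imp_le)
        moreover have "of_real t \<in> cball (0::complex) R0" using t \<delta> \<delta>0 R R' by auto
        ultimately have "t\<^sup>2 * norm (q y (of_real t)) \<le> \<eta> / M * M"
          using M(2)[OF y] \<eta> M(1) by (intro mult_mono) auto
        thus ?thesis using M(1) by (simp add: g_def norm_mult norm_power)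
      qed
      show "4 * \<epsilon> \<le> Re (g y (of_real \<delta>))"
      proof -
        have "of_real \<delta> \<in> cball (0::complex) R0" using \<delta> \<delta>0 R R' by auto
        from mult_left_mono[OF Re_q[OF y this], of "\<delta>\<^sup>2"] have "\<delta>\<^sup>2 * a \<le> Re (g y (of_real \<delta>))"
          by (simp add: g_def flip: of_real_power)
        moreover have "\<epsilon> \<le> \<delta>\<^sup>2 * a / 4" by (simp add: \<epsilon>_def)
        ultimately show ?thesis by linarith
      qed
    qed
    thus "\<exists>R' R \<eta> \<epsilon>. ray_disc Y q q' \<kappa> m R' R \<delta> \<eta> \<epsilon>" by blast
  qed
qed

end

section \<open>Polar coordinates near a point\<close>

lemma integral_scale:
  fixes H :: "'a::euclidean_space \<Rightarrow> complex"
  assumes "s > 0" "H \<in> borel_measurable borel"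
  shows "(\<integral>\<theta>. H \<theta> \<partial>lborel) = of_real (s ^ DIM('a)) * (\<integral>y. H (s *\<^sub>R y) \<partial>lborel)"
proof -
  have "(\<integral>\<theta>. H \<theta> \<partial>lborel) = (\<integral>\<theta>. H \<theta> \<partial>density (distr lborel borel (\<lambda>x. 0 + s *\<^sub>R x)) (\<lambda>_. ennreal (\<bar>s\<bar> ^ DIM('a))))"
    using lborel_affine[of s "0::'a"] assms(1) by simp
  also have "\<dots> = (\<integral>\<theta>. (\<bar>s\<bar> ^ DIM('a)) *\<^sub>R H \<theta> \<partial>distr lborel borel (\<lambda>x. 0 + s *\<^sub>R x))"
    using assms by (subst integral_density) auto
  also have "\<dots> = (\<integral>y. (\<bar>s\<bar> ^ DIM('a)) *\<^sub>R H (0 + s *\<^sub>R y) \<partial>lborel)"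
    using assms by (subst integral_distr) auto
  also have "\<dots> = of_real (s ^ DIM('a)) * (\<integral>y. H (s *\<^sub>R y) \<partial>lborel)"
    using assms(1) by (simp add: scaleR_conv_of_real)
  finally show ?thesis .
qed

lemma integral_translate:
  fixes H :: "'a::euclidean_space \<Rightarrow> complex"
  assumes "H \<in> borel_measurable borel"
  shows "(\<integral>\<theta>. H \<theta> \<partial>lborel) = (\<integral>\<theta>. H (l + \<theta>) \<partial>lborel)"
proof -
  have "(\<integral>\<theta>. H \<theta> \<partial>lborel) = (\<integral>\<theta>. H \<theta> \<partial>distr lborel borel ((+) l))"
    by (simp add: lborel_distr_plus)
  also have "\<dots> = (\<integral>\<theta>. H (l + \<theta>) \<partial>lborel)"
    using assms by (subst integral_distr) auto
  finally show ?thesis .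
qed

text \<open>
  Polar coordinates are used with a shell of positive volume in place of the unit sphere: each nonzero \<open>\<theta>\<close> is \<open>s y\<close> with
  \<open>y\<close> in the shell for all \<open>s\<close> between \<open>\<bar>\<theta>\<bar> / 2\<close> and \<open>\<bar>\<theta>\<bar>\<close>, and the measure \<open>ds / s\<close> of these \<open>s\<close> is \<open>ln 2\<close> for every \<open>\<theta>\<close>.
  Averaging over them turns an integral over \<open>\<theta>\<close> into one over \<open>s\<close> and \<open>y\<close> by Fubini and scaling alone.
\<close>

definition shell :: "'a::euclidean_space set" where
  "shell = cball 0 2 - ball 0 1"

lemma shell_iff: "y \<in> shell \<longleftrightarrow> 1 \<le> norm y \<and> norm y \<le> 2"
  by (auto simp: shell_def)

lemma compact_shell: "compact (shell :: 'a::euclidean_space set)"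
  unfolding shell_def by (intro compact_diff) auto

lemma shell_measurable [measurable]: "shell \<in> sets borel"
  by (intro borel_compact compact_shell)

lemma emeasure_shell: "emeasure lborel (shell :: 'a::euclidean_space set) > 0"
proof -
  obtain b :: 'a where b: "b \<in> Basis" using nonempty_Basis by blast
  have "ball ((3 / 2) *\<^sub>R b) (1 / 2) \<subseteq> shell"
  proof
    fix y assume "y \<in> ball ((3 / 2) *\<^sub>R b) (1 / 2)"
    hence 1: "norm ((3 / 2) *\<^sub>R b - y) < 1 / 2" by (simp add: dist_norm)
    have 2: "norm ((3 / 2) *\<^sub>R b) = 3 / 2" using b by simp
    show "y \<in> shell" unfolding shell_iff
      using 1 2 norm_triangle_ineq2[of "(3 / 2) *\<^sub>R b" y] norm_triangle_ineq2[of y "(3 / 2) *\<^sub>R b"]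
      by (simp add: norm_minus_commute)
  qed
  moreover have "emeasure lborel (ball ((3 / 2) *\<^sub>R b) (1 / 2)) > 0"
  proof (rule ccontr)
    assume "\<not> ?thesis"
    hence "ball ((3 / 2) *\<^sub>R b) (1 / 2) \<in> null_sets lborel" by (auto simp: null_sets_def)
    hence "negligible (ball ((3 / 2) *\<^sub>R b) (1 / 2))"
      unfolding negligible_iff_null_sets by (rule null_sets_completionI)
    thus False using open_not_negligible[OF open_ball, of "(3 / 2) *\<^sub>R b" "1 / 2"] by simp
  qed
  ultimately show ?thesis
    by (metis emeasure_mono less_le_trans sets_lborel shell_measurable)
qed

definition radial_density :: "real \<Rightarrow> real \<Rightarrow> 'a::euclidean_space \<Rightarrow> real" where
  "radial_density \<delta> s \<theta> = indicator {0..\<delta>} s * (indicator shell ((1 / s) *\<^sub>R \<theta>) / s)"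

text \<open>
  The cutoff restricts the average to \<open>s \<le> \<delta>\<close>. It is a radial function, equal to one near the origin and of compact
  support.
\<close>

definition cutoff :: "real \<Rightarrow> 'a::euclidean_space \<Rightarrow> real" where
  "cutoff \<delta> \<theta> = (\<integral>s. radial_density \<delta> s \<theta> \<partial>lborel) / ln 2"

lemma radial_density_nonneg: "radial_density \<delta> s \<theta> \<ge> 0"
  by (auto simp: radial_density_def indicator_def)

lemma radial_density_eq:
  assumes "\<theta> \<noteq> 0"
  shows "radial_density \<delta> s \<theta> = indicator {0..\<delta>} s * (1 / s * indicator {norm \<theta> / 2..norm \<theta>} s)"
proof (cases "s > 0")
  case True
  hence "(1 / s) *\<^sub>R \<theta> \<in> shell \<longleftrightarrow> s \<in> {norm \<theta> / 2..norm \<theta>}"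
    by (auto simp: shell_iff field_simps)
  thus ?thesis by (simp add: radial_density_def indicator_def)
next
  case False
  moreover have "norm \<theta> > 0" using assms by simp
  ultimately show ?thesis by (auto simp: radial_density_def indicator_def)
qed

text \<open>
  At \<open>\<theta> = 0\<close> the cutoff is \<open>0\<close>, since the shell does not contain the origin; this is a null set.
\<close>

lemma cutoff_eq_1:
  assumes "\<theta> \<noteq> 0" "norm \<theta> \<le> \<delta>"
  shows "cutoff \<delta> \<theta> = 1"
proof -
  have n: "norm \<theta> > 0" using assms by simp
  have "(\<integral>s. radial_density \<delta> s \<theta> \<partial>lborel) = (\<integral>s. 1 / s * indicator {norm \<theta> / 2..norm \<theta>} s \<partial>lborel)"
    unfolding radial_density_eq[OF assms(1)] using assms(2) n
    by (intro Bochner_Integration.integral_cong) (auto simp: indicator_def)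
  also have "\<dots> = ln (norm \<theta>) - ln (norm \<theta> / 2)"
  proof (rule integral_FTC_Icc_real)
    have pos: "0 < s" if "norm \<theta> / 2 \<le> s" for s using n that by linarith
    show "DERIV ln s :> 1 / s" if "norm \<theta> / 2 \<le> s" "s \<le> norm \<theta>" for s
      using pos[OF that(1)] by (auto intro!: derivative_eq_intros)
    show "isCont (\<lambda>s. 1 / s) s" if "norm \<theta> / 2 \<le> s" "s \<le> norm \<theta>" for s
      using pos[OF that(1)] by (intro continuous_intros) auto
  qed simp
  also have "\<dots> = ln 2" using n by (simp add: ln_div)
  finally show ?thesis by (simp add: cutoff_def)
qed

lemma cutoff_eq_0:
  assumes "norm \<theta> > 2 * \<delta>" "\<delta> > 0"
  shows "cutoff \<delta> \<theta> = 0"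
proof -
  have "\<theta> \<noteq> 0" using assms by auto
  hence "radial_density \<delta> s \<theta> = 0" for s
    using assms by (auto simp: radial_density_eq indicator_def)
  thus ?thesis by (simp add: cutoff_def)
qed

lemma radial_density_measurable [measurable]:
  "(\<lambda>x. radial_density \<delta> (fst x) (snd x)) \<in> borel_measurable (borel \<Otimes>\<^sub>M (borel :: 'a::euclidean_space measure))"
  unfolding radial_density_def by measurable

lemma radial_density_measurable' [measurable]:
  "radial_density \<delta> s \<in> borel_measurable (borel :: 'a::euclidean_space measure)"
  unfolding radial_density_def[abs_def] by measurable

text \<open>
  The factor \<open>1 / s\<close> is harmless: the scaled shell has volume proportional to \<open>s\<^sup>m\<close>, where \<open>m \<ge> 1\<close> is the dimension.
\<close>

lemma integrable_radial_density:
  fixes F :: "'a::euclidean_space \<Rightarrow> complex"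
  assumes F: "F \<in> borel_measurable borel" "\<And>\<theta>. norm (F \<theta>) \<le> M" and \<delta>: "\<delta> > 0"
  shows "integrable (lborel \<Otimes>\<^sub>M lborel) (\<lambda>x. of_real (radial_density \<delta> (fst x) (snd x)) * F (snd x))"
proof -
  let ?f = "\<lambda>x. of_real (radial_density \<delta> (fst x) (snd x)) * F (snd x)"
  let ?vol = "measure lborel (shell :: 'a set)"
  note [measurable] = F(1)
  have M: "M \<ge> 0" using F(2)[of 0] norm_ge_zero order_trans by blast
  have meas: "?f \<in> borel_measurable (lborel \<Otimes>\<^sub>M lborel)" by measurable
  have fin: "emeasure lborel (shell :: 'a set) < \<infinity>"
    by (rule emeasure_compact_finite[OF compact_shell])
  have scaled: "indicator shell ((1 / s) *\<^sub>R \<theta>) = indicat_real ((\<lambda>y. s *\<^sub>R y) ` shell) \<theta>" if "s > 0" for s and \<theta> :: 'a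
  proof -
    have "(1 / s) *\<^sub>R \<theta> \<in> shell \<longleftrightarrow> \<theta> \<in> (\<lambda>y. s *\<^sub>R y) ` shell"
      using that by (auto simp: image_iff intro!: bexI[of _ "(1 / s) *\<^sub>R \<theta>"])
    thus ?thesis by (simp add: indicator_def)
  qed
  have cpt: "compact ((\<lambda>y. s *\<^sub>R y) ` (shell :: 'a set))" for s
    by (intro compact_scaling compact_shell)
  have int1: "integrable lborel (\<lambda>\<theta>::'a. radial_density \<delta> s \<theta>)" for s
  proof (cases "s > 0")
    case True
    have "integrable lborel (indicat_real ((\<lambda>y. s *\<^sub>R y) ` (shell::'a set)))"
      using emeasure_compact_finite[OF cpt[of s]] by (simp add: integrable_indicator_iff borel_compact[OF cpt])
    thus ?thesis unfolding radial_density_def scaled[OF True] by simp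
  next
    case False
    hence "radial_density \<delta> s = (\<lambda>\<theta>::'a. 0)"
      by (auto simp: radial_density_def indicator_def fun_eq_iff shell_iff)
    thus ?thesis by simp
  qed
  have val: "(\<integral>\<theta>. radial_density \<delta> s (\<theta> :: 'a) \<partial>lborel) = indicator {0..\<delta>} s * (s ^ DIM('a) * ?vol / s)" for s
  proof (cases "s > 0")
    case True
    have "complex_of_real (\<integral>\<theta>. indicator shell ((1 / s) *\<^sub>R (\<theta>::'a)) \<partial>lborel)
      = (\<integral>\<theta>. complex_of_real (indicator shell ((1 / s) *\<^sub>R (\<theta>::'a))) \<partial>lborel)" by simp
    also have "\<dots> = of_real (s ^ DIM('a)) * (\<integral>\<theta>. complex_of_real (indicator shell ((1 / s) *\<^sub>R (s *\<^sub>R (\<theta>::'a)))) \<partial>lborel)"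
      using True by (intro integral_scale) auto
    also have "\<dots> = of_real (s ^ DIM('a)) * of_real (\<integral>\<theta>. indicator shell (\<theta>::'a) \<partial>lborel)"
      unfolding integral_complex_of_real[symmetric] using True by simp
    also have "\<dots> = of_real (s ^ DIM('a) * ?vol)"
      using fin by simp
    finally have "(\<integral>\<theta>. indicator shell ((1 / s) *\<^sub>R (\<theta>::'a)) \<partial>lborel) = s ^ DIM('a) * ?vol"
      using of_real_eq_iff by blast
    thus ?thesis unfolding radial_density_def by simp
  next
    case False
    hence "radial_density \<delta> s = (\<lambda>\<theta>::'a. 0)"
      by (auto simp: radial_density_def indicator_def fun_eq_iff shell_iff)
    thus ?thesis using False by (auto simp: indicator_def)
  qed
  show ?thesis
  proof (rule lborel_pair.Fubini_integrable[OF meas])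
    have bound: "norm (?f (s, \<theta>)) \<le> M * radial_density \<delta> s \<theta>" for s \<theta>
      using F(2)[of \<theta>] radial_density_nonneg[of \<delta> s \<theta>] M by (simp add: norm_mult mult.commute mult_right_mono)
    have intF: "integrable lborel (\<lambda>\<theta>. ?f (s, \<theta>))" for s
    proof (rule Bochner_Integration.integrable_bound)
      show "integrable lborel (\<lambda>\<theta>. M * radial_density \<delta> s (\<theta> :: 'a))" using int1 by simp
      show "AE \<theta> in lborel. norm (?f (s, \<theta>)) \<le> norm (M * radial_density \<delta> s \<theta>)"
      proof (intro AE_I2)
        fix \<theta> :: 'a
        have "norm (M * radial_density \<delta> s \<theta>) = M * radial_density \<delta> s \<theta>"
          using M radial_density_nonneg[of \<delta> s \<theta>] by simp
        with bound[of s \<theta>] show "norm (?f (s, \<theta>)) \<le> norm (M * radial_density \<delta> s \<theta>)" by simp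
      qed
    qed (simp only: fst_conv snd_conv, measurable)
    show "AE s in lborel. integrable lborel (\<lambda>\<theta>. ?f (s, \<theta>))" using intF by blast
    show "integrable lborel (\<lambda>s. \<integral>\<theta>. norm (?f (s, \<theta>)) \<partial>lborel)"
    proof (rule Bochner_Integration.integrable_bound)
      show "integrable lborel (\<lambda>s. indicator {0..\<delta>} s *\<^sub>R (M * (\<delta> ^ (DIM('a) - 1) * ?vol)))"
        by (intro integrable_scaleR_left) (simp add: integrable_indicator_unit)
      show "AE s in lborel. norm (\<integral>\<theta>. norm (?f (s, \<theta>)) \<partial>lborel) \<le> norm (indicator {0..\<delta>} s *\<^sub>R (M * (\<delta> ^ (DIM('a) - 1) * ?vol)))"
      proof (intro AE_I2)
        fix s
        have "norm (\<integral>\<theta>. norm (?f (s, \<theta>)) \<partial>lborel) = (\<integral>\<theta>. norm (?f (s, \<theta>)) \<partial>lborel)"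
          by (simp add: integral_nonneg_AE)
        also have "\<dots> \<le> (\<integral>\<theta>. M * radial_density \<delta> s (\<theta> :: 'a) \<partial>lborel)"
          using bound int1[of s] intF[of s] by (intro integral_mono) auto
        also have "\<dots> = M * (indicator {0..\<delta>} s * (s ^ DIM('a) * ?vol / s))" by (simp add: val)
        also have "\<dots> \<le> indicator {0..\<delta>} s *\<^sub>R (M * (\<delta> ^ (DIM('a) - 1) * ?vol))"
        proof (cases "s \<in> {0..\<delta>}")
          case True
          have "s ^ DIM('a) / s \<le> \<delta> ^ (DIM('a) - 1)"
          proof (cases "s = 0")
            case False
            hence "s ^ DIM('a) / s = s ^ (DIM('a) - 1)"
              by (metis DIM_positive power_minus_mult nonzero_mult_div_cancel_right)
            thus ?thesis using True by (simp add: power_mono)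
          qed (use \<delta> in auto)
          hence "s ^ DIM('a) / s * (M * ?vol) \<le> \<delta> ^ (DIM('a) - 1) * (M * ?vol)"
            using M by (intro mult_right_mono) auto
          thus ?thesis using True by (simp add: mult_ac)
        qed simp
        also have "\<dots> \<le> norm (indicator {0..\<delta>} s *\<^sub>R (M * (\<delta> ^ (DIM('a) - 1) * ?vol)))" by simp
        finally show "norm (\<integral>\<theta>. norm (?f (s, \<theta>)) \<partial>lborel) \<le> norm (indicator {0..\<delta>} s *\<^sub>R (M * (\<delta> ^ (DIM('a) - 1) * ?vol)))" .
      qed
    qed measurable
  qed
qed

lemma integrable_cutoff:
  assumes "\<delta> > 0"
  shows "integrable lborel (cutoff \<delta> :: 'a::euclidean_space \<Rightarrow> real)"
proof -
  have "integrable (lborel \<Otimes>\<^sub>M lborel) (\<lambda>x. complex_of_real (radial_density \<delta> (fst x) (snd x :: 'a)))"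
    using integrable_radial_density[of "\<lambda>_. 1" 1 \<delta>] assms by simp
  hence "integrable (lborel \<Otimes>\<^sub>M lborel) (\<lambda>(s, \<theta> :: 'a). radial_density \<delta> s \<theta>)"
    by (simp add: case_prod_beta' complex_of_real_integrable_eq)
  from lborel_pair.integrable_snd[OF this] show ?thesis
    unfolding cutoff_def by simp
qed

lemma cutoff_integral_polar:
  fixes F :: "'a::euclidean_space \<Rightarrow> complex"
  assumes F: "continuous_on UNIV F" "\<And>\<theta>. norm (F \<theta>) \<le> M" and \<delta>: "\<delta> > 0"
  shows "(\<integral>\<theta>. cutoff \<delta> \<theta> *\<^sub>R F \<theta> \<partial>lborel) = of_real (1 / ln 2) *
    (\<integral>y. indicat_real shell y *\<^sub>R (\<integral>t. indicat_real {0..\<delta>} t *\<^sub>R (of_real t ^ (DIM('a) - 1) * F (t *\<^sub>R y)) \<partial>lborel) \<partial>lborel)"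
proof -
  have Fm[measurable]: "F \<in> borel_measurable borel" using F(1) by (rule borel_measurable_continuous_onI)
  let ?d = "\<lambda>s \<theta>. of_real (radial_density \<delta> s \<theta>) * F \<theta>"
  have int: "integrable (lborel \<Otimes>\<^sub>M lborel) (\<lambda>(s, \<theta>). ?d s \<theta>)"
    using integrable_radial_density[OF Fm F(2) \<delta>] by (simp add: case_prod_beta')
  have "(\<integral>\<theta>. cutoff \<delta> \<theta> *\<^sub>R F \<theta> \<partial>lborel) = (\<integral>\<theta>. of_real (1 / ln 2) * (\<integral>s. ?d s \<theta> \<partial>lborel) \<partial>lborel)"
    by (simp add: cutoff_def scaleR_conv_of_real)
  also have "\<dots> = of_real (1 / ln 2) * (\<integral>\<theta>. (\<integral>s. ?d s \<theta> \<partial>lborel) \<partial>lborel)"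
    by (rule integral_mult_right_zero)
  also have "(\<integral>\<theta>. (\<integral>s. ?d s \<theta> \<partial>lborel) \<partial>lborel) = (\<integral>s. (\<integral>\<theta>. ?d s \<theta> \<partial>lborel) \<partial>lborel)"
    by (rule lborel_pair.Fubini_integral[OF int])
  also have "\<dots> = (\<integral>s. (\<integral>y. indicat_real {0..\<delta>} s *\<^sub>R (indicat_real shell y *\<^sub>R (of_real s ^ (DIM('a) - 1) * F (s *\<^sub>R y))) \<partial>lborel) \<partial>lborel)"
  proof (rule integral_cong_AE)
    show "AE s in lborel. (\<integral>\<theta>. ?d s \<theta> \<partial>lborel) = (\<integral>y. indicat_real {0..\<delta>} s *\<^sub>R (indicat_real shell y *\<^sub>R (of_real s ^ (DIM('a) - 1) * F (s *\<^sub>R y))) \<partial>lborel)"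
      using AE_lborel_singleton[of 0]
    proof eventually_elim
      case (elim s)
      show ?case
      proof (cases "s > 0")
        case True
        have "(\<integral>\<theta>. ?d s \<theta> \<partial>lborel) = of_real (s ^ DIM('a)) * (\<integral>y. ?d s (s *\<^sub>R y) \<partial>lborel)"
          by (rule integral_scale[OF True]) measurable
        also have "\<dots> = (\<integral>y. of_real (s ^ DIM('a)) * ?d s (s *\<^sub>R y) \<partial>lborel)"
          by (rule integral_mult_right_zero[symmetric])
        also have "\<dots> = (\<integral>y. indicat_real {0..\<delta>} s *\<^sub>R (indicat_real shell y *\<^sub>R (of_real s ^ (DIM('a) - 1) * F (s *\<^sub>R y))) \<partial>lborel)"
        proof (rule Bochner_Integration.integral_cong[OF refl])
          fix y :: 'a
          have "s ^ DIM('a) = s ^ (DIM('a) - 1) * s" by (metis DIM_positive power_minus_mult)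
          thus "of_real (s ^ DIM('a)) * ?d s (s *\<^sub>R y) = indicat_real {0..\<delta>} s *\<^sub>R (indicat_real shell y *\<^sub>R (of_real s ^ (DIM('a) - 1) * F (s *\<^sub>R y)))"
            using True by (simp add: radial_density_def scaleR_conv_of_real)
        qed
        finally show ?thesis .
      qed (use elim in \<open>auto simp: radial_density_def indicator_def\<close>)
    qed
  qed measurable
  also have "\<dots> = (\<integral>y. (\<integral>s. indicat_real {0..\<delta>} s *\<^sub>R (indicat_real shell y *\<^sub>R (of_real s ^ (DIM('a) - 1) * F (s *\<^sub>R y))) \<partial>lborel) \<partial>lborel)"
  proof (rule lborel_pair.Fubini_integral[symmetric])
    have "integrable lborel (\<lambda>x. indicat_real ({0..\<delta>} \<times> (shell::'a set)) x *\<^sub>R (of_real (fst x) ^ (DIM('a) - 1) * F (fst x *\<^sub>R snd x)))"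
    proof (rule integrable_weighted)
      have c: "compact ({0..\<delta>} \<times> (shell::'a set))" by (intro compact_Times compact_Icc compact_shell)
      show "integrable lborel (indicat_real ({0..\<delta>} \<times> (shell::'a set)))"
        using emeasure_compact_finite[OF c] by (simp add: integrable_indicator_iff borel_compact[OF c])
      show "compact ({0..\<delta>} \<times> (shell::'a set))" by (rule c)
      show "continuous_on ({0..\<delta>} \<times> shell) (\<lambda>x. of_real (fst x) ^ (DIM('a) - 1) * F (fst x *\<^sub>R snd x))"
        by (intro continuous_intros continuous_on_compose2[OF F(1)]) auto
    qed auto
    thus "integrable (lborel \<Otimes>\<^sub>M lborel) (\<lambda>(s, y). indicat_real {0..\<delta>} s *\<^sub>R (indicat_real shell y *\<^sub>R (of_real s ^ (DIM('a) - 1) * F (s *\<^sub>R y))))"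
      unfolding lborel_prod by (simp add: case_prod_beta' indicator_times)
  qed
  also have "\<dots> = (\<integral>y. indicat_real shell y *\<^sub>R (\<integral>t. indicat_real {0..\<delta>} t *\<^sub>R (of_real t ^ (DIM('a) - 1) * F (t *\<^sub>R y)) \<partial>lborel) \<partial>lborel)"
    by (rule Bochner_Integration.integral_cong[OF refl]) (simp add: indicator_def)
  finally show ?thesis .
qed

text \<open>
  The remainder is the divided difference of the divided difference of \<open>exp\<close> at the origin. Its value at \<open>0\<close> comes
  from differentiating \<open>exp w = 1 + w h\<^sub>1(w)\<close> twice.
\<close>

lemma exp_quadratic_remainder:
  obtains h :: "complex \<Rightarrow> complex" where "h holomorphic_on UNIV" "h 0 = 1 / 2" "\<And>w. exp w = 1 + w + w\<^sup>2 * h w"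
proof -
  define h1 :: "complex \<Rightarrow> complex" where "h1 w = (if w = 0 then deriv exp 0 else (exp w - exp 0) / (w - 0))" for w
  define h where "h w = (if w = 0 then deriv h1 0 else (h1 w - h1 0) / (w - 0))" for w
  have hol1: "h1 holomorphic_on UNIV"
    unfolding h1_def by (intro pole_lemma_open holomorphic_on_exp open_UNIV holomorphic_intros)
  have hol: "h holomorphic_on UNIV"
    unfolding h_def by (intro pole_lemma_open hol1 open_UNIV)
  have e1: "exp w = 1 + w * h1 w" for w by (simp add: h1_def)
  have h10: "h1 0 = 1" by (simp add: h1_def DERIV_imp_deriv[OF DERIV_exp])
  have d1: "(h1 has_field_derivative deriv h1 w) (at w)" for w
    by (rule holomorphic_derivI[OF hol1 open_UNIV UNIV_I])
  have d2: "(deriv h1 has_field_derivative deriv (deriv h1) w) (at w)" for w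
    by (rule holomorphic_derivI[OF holomorphic_deriv[OF hol1 open_UNIV] open_UNIV UNIV_I])
  have "exp w = h1 w + w * deriv h1 w" for w
  proof -
    have "((\<lambda>w. 1 + w * h1 w) has_field_derivative h1 w + w * deriv h1 w) (at w)"
      by (auto intro!: derivative_eq_intros d1)
    thus ?thesis unfolding e1[symmetric] using DERIV_unique[OF DERIV_exp] by blast
  qed
  hence "exp = (\<lambda>w. h1 w + w * deriv h1 w)" by auto
  moreover have "((\<lambda>w. h1 w + w * deriv h1 w) has_field_derivative 2 * deriv h1 0) (at 0)"
    by (auto intro!: derivative_eq_intros d1 d2)
  ultimately have "(exp has_field_derivative 2 * deriv h1 0) (at 0)" by metis
  from DERIV_unique[OF this DERIV_exp] have "h 0 = 1 / 2" by (simp add: h_def field_simps)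
  moreover have "h1 w = 1 + w * h w" for w using h10 by (simp add: h_def)
  hence "exp w = 1 + w + w\<^sup>2 * h w" for w
    unfolding e1 by (simp add: algebra_simps power2_eq_square)
  ultimately show thesis using that hol by blast
qed

section \<open>Green functions of centred random walks\<close>

definition quad_rem :: "complex \<Rightarrow> complex" where
  "quad_rem = (SOME h. h holomorphic_on UNIV \<and> h 0 = 1 / 2 \<and> (\<forall>w. exp w = 1 + w + w\<^sup>2 * h w))"

lemma quad_rem: "quad_rem holomorphic_on UNIV" "quad_rem 0 = 1 / 2" "exp w = 1 + w + w\<^sup>2 * quad_rem w"
proof -
  have "\<exists>h. h holomorphic_on UNIV \<and> h 0 = 1 / 2 \<and> (\<forall>w. exp w = 1 + w + w\<^sup>2 * h w)"
    using exp_quadratic_remainder by metis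
  from someI_ex[OF this]
  show "quad_rem holomorphic_on UNIV" "quad_rem 0 = 1 / 2" "exp w = 1 + w + w\<^sup>2 * quad_rem w"
    unfolding quad_rem_def[symmetric] by blast+
qed

lemma quad_rem_deriv: "(quad_rem has_field_derivative deriv quad_rem w) (at w)"
  by (rule holomorphic_derivI[OF quad_rem(1) open_UNIV UNIV_I])

lemma continuous_on_quad_rem: "continuous_on UNIV quad_rem" "continuous_on UNIV (deriv quad_rem)"
  using quad_rem(1) holomorphic_deriv[OF quad_rem(1) open_UNIV] by (auto intro: holomorphic_on_imp_continuous_on)

text \<open>
  The step distribution of a random walk with finite support \<open>S\<close>, mean zero, and not supported on a hyperplane.
\<close>

locale centred_walk =
  fixes S :: "'a::euclidean_space set" and p :: "'a \<Rightarrow> real"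
  assumes fin: "finite S" and p_pos: "\<And>k. k \<in> S \<Longrightarrow> p k > 0" and p_sum: "sum p S = 1"
    and p_mean: "(\<Sum>k\<in>S. p k *\<^sub>R k) = 0"
    and p_span: "\<And>u. u \<noteq> 0 \<Longrightarrow> \<exists>k\<in>S. k \<bullet> u \<noteq> 0"
begin

definition char :: "'a \<Rightarrow> complex" where
  "char \<theta> = (\<Sum>k\<in>S. of_real (p k) * exp (\<i> * of_real (k \<bullet> \<theta>)))"

lemma norm_char: "norm (char \<theta>) \<le> 1"
proof -
  have "norm (char \<theta>) \<le> (\<Sum>k\<in>S. norm (of_real (p k) * exp (\<i> * of_real (k \<bullet> \<theta>))))"
    unfolding char_def by (rule norm_sum)
  also have "\<dots> = sum p S"
    using p_pos by (intro sum.cong) (auto simp: norm_mult less_imp_le)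
  finally show ?thesis by (simp add: p_sum)
qed

lemma continuous_on_char: "continuous_on X char"
  unfolding char_def by (intro continuous_intros)

lemma char_0: "char 0 = 1"
  by (simp add: char_def p_sum flip: of_real_sum)

text \<open>
  The value \<open>1\<close> is a convex combination of points of the unit circle, hence all of them are \<open>1\<close>.
\<close>

lemma char_eq_1_iff: "char l = 1 \<longleftrightarrow> (\<forall>k\<in>S. exp (\<i> * of_real (k \<bullet> l)) = 1)"
proof
  assume "char l = 1"
  hence "Re (char l) = 1" by simp
  hence "(\<Sum>k\<in>S. p k * cos (k \<bullet> l)) = sum p S"
    by (simp add: char_def p_sum Re_exp)
  hence "(\<Sum>k\<in>S. p k * (1 - cos (k \<bullet> l))) = 0"
    by (simp add: right_diff_distrib sum_subtractf)
  hence *: "p k * (1 - cos (k \<bullet> l)) = 0" if "k \<in> S" for k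
    using that p_pos fin by (subst (asm) sum_nonneg_eq_0_iff) (auto intro!: mult_nonneg_nonneg simp: less_imp_le)
  show "\<forall>k\<in>S. exp (\<i> * of_real (k \<bullet> l)) = 1"
  proof
    fix k assume k: "k \<in> S"
    have c: "cos (k \<bullet> l) = 1" using *[OF k] p_pos[OF k] by simp
    hence "sin (k \<bullet> l) = 0" using sin_cos_squared_add[of "k \<bullet> l"] by simp
    with c show "exp (\<i> * of_real (k \<bullet> l)) = 1"
      by (simp add: complex_eq_iff Re_exp Im_exp)
  qed
next
  assume "\<forall>k\<in>S. exp (\<i> * of_real (k \<bullet> l)) = 1"
  hence "char l = (\<Sum>k\<in>S. of_real (p k))" unfolding char_def by (intro sum.cong) auto
  thus "char l = 1" by (simp add: p_sum flip: of_real_sum)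
qed

lemma char_periodic: "char l = 1 \<Longrightarrow> char (l + \<theta>) = char \<theta>"
  unfolding char_eq_1_iff unfolding char_def
  by (intro sum.cong) (auto simp: inner_add_right distrib_left exp_add)

lemma char_diff: "char l = 1 \<Longrightarrow> char l' = 1 \<Longrightarrow> char (l - l') = 1"
  unfolding char_eq_1_iff by (auto simp: inner_diff_right right_diff_distrib exp_diff)

text \<open>
  Since the mean is zero, \<open>1 - char (s y)\<close> is divisible by \<open>s\<^sup>2\<close>; \<open>Q\<close> is the quotient, \<open>Q'\<close> its derivative in \<open>s\<close>, and
  \<open>var y\<close> is half the variance of the step in direction \<open>y\<close>.
\<close>

definition "Q y s = (\<Sum>k\<in>S. of_real (p k * (k \<bullet> y)\<^sup>2) * quad_rem (\<i> * s * of_real (k \<bullet> y)))"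
definition "Q' y s = (\<Sum>k\<in>S. of_real (p k * (k \<bullet> y)\<^sup>2) * (deriv quad_rem (\<i> * s * of_real (k \<bullet> y)) * (\<i> * of_real (k \<bullet> y))))"
definition "var y = (\<Sum>k\<in>S. p k * (k \<bullet> y)\<^sup>2 / 2)"

lemma char_along_ray: "char (t *\<^sub>R y) = 1 - (of_real t)\<^sup>2 * Q y (of_real t)"
proof -
  have mean: "(\<Sum>k\<in>S. p k * (k \<bullet> y)) = 0"
    using p_mean by (metis (no_types, lifting) inner_scaleR_left inner_sum_left inner_zero_left sum.cong)
  have "char (t *\<^sub>R y) = (\<Sum>k\<in>S. of_real (p k) + \<i> * of_real t * of_real (p k * (k \<bullet> y))
      - (of_real t)\<^sup>2 * (of_real (p k * (k \<bullet> y)\<^sup>2) * quad_rem (\<i> * of_real t * of_real (k \<bullet> y))))"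
    unfolding char_def
  proof (intro sum.cong refl)
    fix k
    have "exp (\<i> * of_real (k \<bullet> (t *\<^sub>R y))) = exp (\<i> * of_real t * of_real (k \<bullet> y))" by (simp add: mult_ac)
    also have "\<dots> = 1 + \<i> * of_real t * of_real (k \<bullet> y) + (\<i> * of_real t * of_real (k \<bullet> y))\<^sup>2 * quad_rem (\<i> * of_real t * of_real (k \<bullet> y))"
      by (rule quad_rem(3))
    finally show "of_real (p k) * exp (\<i> * of_real (k \<bullet> (t *\<^sub>R y))) = of_real (p k) + \<i> * of_real t * of_real (p k * (k \<bullet> y))
      - (of_real t)\<^sup>2 * (of_real (p k * (k \<bullet> y)\<^sup>2) * quad_rem (\<i> * of_real t * of_real (k \<bullet> y)))"
      by (simp add: power_mult_distrib distrib_left right_diff_distrib mult_ac)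
  qed
  also have "\<dots> = (\<Sum>k\<in>S. of_real (p k)) + (\<Sum>k\<in>S. \<i> * of_real t * of_real (p k * (k \<bullet> y))) - (of_real t)\<^sup>2 * Q y (of_real t)"
    by (simp only: sum_subtractf sum.distrib Q_def sum_distrib_left)
  also have "(\<Sum>k\<in>S. \<i> * of_real t * of_real (p k * (k \<bullet> y))) = \<i> * of_real t * of_real (\<Sum>k\<in>S. p k * (k \<bullet> y))"
    by (simp add: sum_distrib_left)
  finally show ?thesis by (simp add: mean p_sum flip: of_real_sum)
qed

sublocale ray_family shell Q Q' var "DIM('a)"
proof unfold_locales
  show "compact (shell :: 'a set)" by (rule compact_shell)
  show "emeasure lborel (shell :: 'a set) > 0" by (rule emeasure_shell)
  show "continuous_on (shell \<times> UNIV) (\<lambda>x. Q (fst x) (snd x))"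
    unfolding Q_def by (intro continuous_intros continuous_on_compose2[OF continuous_on_quad_rem(1)]) auto
  show "continuous_on (shell \<times> UNIV) (\<lambda>x. Q' (fst x) (snd x))"
    unfolding Q'_def by (intro continuous_intros continuous_on_compose2[OF continuous_on_quad_rem(2)]) auto
  show "(Q y has_field_derivative Q' y s) (at s)" for y s
    unfolding Q_def Q'_def
  proof (intro DERIV_sum DERIV_cmult)
    fix k
    have "((\<lambda>s. \<i> * s * of_real (k \<bullet> y)) has_field_derivative \<i> * of_real (k \<bullet> y)) (at s)"
      by (auto intro!: derivative_eq_intros)
    from DERIV_chain2[OF quad_rem_deriv this]
    show "((\<lambda>s. quad_rem (\<i> * s * of_real (k \<bullet> y))) has_field_derivative
      deriv quad_rem (\<i> * s * of_real (k \<bullet> y)) * (\<i> * of_real (k \<bullet> y))) (at s)" .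
  qed
  show "Q y 0 = of_real (var y)" for y
    by (simp add: Q_def var_def quad_rem(2))
  show "var y > 0" if "y \<in> shell" for y
  proof -
    have "y \<noteq> 0" using that by (auto simp: shell_iff)
    then obtain k where k: "k \<in> S" "k \<bullet> y \<noteq> 0" using p_span by blast
    show ?thesis unfolding var_def
    proof (rule sum_pos2[OF fin k(1)])
      show "0 < p k * (k \<bullet> y)\<^sup>2 / 2" using k p_pos by simp
      show "0 \<le> p i * (i \<bullet> y)\<^sup>2 / 2" if "i \<in> S" for i using p_pos[OF that] by simp
    qed
  qed
  show "norm (1 - (of_real t)\<^sup>2 * Q y (of_real t)) \<le> 1" for y t
    using norm_char[of "t *\<^sub>R y"] by (simp add: char_along_ray)
qed simp

end

text \<open>
  The functions \<open>A\<close>, \<open>B\<close>, \<open>C\<close> stay the same when \<open>\<epsilon>\<close> is decreased, so \<open>\<epsilon>\<close> may also be adapted to the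
  integral over the complement of the balls around the periods.
\<close>

lemma ray_disc_shrink:
  assumes "ray_disc Y q q' \<kappa> m R' R \<delta> \<eta> \<epsilon>" "0 < \<epsilon>'" "\<epsilon>' \<le> \<epsilon>"
  shows "ray_disc Y q q' \<kappa> m R' R \<delta> \<eta> \<epsilon>'"
proof -
  interpret ray_disc Y q q' \<kappa> m R' R \<delta> \<eta> \<epsilon> by fact
  show ?thesis
  proof unfold_locales
    show "4 * \<epsilon>' \<le> Re (g y (of_real \<delta>))" if "y \<in> Y" for y
      using g_end[OF that] assms(3) by simp
  qed (use radii \<eta>_pos Re_q_pos inj g_circle g_ray \<epsilon> assms in auto)
qed

context centred_walk
begin

lemma resolvent_bound:
  assumes "0 < x" "x < 1"
  shows "1 - of_real x * char \<theta> \<noteq> 0" "norm (1 / (1 - of_real x * char \<theta>)) \<le> 1 / (1 - x)"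
proof -
  have "norm (of_real x * char \<theta>) \<le> x * 1"
    unfolding norm_mult using norm_char[of \<theta>] assms by (intro mult_mono) auto
  hence *: "norm (1 - of_real x * char \<theta>) \<ge> 1 - x"
    using norm_triangle_ineq2[of 1 "of_real x * char \<theta>"] by simp
  thus "1 - of_real x * char \<theta> \<noteq> 0" using assms by auto
  show "norm (1 / (1 - of_real x * char \<theta>)) \<le> 1 / (1 - x)"
    using * assms by (simp add: norm_divide frac_le)
qed

lemma continuous_on_resolvent: "0 < x \<Longrightarrow> x < 1 \<Longrightarrow> continuous_on X (\<lambda>\<theta>. 1 / (1 - of_real x * char \<theta>))"
  using resolvent_bound(1) by (intro continuous_intros continuous_on_char) auto

text \<open>
  The periods form a group, and by the quadratic behaviour along rays \<open>0\<close> is an isolated point of it.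
\<close>

lemma periods_separated:
  obtains d where "d > 0" "\<And>l l'. char l = 1 \<Longrightarrow> char l' = 1 \<Longrightarrow> l \<noteq> l' \<Longrightarrow> dist l l' > d"
proof -
  obtain d0 where d0: "d0 > 0" "\<And>y t. y \<in> shell \<Longrightarrow> t \<in> {0<..d0} \<Longrightarrow> g y (of_real t) \<noteq> 0"
    using ray_disc_exists by metis
  have "dist l l' > d0" if "char l = 1" "char l' = 1" "l \<noteq> l'" for l l'
  proof (rule ccontr)
    assume *: "\<not> dist l l' > d0"
    define t where "t = norm (l - l')"
    have t: "t > 0" "t \<le> d0" using that(3) * by (auto simp: t_def dist_norm)
    have "(1 / t) *\<^sub>R (l - l') \<in> shell"
      using t by (simp add: shell_iff) (simp add: t_def)
    from d0(2)[OF this, of t] t have "(of_real t)\<^sup>2 * Q ((1 / t) *\<^sub>R (l - l')) (of_real t) \<noteq> 0"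
      by (simp add: g_def)
    moreover have "char (l - l') = 1 - (of_real t)\<^sup>2 * Q ((1 / t) *\<^sub>R (l - l')) (of_real t)"
      using char_along_ray[of t "(1 / t) *\<^sub>R (l - l')"] t by simp
    ultimately show False using char_diff[OF that(1,2)] by simp
  qed
  with d0(1) that show thesis by blast
qed

lemma finite_periods:
  assumes "bounded X"
  shows "finite {\<theta>\<in>X. char \<theta> = 1}"
proof -
  obtain d0 where "d0 > 0" "\<And>l l'. char l = 1 \<Longrightarrow> char l' = 1 \<Longrightarrow> l \<noteq> l' \<Longrightarrow> dist l l' > d0"
    using periods_separated by metis
  hence "uniform_discrete {\<theta>\<in>X. char \<theta> = 1}"
    unfolding uniform_discrete_def by (intro exI[of _ d0]) force
  moreover have "bounded {\<theta>\<in>X. char \<theta> = 1}" using assms by (rule bounded_subset) auto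
  ultimately show ?thesis using uniform_discrete_finite_iff by blast
qed

lemma resolvent_integral_near_period:
  assumes "char l = 1" "\<delta> > 0" "0 < x" "x < 1"
  shows "(\<integral>\<theta>. cutoff \<delta> (\<theta> - l) *\<^sub>R (1 / (1 - of_real x * char \<theta>)) \<partial>lborel) = of_real (1 / ln 2) *
    (\<integral>y. indicat_real shell y *\<^sub>R (\<integral>t. indicat_real {0..\<delta>} t *\<^sub>R
      (of_real t ^ (DIM('a) - 1) / (1 - of_real x * char (t *\<^sub>R y))) \<partial>lborel) \<partial>lborel)"
proof -
  have [measurable]: "char \<in> borel_measurable borel"
    using continuous_on_char by (rule borel_measurable_continuous_onI)
  have [measurable]: "cutoff \<delta> \<in> borel_measurable (borel :: 'a measure)"
    using integrable_cutoff[OF assms(2)] by auto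
  have "(\<integral>\<theta>. cutoff \<delta> (\<theta> - l) *\<^sub>R (1 / (1 - of_real x * char \<theta>)) \<partial>lborel)
      = (\<integral>\<theta>. cutoff \<delta> (l + \<theta> - l) *\<^sub>R (1 / (1 - of_real x * char (l + \<theta>))) \<partial>lborel)"
    by (rule integral_translate) measurable
  also have "\<dots> = (\<integral>\<theta>. cutoff \<delta> \<theta> *\<^sub>R (1 / (1 - of_real x * char \<theta>)) \<partial>lborel)"
    by (simp add: char_periodic[OF assms(1)])
  also have "\<dots> = of_real (1 / ln 2) *
    (\<integral>y. indicat_real shell y *\<^sub>R (\<integral>t. indicat_real {0..\<delta>} t *\<^sub>R
      (of_real t ^ (DIM('a) - 1) * (1 / (1 - of_real x * char (t *\<^sub>R y)))) \<partial>lborel) \<partial>lborel)"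
    by (rule cutoff_integral_polar[OF continuous_on_resolvent resolvent_bound(2)]) (use assms in auto)
  finally show ?thesis by simp
qed

text \<open>
  A partition of unity into cutoffs around the periods in \<open>K\<close> and a weight \<open>v\<close> that lives where \<open>\<bar>1 - char\<bar>\<close> is bounded
  below. The latter contributes a function that is holomorphic at \<open>z = 1\<close>, each of the former a fixed multiple of the
  radial integrals.
\<close>

lemma resolvent_integral_expansion:
  assumes K: "compact K" and inner: "\<And>\<theta>. \<theta> \<in> K \<Longrightarrow> char \<theta> = 1 \<Longrightarrow> \<theta> \<in> interior K"
    and nonempty: "\<exists>\<theta>\<in>K. char \<theta> = 1"
  obtains \<epsilon> A B C where "\<epsilon> > 0" "A holomorphic_on ball 1 \<epsilon>" "B holomorphic_on ball 1 \<epsilon>" "C holomorphic_on ball 1 \<epsilon>"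
    "\<exists>z\<in>ball 1 \<epsilon> - {1}. B z \<noteq> 0 \<or> C z \<noteq> 0"
    "\<And>x. x \<in> {1-\<epsilon><..<1} \<Longrightarrow> (\<integral>\<theta>. indicat_real K \<theta> *\<^sub>R (1 / (1 - of_real x * char \<theta>)) \<partial>lborel)
       = A (of_real x) + B (of_real x) / csqrt (1 - of_real x) + C (of_real x) * Ln (1 - of_real x)"
proof -
  obtain d1 where d1: "d1 > 0" "\<And>l l'. char l = 1 \<Longrightarrow> char l' = 1 \<Longrightarrow> l \<noteq> l' \<Longrightarrow> dist l l' > d1"
    using periods_separated by metis
  obtain d0 where d0: "d0 > 0" "\<And>\<delta>. \<delta> \<in> {0<..d0} \<Longrightarrow> \<exists>R' R \<eta> \<epsilon>. ray_disc shell Q Q' var DIM('a) R' R \<delta> \<eta> \<epsilon>"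
    using ray_disc_exists by metis
  define P where "P = {\<theta>\<in>K. char \<theta> = 1}"
  have finP: "finite P" unfolding P_def by (intro finite_periods compact_imp_bounded K)
  have charP: "char l = 1" if "l \<in> P" for l using that by (simp add: P_def)
  have "\<exists>d>0. \<forall>l\<in>P. cball l d \<subseteq> K"
    using finP inner
  proof -
    have "\<forall>l\<in>P. \<exists>d>0. cball l d \<subseteq> K" using inner by (auto simp: P_def mem_interior_cball)
    then obtain d where d: "\<And>l. l \<in> P \<Longrightarrow> d l > 0 \<and> cball l (d l) \<subseteq> K" by metis
    have "Min (insert 1 (d ` P)) > 0" using finP d by (subst Min_gr_iff) auto
    moreover have "cball l (Min (insert 1 (d ` P))) \<subseteq> K" if "l \<in> P" for l
    proof -
      have "Min (insert 1 (d ` P)) \<le> d l" using finP that by (intro Min_le) auto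
      thus ?thesis using d[OF that] by (meson order_trans subset_cball)
    qed
    ultimately show ?thesis by blast
  qed
  then obtain d2 where d2: "d2 > 0" "\<And>l. l \<in> P \<Longrightarrow> cball l d2 \<subseteq> K" by blast
  \<comment> \<open>The balls of radius \<open>2 \<delta>\<close> that support the cutoffs are disjoint and contained in \<open>K\<close>.\<close>
  define \<delta> where "\<delta> = min d0 (min (d1 / 5) (d2 / 3))"
  have \<delta>: "\<delta> > 0" "\<delta> \<le> d0" "5 * \<delta> \<le> d1" "3 * \<delta> \<le> d2" using d0 d1 d2 by (auto simp: \<delta>_def)
  obtain R' R \<eta> \<epsilon>1 where rd: "ray_disc shell Q Q' var DIM('a) R' R \<delta> \<eta> \<epsilon>1"
    using d0(2)[of \<delta>] \<delta> by auto
  define K' where "K' = K - (\<Union>l\<in>P. ball l \<delta>)"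
  have K': "compact K'" unfolding K'_def by (intro compact_diff K open_UN) auto
  have "1 \<notin> char ` K'"
  proof
    assume "1 \<in> char ` K'"
    then obtain \<theta> where "\<theta> \<in> K'" "char \<theta> = 1" by auto
    hence "\<theta> \<in> P" by (auto simp: P_def K'_def)
    thus False using \<open>\<theta> \<in> K'\<close> \<delta>(1) by (auto simp: K'_def)
  qed
  moreover have "closed (char ` K')"
    by (intro compact_imp_closed compact_continuous_image continuous_on_char K')
  ultimately obtain d3 where d3: "d3 > 0" "\<And>w. w \<in> char ` K' \<Longrightarrow> d3 \<le> dist 1 w"
    using separate_point_closed by metis
  define \<epsilon> where "\<epsilon> = min \<epsilon>1 d3"
  interpret big: ray_disc shell Q Q' var "DIM('a)" R' R \<delta> \<eta> \<epsilon>1 by (rule rd)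
  have eps: "\<epsilon> > 0" "\<epsilon> \<le> \<epsilon>1" "\<epsilon> \<le> d3" using d3 big.\<epsilon> by (auto simp: \<epsilon>_def)
  interpret ray_disc shell Q Q' var "DIM('a)" R' R \<delta> \<eta> \<epsilon>
    by (rule ray_disc_shrink[OF rd eps(1,2)])
  define v where "v \<theta> = indicat_real K' \<theta> * (1 - (\<Sum>l\<in>P. cutoff \<delta> (\<theta> - l)))" for \<theta>
  have int_cutoff: "integrable lborel (\<lambda>\<theta>::'a. cutoff \<delta> (\<theta> - l))" for l
  proof -
    have "integrable (distr lborel borel ((+) (- l))) (cutoff \<delta> :: 'a \<Rightarrow> real)"
      unfolding lborel_distr_plus by (rule integrable_cutoff[OF \<delta>(1)])
    from integrable_distr[OF _ this] show ?thesis by simp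
  qed
  have int_v: "integrable lborel v"
  proof -
    have "integrable lborel (indicat_real K')"
      using emeasure_compact_finite[OF K'] by (simp add: integrable_indicator_iff borel_compact[OF K'])
    moreover have "integrable lborel (\<lambda>\<theta>. indicat_real K' \<theta> *\<^sub>R (\<Sum>l\<in>P. cutoff \<delta> (\<theta> - l)))"
      using int_cutoff by (intro integrable_mult_indicator Bochner_Integration.integrable_sum) (simp_all add: borel_compact[OF K'])
    ultimately show ?thesis
      unfolding v_def[abs_def] by (simp add: right_diff_distrib)
  qed
  define A0 where "A0 z = (\<integral>\<theta>. v \<theta> *\<^sub>R (1 / (1 - z * char \<theta>)) \<partial>lborel)" for z
  have nz: "1 - z * char \<theta> \<noteq> 0" if "\<theta> \<in> K'" "z \<in> ball 1 \<epsilon>" for z \<theta>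
  proof
    assume "1 - z * char \<theta> = 0"
    hence "1 - char \<theta> = (z - 1) * char \<theta>" by (simp add: algebra_simps)
    hence "norm (1 - char \<theta>) = norm (z - 1) * norm (char \<theta>)" by (simp add: norm_mult)
    also have "\<dots> \<le> norm (z - 1) * 1" by (intro mult_left_mono norm_char) auto
    also have "\<dots> < d3" using that(2) eps by (simp add: dist_norm norm_minus_commute)
    finally show False using d3(2)[of "char \<theta>"] that(1) by (simp add: dist_norm)
  qed
  have hol0: "A0 holomorphic_on ball 1 \<epsilon>"
    unfolding A0_def
  proof (rule holomorphic_on_weighted_integral[OF int_v _ K'])
    show "continuous_on (ball 1 \<epsilon> \<times> K') (\<lambda>x. 1 / (1 - fst x * char (snd x)))"
      using nz by (intro continuous_intros continuous_on_compose2[OF continuous_on_char[of UNIV]]) auto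
    show "(\<lambda>z. 1 / (1 - z * char \<theta>)) holomorphic_on ball 1 \<epsilon>" if "\<theta> \<in> K'" for \<theta>
      using nz[OF that] by (intro holomorphic_intros) auto
  qed (auto simp: v_def)
  define c0 where "c0 = complex_of_real (real (card P) / ln 2)"
  have "P \<noteq> {}" using nonempty by (auto simp: P_def)
  hence c0: "c0 \<noteq> 0" using finP by (simp add: c0_def)
  show thesis
  proof (rule that[of \<epsilon> "\<lambda>z. A0 z + c0 * A z" "\<lambda>z. c0 * B z" "\<lambda>z. c0 * C z"])
    show "\<epsilon> > 0" by (rule eps)
    show "(\<lambda>z. A0 z + c0 * A z) holomorphic_on ball 1 \<epsilon>" "(\<lambda>z. c0 * B z) holomorphic_on ball 1 \<epsilon>"
      "(\<lambda>z. c0 * C z) holomorphic_on ball 1 \<epsilon>"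
      by (intro holomorphic_on_add holomorphic_on_mult holomorphic_on_const hol0 holomorphic_ABC)+
    show "\<exists>z\<in>ball 1 \<epsilon> - {1}. c0 * B z \<noteq> 0 \<or> c0 * C z \<noteq> 0"
      using singular_part_nontrivial c0 by simp
  next
    fix x assume x: "x \<in> {1-\<epsilon><..<1}"
    hence x': "0 < x" "x < 1" using big.\<epsilon> eps by auto
    let ?F = "\<lambda>\<theta>. 1 / (1 - of_real x * char \<theta>)"
    have [measurable]: "char \<in> borel_measurable borel"
      using continuous_on_char by (rule borel_measurable_continuous_onI)
    \<comment> \<open>The centres \<open>P\<close>, where the cutoffs vanish, are an exceptional null set.\<close>
    have partition: "indicat_real K \<theta> = v \<theta> + (\<Sum>l\<in>P. cutoff \<delta> (\<theta> - l))" if "\<theta> \<notin> P" for \<theta>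
    proof (cases "\<theta> \<in> K'")
      case True
      thus ?thesis by (simp add: v_def K'_def)
    next
      case False
      show ?thesis
      proof (cases "\<theta> \<in> K")
        case True
        then obtain l where l: "l \<in> P" "dist l \<theta> < \<delta>" using False by (auto simp: K'_def)
        have "cutoff \<delta> (\<theta> - l) = 1"
          using l \<open>\<theta> \<notin> P\<close> by (intro cutoff_eq_1) (auto simp: dist_norm norm_minus_commute)
        moreover have "cutoff \<delta> (\<theta> - l') = 0" if "l' \<in> P - {l}" for l'
        proof (rule cutoff_eq_0)
          have "dist l l' > d1" using that l charP by (intro d1) auto
          hence "dist l' \<theta> > 4 * \<delta>" using l \<delta> dist_triangle[of l l' \<theta>] by (simp add: dist_commute)
          thus "norm (\<theta> - l') > 2 * \<delta>" using \<delta> by (simp add: dist_norm norm_minus_commute)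
        qed (rule \<delta>)
        ultimately have "(\<Sum>l\<in>P. cutoff \<delta> (\<theta> - l)) = 1"
          using finP l(1) by (subst sum.remove[of _ l]) auto
        thus ?thesis using True False by (simp add: v_def)
      next
        case F: False
        have "cutoff \<delta> (\<theta> - l) = 0" if "l \<in> P" for l
        proof (rule cutoff_eq_0)
          have "\<theta> \<notin> cball l d2" using d2(2)[OF that] F by blast
          thus "norm (\<theta> - l) > 2 * \<delta>" using \<delta> by (simp add: dist_norm norm_minus_commute)
        qed (rule \<delta>)
        thus ?thesis using F False by (simp add: v_def)
      qed
    qed
    have intF: "integrable lborel (\<lambda>\<theta>. w \<theta> *\<^sub>R ?F \<theta>)" if "integrable lborel w" for w :: "'a \<Rightarrow> real"
    proof (rule Bochner_Integration.integrable_bound[of _ "\<lambda>\<theta>. (1 / (1 - x)) * w \<theta>"])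
      show "integrable lborel (\<lambda>\<theta>. (1 / (1 - x)) * w \<theta>)" using that by simp
      show "(\<lambda>\<theta>. w \<theta> *\<^sub>R ?F \<theta>) \<in> borel_measurable lborel"
        using borel_measurable_integrable[OF that] by measurable
      show "AE \<theta> in lborel. norm (w \<theta> *\<^sub>R ?F \<theta>) \<le> norm ((1 / (1 - x)) * w \<theta>)"
      proof (intro AE_I2)
        fix \<theta>
        from mult_left_mono[OF resolvent_bound(2)[OF x', of \<theta>], of "\<bar>w \<theta>\<bar>"] x'
        show "norm (w \<theta> *\<^sub>R ?F \<theta>) \<le> norm ((1 / (1 - x)) * w \<theta>)"
          by (simp add: abs_mult mult.commute)
      qed
    qed
    have "(\<integral>\<theta>. indicat_real K \<theta> *\<^sub>R ?F \<theta> \<partial>lborel)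
        = (\<integral>\<theta>. v \<theta> *\<^sub>R ?F \<theta> + (\<Sum>l\<in>P. cutoff \<delta> (\<theta> - l) *\<^sub>R ?F \<theta>) \<partial>lborel)"
    proof (rule integral_cong_AE)
      have "AE \<theta> in lborel. \<theta> \<notin> P"
        by (rule AE_not_in) (rule finite_imp_null_set_lborel[OF finP])
      thus "AE \<theta> in lborel. indicat_real K \<theta> *\<^sub>R ?F \<theta> = v \<theta> *\<^sub>R ?F \<theta> + (\<Sum>l\<in>P. cutoff \<delta> (\<theta> - l) *\<^sub>R ?F \<theta>)"
        by eventually_elim (subst partition, assumption, simp only: scaleR_add_left scaleR_sum_left)
      show "(\<lambda>\<theta>. indicat_real K \<theta> *\<^sub>R ?F \<theta>) \<in> borel_measurable lborel"
        using borel_compact[OF K] by measurable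
      show "(\<lambda>\<theta>. v \<theta> *\<^sub>R ?F \<theta> + (\<Sum>l\<in>P. cutoff \<delta> (\<theta> - l) *\<^sub>R ?F \<theta>)) \<in> borel_measurable lborel"
        by (intro borel_measurable_add borel_measurable_sum borel_measurable_integrable intF int_v int_cutoff)
    qed
    also have "\<dots> = A0 (of_real x) + (\<Sum>l\<in>P. \<integral>\<theta>. cutoff \<delta> (\<theta> - l) *\<^sub>R ?F \<theta> \<partial>lborel)"
      unfolding A0_def using intF[OF int_v] intF[OF int_cutoff]
      by (subst Bochner_Integration.integral_add) (auto simp: Bochner_Integration.integral_sum)
    also have "(\<Sum>l\<in>P. \<integral>\<theta>. cutoff \<delta> (\<theta> - l) *\<^sub>R ?F \<theta> \<partial>lborel) = (\<Sum>l\<in>P. of_real (1 / ln 2) *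
       (A (of_real x) + B (of_real x) / csqrt (1 - of_real x) + C (of_real x) * Ln (1 - of_real x)))"
    proof (rule sum.cong[OF refl])
      fix l assume "l \<in> P"
      have D: "1 - of_real x * char (t *\<^sub>R y) = D y (of_real x) (of_real t)" for t y
        by (simp add: D_def g_def char_along_ray algebra_simps)
      show "(\<integral>\<theta>. cutoff \<delta> (\<theta> - l) *\<^sub>R ?F \<theta> \<partial>lborel) = of_real (1 / ln 2) *
       (A (of_real x) + B (of_real x) / csqrt (1 - of_real x) + C (of_real x) * Ln (1 - of_real x))"
        unfolding resolvent_integral_near_period[OF charP[OF \<open>l \<in> P\<close>] \<delta>(1) x'] D radial_integral_expansion[OF x] ..
    qed
    also have "\<dots> = c0 * (A (of_real x) + B (of_real x) / csqrt (1 - of_real x) + C (of_real x) * Ln (1 - of_real x))"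
      by (simp add: c0_def)
    finally show "(\<integral>\<theta>. indicat_real K \<theta> *\<^sub>R ?F \<theta> \<partial>lborel)
       = A0 (of_real x) + c0 * A (of_real x) + c0 * B (of_real x) / csqrt (1 - of_real x) + c0 * C (of_real x) * Ln (1 - of_real x)"
      by (simp add: distrib_left mult.assoc)
  qed
qed

end

section \<open>Multi-valued functions with a square root and a logarithm\<close>

text \<open>
  The nontriviality assumption is about points other than \<open>t0\<close> and thus says that \<open>B\<close> and \<open>C\<close> do not both vanish
  identically.
\<close>

locale log_sqrt_singularity =
  fixes t0 \<epsilon> :: real and A B C G :: "complex \<Rightarrow> complex"
  assumes t0_pos: "t0 > 0" and eps_pos: "\<epsilon> > 0"
    and hol: "A holomorphic_on ball (of_real t0) \<epsilon>" "B holomorphic_on ball (of_real t0) \<epsilon>"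
      "C holomorphic_on ball (of_real t0) \<epsilon>"
    and G_eq: "\<And>t. t \<in> ball 0 t0 \<Longrightarrow> t \<in> ball (of_real t0) \<epsilon> \<Longrightarrow>
      G t = A t + B t / csqrt (1 - t / t0) + C t * Ln (1 - t / t0)"
    and nontrivial: "\<exists>t\<in>ball (of_real t0) \<epsilon> - {of_real t0}. B t \<noteq> 0 \<or> C t \<noteq> 0"
begin

text \<open>
  The universal covering of the punctured disc: \<open>1 - t / t0 = exp \<zeta>\<close>, where \<open>\<zeta>\<close> ranges over a half-plane. The lift of the
  expansion to the half-plane is single-valued.
\<close>

definition cover :: "complex \<Rightarrow> complex" where
  "cover \<zeta> = of_real t0 * (1 - exp \<zeta>)"

definition lift :: "complex \<Rightarrow> complex" where
  "lift \<zeta> = A (cover \<zeta>) + B (cover \<zeta>) * exp (- \<zeta> / 2) + C (cover \<zeta>) * \<zeta>"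

definition half_plane :: "complex set" where
  "half_plane = {\<zeta>. Re \<zeta> < ln (\<epsilon> / t0)}"

lemma open_half_plane: "open half_plane"
  unfolding half_plane_def by (simp add: open_halfspace_Re_lt)

lemma connected_half_plane: "connected half_plane"
  unfolding half_plane_def by (simp add: convex_connected convex_halfspace_Re_lt)

lemma cover_in_ball: "\<zeta> \<in> half_plane \<longleftrightarrow> cover \<zeta> \<in> ball (of_real t0) \<epsilon>"
proof -
  have "dist (of_real t0) (cover \<zeta>) = t0 * exp (Re \<zeta>)"
    using t0_pos by (simp add: cover_def dist_norm algebra_simps norm_mult)
  moreover have "Re \<zeta> < ln (\<epsilon> / t0) \<longleftrightarrow> exp (Re \<zeta>) < \<epsilon> / t0"
    using t0_pos eps_pos by (metis divide_pos_pos exp_less_cancel_iff exp_ln)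
  ultimately show ?thesis
    using t0_pos by (simp add: half_plane_def field_simps)
qed

lemma cover_eqI: fixes t :: complex shows "exp \<zeta> = 1 - t / t0 \<Longrightarrow> cover \<zeta> = t"
  using t0_pos by (simp add: cover_def)

lemma lift_holomorphic: "lift holomorphic_on half_plane"
proof -
  have c: "cover holomorphic_on half_plane"
    unfolding cover_def by (intro holomorphic_intros)
  have "(\<lambda>\<zeta>. H (cover \<zeta>)) holomorphic_on half_plane"
    if "H holomorphic_on ball (of_real t0) \<epsilon>" for H
    by (rule holomorphic_on_compose_gen[OF c that, unfolded o_def])
       (use cover_in_ball in blast)
  note H = this[OF hol(1)] this[OF hol(2)] this[OF hol(3)]
  have "(\<lambda>\<zeta>. exp (- \<zeta> / 2)) holomorphic_on half_plane"
    by (intro holomorphic_intros) auto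
  with H show ?thesis
    unfolding lift_def by (intro holomorphic_on_add holomorphic_on_mult holomorphic_on_ident)
qed

lemma G_eq_lift:
  assumes "t \<in> ball 0 t0" "t \<in> ball (of_real t0) \<epsilon>"
  shows "G t = lift (Ln (1 - t / t0))"
proof -
  have "1 - t / t0 \<noteq> 0"
    using assms(1) t0_pos by (auto simp: field_simps)
  hence "exp (- Ln (1 - t / t0) / 2) = 1 / csqrt (1 - t / t0)" "cover (Ln (1 - t / t0)) = t"
    using cover_eqI by (simp_all add: csqrt_exp_Ln exp_minus inverse_eq_divide)
  thus ?thesis
    unfolding lift_def G_eq[OF assms] by simp
qed

text \<open>
  Periodicity on an open set extends to the half-plane. Under \<open>\<zeta> \<mapsto> \<zeta> + 2 \<pi> i\<close> the square root changes its sign and the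
  logarithm grows by \<open>2 \<pi> i\<close>, so periodicity means \<open>\<pi> i C = B exp (- \<zeta> / 2)\<close>. A second shift changes the sign of the right-hand
  side only, hence both sides vanish.
\<close>

lemma lift_not_periodic:
  assumes V: "open V" "V \<noteq> {}" "V \<subseteq> half_plane"
    and per: "\<And>\<zeta>. \<zeta> \<in> V \<Longrightarrow> lift (\<zeta> + 2 * of_real pi * \<i>) = lift \<zeta>"
  shows False
proof -
  have shift: "\<zeta> + 2 * of_real pi * \<i> \<in> half_plane \<longleftrightarrow> \<zeta> \<in> half_plane" for \<zeta>
    by (simp add: half_plane_def)
  have c: "cover (\<zeta> + 2 * of_real pi * \<i>) = cover \<zeta>" for \<zeta>
    by (simp add: cover_def exp_add)
  have e: "exp (- (\<zeta> + 2 * of_real pi * \<i>) / 2) = - exp (- \<zeta> / 2)" for \<zeta>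
  proof -
    have "- (\<zeta> + 2 * of_real pi * \<i>) / 2 = - \<zeta> / 2 - pi * \<i>" for \<zeta> :: complex by (simp add: field_simps)
    note eq = this
    show ?thesis unfolding eq by (simp add: exp_diff)
  qed
  have "(\<lambda>\<zeta>. lift (\<zeta> + 2 * of_real pi * \<i>)) holomorphic_on half_plane"
    by (rule holomorphic_on_compose_gen[OF _ lift_holomorphic, unfolded o_def])
       (auto intro!: holomorphic_intros simp: shift)
  hence per': "lift (\<zeta> + 2 * of_real pi * \<i>) = lift \<zeta>" if "\<zeta> \<in> half_plane" for \<zeta>
    by (rule analytic_continuation_open[OF V(1) open_half_plane V(2) connected_half_plane V(3) _
          lift_holomorphic _ that]) (simp add: per)
  have *: "\<i> * pi * C (cover \<zeta>) = B (cover \<zeta>) * exp (- \<zeta> / 2)" if "\<zeta> \<in> half_plane" for \<zeta>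
    using per'[OF that] unfolding lift_def c e by (simp add: algebra_simps)
  have "C (cover \<zeta>) = 0 \<and> B (cover \<zeta>) = 0" if "\<zeta> \<in> half_plane" for \<zeta>
    using *[OF that] *[of "\<zeta> + 2 * of_real pi * \<i>"] that unfolding c e by (simp add: shift)
  moreover obtain t where t: "t \<in> ball (of_real t0) \<epsilon> - {of_real t0}" "B t \<noteq> 0 \<or> C t \<noteq> 0"
    using nontrivial by blast
  moreover have "cover (Ln (1 - t / t0)) = t"
    using t t0_pos by (intro cover_eqI) auto
  ultimately show False
    using cover_in_ball by (metis DiffD1)
qed

text \<open>
  A holomorphic extension lifts to a function that is periodic and agrees with the lift of the expansion on an open
  set.
\<close>

lemma no_holomorphic_extension:
  assumes "\<delta> > 0" "E holomorphic_on ball (of_real t0) \<delta>"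
    and eq: "\<And>t. t \<in> ball 0 t0 \<Longrightarrow> t \<in> ball (of_real t0) \<delta> \<Longrightarrow> E t = G t"
  shows False
proof -
  define d where "d = min \<delta> \<epsilon>"
  have d: "d > 0" "d \<le> \<delta>" "d \<le> \<epsilon>" using assms eps_pos by (auto simp: d_def)
  define W where "W = {\<zeta>. Re \<zeta> < ln (d / t0)}"
  have W: "open W" "connected W"
    unfolding W_def by (simp_all add: open_halfspace_Re_lt convex_connected convex_halfspace_Re_lt)
  have Wh: "W \<subseteq> half_plane"
  proof -
    have "ln (d / t0) \<le> ln (\<epsilon> / t0)"
      using d t0_pos by (simp add: divide_right_mono)
    thus ?thesis unfolding W_def half_plane_def by auto
  qed
  have Wc: "cover \<zeta> \<in> ball (of_real t0) d" if "\<zeta> \<in> W" for \<zeta>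
  proof -
    have "dist (of_real t0) (cover \<zeta>) = t0 * exp (Re \<zeta>)"
      using t0_pos by (simp add: cover_def dist_norm algebra_simps norm_mult)
    moreover have "exp (Re \<zeta>) < d / t0"
      using t0_pos d that unfolding W_def by (metis divide_pos_pos exp_less_cancel_iff exp_ln mem_Collect_eq)
    ultimately show ?thesis
      using t0_pos by (simp add: field_simps)
  qed
  have holE: "(\<lambda>\<zeta>. E (cover \<zeta>)) holomorphic_on W"
  proof (rule holomorphic_on_compose_gen[OF _ assms(2), unfolded o_def])
    show "cover holomorphic_on W" unfolding cover_def by (intro holomorphic_intros)
    show "cover ` W \<subseteq> ball (of_real t0) \<delta>" using Wc d by fastforce
  qed
  define V where "V = W \<inter> {\<zeta>. Im \<zeta> > - pi} \<inter> {\<zeta>. Im \<zeta> < pi} \<inter> {\<zeta>. norm (1 - exp \<zeta>) < 1}"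
  have "open V"
    unfolding V_def using W(1)
    by (intro open_Int open_halfspace_Im_lt open_halfspace_Im_gt open_Collect_less continuous_intros)
  moreover have "V \<subseteq> W" by (auto simp: V_def)
  moreover have "of_real (ln (min (d / t0 / 2) (1 / 2))) \<in> V"
  proof -
    define u where "u = min (d / t0 / 2) (1 / 2)"
    have u: "u > 0" "u < 1" "u < d / t0" using d t0_pos by (auto simp: u_def min_def field_simps)
    have "exp (of_real (ln u)) = (of_real u :: complex)"
      using u by (metis exp_ln exp_of_real)
    moreover have "norm (1 - of_real u :: complex) < 1"
      using u by (metis of_real_1 of_real_diff norm_of_real abs_of_pos diff_gt_0_iff_gt diff_less_eq less_add_same_cancel1)
    ultimately show ?thesis
      unfolding u_def[symmetric] using u by (auto simp: V_def W_def)
  qed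
  moreover have "lift \<zeta> = E (cover \<zeta>)" if "\<zeta> \<in> V" for \<zeta>
  proof -
    have W': "\<zeta> \<in> W" using that by (auto simp: V_def)
    have 1: "1 - cover \<zeta> / t0 = exp \<zeta>"
      using t0_pos by (simp add: cover_def)
    have 2: "cover \<zeta> \<in> ball 0 t0"
      using that t0_pos by (simp add: V_def cover_def norm_mult)
    have "G (cover \<zeta>) = lift (Ln (exp \<zeta>))"
      using G_eq_lift[OF 2] Wc[OF W'] d unfolding 1 by auto
    also have "Ln (exp \<zeta>) = \<zeta>"
      using that by (intro Ln_exp) (auto simp: V_def)
    finally show ?thesis
      using eq[OF 2] Wc[OF W'] d by auto
  qed
  ultimately have *: "lift \<zeta> = E (cover \<zeta>)" if "\<zeta> \<in> W" for \<zeta>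
    by (intro analytic_continuation_open[OF _ W(1) _ W(2) _ _ holE _ that, of V lift])
       (auto intro: holomorphic_on_subset[OF lift_holomorphic Wh])
  have "W \<noteq> {}"
    using lt_ex[of "ln (d / t0)"] unfolding W_def by (metis Collect_empty_eq Re_complex_of_real)
  thus False
  proof (rule lift_not_periodic[OF W(1) _ Wh])
    fix \<zeta> assume "\<zeta> \<in> W"
    moreover from this have "\<zeta> + 2 * of_real pi * \<i> \<in> W" by (simp add: W_def)
    moreover have "cover (\<zeta> + 2 * of_real pi * \<i>) = cover \<zeta>"
      by (simp add: cover_def exp_add)
    ultimately show "lift (\<zeta> + 2 * of_real pi * \<i>) = lift \<zeta>" by (simp add: *)
  qed
qed

end

text \<open>
  Two branches of the logarithm near \<open>w\<close>, normalised at \<open>c\<close> and \<open>c'\<close>. They differ by a multiple of \<open>2 \<pi> i\<close>, and are equal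
  as soon as they are closer than that.
\<close>

lemma log_branches_agree_near:
  assumes "exp a = c" "exp a' = c'" "w / c \<notin> \<real>\<^sub>\<le>\<^sub>0" "w / c' \<notin> \<real>\<^sub>\<le>\<^sub>0"
    and close: "norm (a + Ln (w / c) - (a' + Ln (w / c'))) < 1"
  shows "\<forall>\<^sub>F v in nhds w. a + Ln (v / c) = a' + Ln (v / c')"
proof -
  have c: "c \<noteq> 0" "c' \<noteq> 0" using assms by auto
  let ?d = "\<lambda>v. a + Ln (v / c) - (a' + Ln (v / c'))"
  have "isCont ?d w"
    using assms c by (intro continuous_intros) auto
  hence "(?d \<longlongrightarrow> ?d w) (nhds w)"
    using isCont_def tendsto_at_iff_tendsto_nhds by blast
  hence "\<forall>\<^sub>F v in nhds w. norm (?d v) < 1"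
    using close by (intro order_tendstoD(2)[OF tendsto_norm])
  moreover have "\<forall>\<^sub>F v in nhds w. v \<noteq> 0"
    using assms by (intro t1_space_nhds) auto
  ultimately show ?thesis
  proof eventually_elim
    case (elim v)
    have "exp (a + Ln (v / c)) = exp (a' + Ln (v / c'))"
      using elim c assms by (simp add: exp_add)
    moreover have "\<bar>Im (a + Ln (v / c)) - Im (a' + Ln (v / c'))\<bar> < 2 * pi"
      using elim abs_Im_le_cmod[of "?d v"] pi_gt3 by simp
    ultimately show ?case by (rule exp_complex_eqI[rotated])
  qed
qed


context log_sqrt_singularity
begin

text \<open>
  A continuous logarithm \<open>l\<close> of \<open>1 - \<gamma> / t0\<close> selects the branch of the logarithm at each point of the path, and the
  continuation is the lift of the expansion composed with that branch.
\<close>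

lemma continuation_along_lift:
  fixes l \<gamma> :: "real \<Rightarrow> complex"
  assumes \<gamma>: "path \<gamma>" "path_image \<gamma> \<subseteq> ball (of_real t0) \<epsilon>" "pathstart \<gamma> \<in> ball 0 t0"
    and l: "continuous_on {0..1} l" "\<And>s. s \<in> {0..1} \<Longrightarrow> 1 - \<gamma> s / t0 = exp (l s)"
      "l 0 = Ln (1 - \<gamma> 0 / t0)"
  defines "F \<equiv> \<lambda>s t::complex. lift (l s + Ln ((1 - t / t0) / exp (l s)))"
  shows "analytic_continuation G \<gamma> F"
  unfolding analytic_continuation_def
proof (intro conjI ballI)
  have \<gamma>U: "\<gamma> s \<in> ball (of_real t0) \<epsilon>" if "s \<in> {0..1}" for s
    using \<gamma>(2) that unfolding path_image_def by blast
  show "path \<gamma>" by fact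
  have affine: "filterlim (\<lambda>t::complex. 1 - t / t0) (nhds (exp (l s))) (nhds (\<gamma> s))" if "s \<in> {0..1}" for s
    unfolding l(2)[OF that, symmetric]
    by (intro tendsto_intros filterlim_ident) (use t0_pos in auto)
  show "same_germ (\<gamma> 0) (F 0) G"
  proof -
    have 0: "\<gamma> 0 \<in> ball 0 t0" using \<gamma>(3) by (simp add: pathstart_def)
    have e: "exp (l 0) = 1 - \<gamma> 0 / t0" using l(2)[of 0] by simp
    have "exp (l 0) \<notin> \<real>\<^sub>\<le>\<^sub>0"
    proof
      assume "exp (l 0) \<in> \<real>\<^sub>\<le>\<^sub>0"
      hence "Re (\<gamma> 0 / t0) \<ge> 1" unfolding e by (auto simp: complex_nonpos_Reals_iff)
      hence "norm (\<gamma> 0 / t0) \<ge> 1" using complex_Re_le_cmod order_trans by blast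
      thus False using 0 t0_pos by (simp add: norm_divide field_simps)
    qed
    moreover have "l 0 = Ln (exp (l 0))"
      using l(3) unfolding e .
    ultimately have ev: "\<forall>\<^sub>F v in nhds (exp (l 0)). l 0 + Ln (v / exp (l 0)) = 0 + Ln (v / 1)"
      by (intro log_branches_agree_near) auto
    hence "\<forall>\<^sub>F t in nhds (\<gamma> 0). l 0 + Ln ((1 - t / t0) / exp (l 0)) = 0 + Ln ((1 - t / t0) / 1)"
      using eventually_compose_filterlim[OF ev affine[of 0]] by simp
    moreover have "\<forall>\<^sub>F t in nhds (\<gamma> 0). t \<in> ball 0 t0"
      using 0 by (intro eventually_nhds_in_open) auto
    moreover have "\<forall>\<^sub>F t in nhds (\<gamma> 0). t \<in> ball (of_real t0) \<epsilon>"
      using \<gamma>U[of 0] by (intro eventually_nhds_in_open) auto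
    ultimately show ?thesis
      unfolding same_germ_def
      by eventually_elim (simp add: F_def G_eq_lift)
  qed
  fix s0 :: real assume s0: "s0 \<in> {0..1}"
  show "F s0 analytic_on {\<gamma> s0}"
  proof -
    define h where "h t = (1 - t / t0) / exp (l s0)" for t :: complex
    have h1: "h (\<gamma> s0) = 1"
      unfolding h_def l(2)[OF s0] by simp
    have "h analytic_on {\<gamma> s0}"
      unfolding h_def by (intro analytic_intros) (use t0_pos in auto)
    hence "(\<lambda>t. l s0 + Ln (h t)) analytic_on {\<gamma> s0}"
      by (rule analytic_on_add[OF analytic_on_const analytic_on_ln]) (simp_all add: h1)
    moreover have "l s0 \<in> half_plane"
      using cover_eqI[OF l(2)[OF s0, symmetric]] \<gamma>U[OF s0] by (simp add: cover_in_ball)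
    hence "lift analytic_on {l s0}"
      using lift_holomorphic open_half_plane analytic_at by blast
    hence "lift analytic_on (\<lambda>t. l s0 + Ln (h t)) ` {\<gamma> s0}"
      by (simp add: h1)
    ultimately show ?thesis
      unfolding F_def h_def[symmetric]
      by (rule analytic_on_compose[unfolded o_def])
  qed
  show "\<forall>\<^sub>F s in at s0 within {0..1}. same_germ (\<gamma> s) (F s) (F s0)"
  proof -
    have liml: "(l \<longlongrightarrow> l s0) (at s0 within {0..1})"
      using l(1) s0 by (simp add: continuous_on)
    have quot: "((\<lambda>s. exp (l s) / exp (l s0)) \<longlongrightarrow> exp (l s0) / exp (l s0)) (at s0 within {0..1})"
      by (intro tendsto_intros liml) auto
    have "((\<lambda>s. l s - (l s0 + Ln (exp (l s) / exp (l s0)))) \<longlongrightarrow>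
        l s0 - (l s0 + Ln (exp (l s0) / exp (l s0)))) (at s0 within {0..1})"
      by (intro tendsto_intros liml quot) auto
    hence "\<forall>\<^sub>F s in at s0 within {0..1}. norm (l s - (l s0 + Ln (exp (l s) / exp (l s0)))) < 1"
      by (intro order_tendstoD(2)[OF tendsto_norm]) auto
    moreover have "\<forall>\<^sub>F s in at s0 within {0..1}. exp (l s) / exp (l s0) \<in> - \<real>\<^sub>\<le>\<^sub>0"
      by (rule topological_tendstoD[OF quot]) (auto simp: open_Compl)
    moreover have "\<forall>\<^sub>F s in at s0 within {0..1}. s \<in> {0..1}"
      by (simp add: eventually_at_filter)
    ultimately show ?thesis
    proof eventually_elim
      case (elim s)
      have ev: "\<forall>\<^sub>F v in nhds (exp (l s)). l s + Ln (v / exp (l s)) = l s0 + Ln (v / exp (l s0))"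
        using elim by (intro log_branches_agree_near) auto
      have "\<forall>\<^sub>F t in nhds (\<gamma> s). l s + Ln ((1 - t / t0) / exp (l s)) = l s0 + Ln ((1 - t / t0) / exp (l s0))"
        by (fact eventually_compose_filterlim[OF ev affine[OF elim(3)]])
      thus ?case
        unfolding same_germ_def by eventually_elim (simp add: F_def)
    qed
  qed
qed

theorem extends: "extends_multivalued G (ball 0 t0) (ball (of_real t0) \<epsilon> - {of_real t0})"
  unfolding extends_multivalued_def
proof (intro allI impI, elim conjE)
  fix \<gamma> :: "real \<Rightarrow> complex"
  assume \<gamma>: "path \<gamma>" "path_image \<gamma> \<subseteq> ball (of_real t0) \<epsilon> - {of_real t0}" "pathstart \<gamma> \<in> ball 0 t0"
  have "continuous_on {0..1} (\<lambda>s. 1 - \<gamma> s / t0)"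
    using \<gamma>(1) t0_pos by (intro continuous_intros) (auto simp: path_def)
  moreover have "1 - \<gamma> s / t0 \<noteq> 0" if "s \<in> {0..1}" for s
  proof
    assume *: "1 - \<gamma> s / t0 = 0"
    have "\<gamma> s = of_real t0 * (1 - (1 - \<gamma> s / t0))" using t0_pos by simp
    hence "\<gamma> s = of_real t0" unfolding * by simp
    moreover have "\<gamma> s \<in> path_image \<gamma>" using that by (simp add: path_image_def)
    ultimately show False using \<gamma>(2) by blast
  qed
  moreover have "contractible {0..1::real}"
    by (simp add: convex_imp_contractible)
  ultimately obtain l where l: "continuous_on {0..1} l" "\<And>s. s \<in> {0..1} \<Longrightarrow> 1 - \<gamma> s / t0 = exp (l s)"
    using continuous_logarithm_on_contractible[of "{0..1::real}" "\<lambda>s. 1 - \<gamma> s / t0"] by metis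
  \<comment> \<open>The logarithm is normalised to the principal value at the starting point.\<close>
  define l' where "l' s = l s - l 0 + Ln (exp (l 0))" for s
  have "1 - \<gamma> s / t0 = exp (l' s)" if "s \<in> {0..1}" for s
    using l(2)[OF that] by (simp add: l'_def exp_add exp_diff)
  moreover have "continuous_on {0..1} l'"
    unfolding l'_def by (intro continuous_intros l)
  moreover have "l' 0 = Ln (1 - \<gamma> 0 / t0)"
    using l(2)[of 0] by (simp add: l'_def)
  ultimately show "\<exists>F. analytic_continuation G \<gamma> F"
    using continuation_along_lift[of \<gamma> l'] \<gamma> by blast
qed

text \<open>
  The loop is a circle around \<open>t0\<close>, along which the logarithm increases by \<open>2 \<pi> i\<close>. If the final germ were the initial one,
  the lift would be periodic near \<open>l 0\<close>.
\<close>

theorem monodromy: "nontrivial_monodromy G (ball 0 t0) (ball (of_real t0) \<epsilon> - {of_real t0})"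
proof -
  define \<eta> where "\<eta> = min (\<epsilon> / t0 / 2) (1 / 2)"
  have \<eta>: "\<eta> > 0" "\<eta> < 1" "t0 * \<eta> < \<epsilon>"
    using eps_pos t0_pos by (auto simp: \<eta>_def min_def field_simps)
  define l :: "real \<Rightarrow> complex" where "l s = of_real (ln \<eta>) + 2 * of_real pi * of_real s * \<i>" for s
  define \<gamma> where "\<gamma> s = cover (l s)" for s
  have exp_l: "exp (l s) = 1 - \<gamma> s / t0" for s
    using t0_pos by (simp add: \<gamma>_def cover_def)
  have norm_l: "norm (exp (l s)) = \<eta>" for s
    using \<eta> by (simp add: l_def)
  have cl: "continuous_on S l" for S
    unfolding l_def by (intro continuous_intros)
  have path: "path \<gamma>"
    unfolding path_def \<gamma>_def cover_def by (intro continuous_intros cl)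
  have l1: "l 1 = l 0 + 2 * of_real pi * \<i>" by (simp add: l_def)
  have loop: "pathfinish \<gamma> = pathstart \<gamma>"
    by (simp add: pathfinish_def pathstart_def \<gamma>_def l1 cover_def exp_add)
  have exp_l0: "exp (l 0) = of_real \<eta>"
    using \<eta> by (simp add: l_def exp_of_real)
  have start: "pathstart \<gamma> \<in> ball 0 t0"
  proof -
    have "norm (1 - of_real \<eta> :: complex) < 1"
      using \<eta> by (metis of_real_1 of_real_diff norm_of_real abs_of_pos diff_gt_0_iff_gt diff_less_eq less_add_same_cancel1)
    thus ?thesis
      using t0_pos by (simp add: pathstart_def \<gamma>_def cover_def exp_l0 norm_mult)
  qed
  have image: "path_image \<gamma> \<subseteq> ball (of_real t0) \<epsilon> - {of_real t0}"
  proof -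
    have "dist (of_real t0) (\<gamma> s) = t0 * \<eta>" for s
      using t0_pos norm_l[of s] by (simp add: \<gamma>_def cover_def dist_norm algebra_simps norm_mult)
    hence "\<gamma> s \<in> ball (of_real t0) \<epsilon> - {of_real t0}" for s
      using \<eta> t0_pos by (metis DiffI dist_self mem_ball mult_eq_0_iff order_less_irrefl singletonD)
    thus ?thesis by (auto simp: path_image_def)
  qed
  let ?F = "\<lambda>s t::complex. lift (l s + Ln ((1 - t / t0) / exp (l s)))"
  have "l 0 = Ln (1 - \<gamma> 0 / t0)"
    using \<eta> unfolding exp_l[symmetric] exp_l0 by (simp add: l_def Ln_of_real)
  hence cont: "analytic_continuation G \<gamma> ?F"
    using exp_l by (intro continuation_along_lift[OF path _ start cl]) (use image in auto)
  have "\<not> same_germ (\<gamma> 1) (?F 1) (?F 0)"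
  proof
    assume "same_germ (\<gamma> 1) (?F 1) (?F 0)"
    moreover have "\<gamma> 1 = \<gamma> 0" using loop by (simp add: pathfinish_def pathstart_def)
    ultimately have *: "\<forall>\<^sub>F t in nhds (\<gamma> 0). ?F 1 t = ?F 0 t"
      by (simp add: same_germ_def)
    have "filterlim cover (nhds (\<gamma> 0)) (nhds (l 0))"
      unfolding \<gamma>_def cover_def by (intro tendsto_intros filterlim_ident)
    hence "\<forall>\<^sub>F \<zeta> in nhds (l 0). ?F 1 (cover \<zeta>) = ?F 0 (cover \<zeta>)"
      using * filterlim_iff by fast
    moreover have "\<forall>\<^sub>F \<zeta> in nhds (l 0). \<zeta> \<in> half_plane \<inter> ball (l 0) pi"
    proof (rule eventually_nhds_in_open)
      show "l 0 \<in> half_plane \<inter> ball (l 0) pi"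
        using image by (auto simp: cover_in_ball path_image_def \<gamma>_def image_subset_iff)
    qed (use open_half_plane in auto)
    ultimately have "\<forall>\<^sub>F \<zeta> in nhds (l 0). \<zeta> \<in> half_plane \<and> lift (\<zeta> + 2 * of_real pi * \<i>) = lift \<zeta>"
    proof eventually_elim
      case (elim \<zeta>)
      have eq: "(1 - cover \<zeta> / t0) / exp (l 0) = exp (\<zeta> - l 0)"
        "(1 - cover \<zeta> / t0) / exp (l 1) = exp (\<zeta> - l 0)"
        using t0_pos by (simp_all add: cover_def exp_diff l1 exp_add)
      moreover have "\<bar>Im (\<zeta> - l 0)\<bar> < pi"
        using elim abs_Im_le_cmod[of "\<zeta> - l 0"] by (auto simp: dist_norm norm_minus_commute)
      hence Ln: "Ln (exp (\<zeta> - l 0)) = \<zeta> - l 0" by (intro Ln_exp) auto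
      moreover have l': "l 1 + (\<zeta> - l 0) = \<zeta> + 2 * of_real pi * \<i>" "l 0 + (\<zeta> - l 0) = \<zeta>"
        by (simp_all add: l1)
      show ?case
        using elim unfolding eq Ln l' by blast
    qed
    then obtain V where "open V" "l 0 \<in> V" "\<forall>\<zeta>\<in>V. \<zeta> \<in> half_plane \<and> lift (\<zeta> + 2 * of_real pi * \<i>) = lift \<zeta>"
      by (auto simp: eventually_nhds)
    thus False using lift_not_periodic[of V] by blast
  qed
  thus ?thesis
    unfolding nontrivial_monodromy_def using path image start loop cont by blast
qed

end

section \<open>Supermultiplicative sequences\<close>

locale supermultiplicative =
  fixes a :: "nat \<Rightarrow> real"
  assumes a_0: "a 0 = 1" and a_nonneg: "\<And>n. a n \<ge> 0" and a_mult: "\<And>m n. a m * a n \<le> a (m + n)"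
begin

lemma pos_add: "a m > 0 \<Longrightarrow> a n > 0 \<Longrightarrow> a (m + n) > 0"
  using a_mult[of m n] by (meson less_le_trans mult_pos_pos)

lemma pos_mult: "a m > 0 \<Longrightarrow> a (j * m) > 0"
  by (induction j) (auto simp: a_0 pos_add)

lemma power_le: "a m ^ j \<le> a (j * m) \<or> j = 0"
proof (induction j)
  case (Suc j)
  show ?case
  proof (cases "j = 0")
    case False
    hence "a m * a m ^ j \<le> a m * a (j * m)" using Suc a_nonneg by (intro mult_left_mono) auto
    thus ?thesis using a_mult[of m "j * m"] by simp
  qed simp
qed simp

definition is_period :: "nat \<Rightarrow> bool" where
  "is_period r \<longleftrightarrow> r \<ge> 1 \<and> (\<forall>n. \<not> r dvd n \<longrightarrow> a n = 0) \<and> finite {n. \<not> a (r * n) > 0}"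

text \<open>
  The period is the least positive difference \<open>d\<close> of two indices \<open>x\<close>, \<open>x + d\<close> with positive terms. It divides every index \<open>n\<close>
  of a positive term: if \<open>n = q d + s\<close> with \<open>0 < s < d\<close>, then \<open>n + q x\<close> and \<open>q (x + d)\<close> are such indices with difference \<open>s\<close>. In
  particular \<open>x = d y\<close>, and all multiples \<open>d n\<close> with \<open>n \<ge> y\<^sup>2\<close> are combinations of \<open>x\<close> and \<open>x + d\<close>.
\<close>

lemma period_exists:
  assumes "n \<ge> 1" "a n > 0"
  shows "\<exists>r. is_period r"
proof -
  define d where "d = (LEAST d. d > 0 \<and> (\<exists>x. a x > 0 \<and> a (x + d) > 0))"
  have ex: "\<exists>d. d > 0 \<and> (\<exists>x. a x > 0 \<and> a (x + d) > 0)"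
    using assms pos_add by (intro exI[of _ n]) auto
  have "d > 0 \<and> (\<exists>x. a x > 0 \<and> a (x + d) > 0)"
    unfolding d_def by (rule LeastI_ex[OF ex])
  then obtain x where d: "d > 0" and x: "a x > 0" "a (x + d) > 0" by blast
  have least: "d \<le> d'" if "d' > 0" "a y > 0" "a (y + d') > 0" for d' y
    unfolding d_def using that by (intro Least_le) blast
  have dvd: "d dvd n" if "a n > 0" for n
  proof (rule ccontr)
    assume "\<not> d dvd n"
    define q where "q = n div d"
    define s where "s = n mod d"
    have s: "s > 0" "s < d" "n = q * d + s"
      using \<open>\<not> d dvd n\<close> d by (auto simp: s_def q_def dvd_eq_mod_eq_0)
    have "a (q * (x + d)) > 0" by (rule pos_mult[OF x(2)])
    moreover have "a (n + q * x) > 0" by (intro pos_add pos_mult that x)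
    moreover have "n + q * x = q * (x + d) + s" using s(3) by (simp add: algebra_simps)
    ultimately have "d \<le> s" using s(1) least[of s "q * (x + d)"] by simp
    thus False using s by simp
  qed
  obtain y where y: "x = d * y" using dvd[OF x(1)] by blast
  have large: "a (d * n) > 0" if "n \<ge> y * y" for n
  proof (cases "y = 0")
    case True
    thus ?thesis using x(2) pos_mult[of d n] y by (simp add: mult.commute)
  next
    case False
    define b where "b = n div y"
    define s where "s = n mod y"
    have "b \<ge> y" using that False unfolding b_def by (metis div_le_mono nonzero_mult_div_cancel_right)
    moreover have "s < y" using False by (simp add: s_def)
    moreover have "n = b * y + s" by (simp add: b_def s_def)
    ultimately have "n = (b - s) * y + s * (y + 1)"
      by (simp add: algebra_simps)
    hence "d * n = (b - s) * x + s * (x + d)" by (simp add: y algebra_simps)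
    thus ?thesis using x by (simp add: pos_add pos_mult)
  qed
  have "is_period d"
    unfolding is_period_def
  proof (intro conjI allI impI)
    show "a n = 0" if "\<not> d dvd n" for n
      using dvd[of n] that a_nonneg[of n] by force
    show "finite {n. \<not> 0 < a (d * n)}"
      by (rule finite_subset[of _ "{..<y * y}"]) (use large not_less in auto)
  qed (use d in simp)
  thus ?thesis ..
qed

lemma period_unique:
  assumes "is_period r" "is_period r'"
  shows "r = r'"
proof -
  have *: "r' dvd r" if "is_period r" "is_period r'" for r r'
  proof -
    have "\<forall>\<^sub>F n in sequentially. a (r * n) > 0"
      using that(1) by (auto simp: is_period_def cofinite_eq_sequentially[symmetric] eventually_cofinite)
    then obtain N where N: "\<And>n. n \<ge> N \<Longrightarrow> a (r * n) > 0" by (auto simp: eventually_sequentially)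
    have "r' dvd r * N" "r' dvd r * (N + 1)"
      using N[of N] N[of "N + 1"] that(2) by (auto simp: is_period_def)
    hence "r' dvd r * (N + 1) - r * N" by (intro dvd_diff_nat)
    thus ?thesis by (simp add: algebra_simps)
  qed
  show ?thesis using *[OF assms] *[OF assms(2,1)] by (simp add: dvd_antisym)
qed

text \<open>
  Fekete's argument. For \<open>S < T\<close> some term satisfies \<open>a N > S\<^sup>N\<close>, for otherwise the radius of convergence would be at
  least \<open>1 / S\<close>. Dividing by \<open>N\<close> with a remainder in a window of positive terms gives \<open>a (r n) \<ge> c S\<^sup>r\<^sup>n\<close>.
\<close>

lemma root_limit:
  assumes r: "is_period r" and T: "T > 0" and le: "\<And>n. a n \<le> T ^ n" and radius: "conv_radius a = ereal (inverse T)"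
  shows "(\<lambda>n. a (r * n) powr (1 / real (r * n))) \<longlonglongrightarrow> T"
proof (rule order_tendstoI)
  have r1: "r \<ge> 1" using r by (simp add: is_period_def)
  fix u assume u: "T < u"
  show "\<forall>\<^sub>F n in sequentially. a (r * n) powr (1 / real (r * n)) < u"
    using eventually_gt_at_top[of 0]
  proof eventually_elim
    case (elim n)
    have "a (r * n) powr (1 / real (r * n)) \<le> (T ^ (r * n)) powr (1 / real (r * n))"
      by (intro powr_mono2 le a_nonneg) auto
    also have "\<dots> = T" using T elim r1 by (simp add: powr_realpow[symmetric] powr_powr)
    finally show ?case using u by simp
  qed
next
  have r1: "r \<ge> 1" using r by (simp add: is_period_def)
  have "\<forall>\<^sub>F n in sequentially. a (r * n) > 0"
    using r by (auto simp: is_period_def cofinite_eq_sequentially[symmetric] eventually_cofinite)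
  then obtain n0 where n0: "\<And>n. n \<ge> n0 \<Longrightarrow> a (r * n) > 0" by (auto simp: eventually_sequentially)
  fix l assume "l < T"
  \<comment> \<open>A positive number between \<open>l\<close> and \<open>T\<close>.\<close>
  define S where "S = (max l 0 + T) / 2"
  have S: "S > 0" "l < S" "S < T" using T \<open>l < T\<close> by (auto simp: S_def)
  have "\<exists>N\<ge>1. a N > S ^ N"
  proof (rule ccontr)
    assume "\<not> ?thesis"
    hence small: "a N \<le> S ^ N" if "N \<ge> 1" for N using that by force
    \<comment> \<open>At \<open>w\<close> the series would converge beyond its radius.\<close>
    obtain w where w: "inverse T < w" "w < inverse S"
      using S T dense[of "inverse T" "inverse S"] by auto
    have w0: "w > 0" "w * S < 1" using w T S by (auto simp: field_simps intro: less_trans[of 0 "inverse T"])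
    have "summable (\<lambda>n. a n * w ^ n)"
    proof (rule summable_comparison_test_ev)
      show "\<forall>\<^sub>F n in sequentially. norm (a n * w ^ n) \<le> (w * S) ^ n"
        using eventually_ge_at_top[of 1]
      proof eventually_elim
        case (elim n)
        have "a n * w ^ n \<le> S ^ n * w ^ n" using small[OF elim] w0 by (intro mult_right_mono) auto
        thus ?case using a_nonneg[of n] w0 by (simp add: power_mult_distrib mult.commute abs_mult)
      qed
      show "summable (\<lambda>n. (w * S) ^ n)" using w0 S by (intro summable_geometric) auto
    qed
    from conv_radius_geI[OF this] have "ereal w \<le> ereal (inverse T)" using w0 radius by simp
    thus False using w by simp
  qed
  then obtain N where N: "N \<ge> 1" "a N > S ^ N" by blast
  have "a N > 0" using N S by (meson less_trans zero_less_power)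
  hence "r dvd N" using r by (auto simp: is_period_def)
  then obtain N' where N': "N = r * N'" by blast
  have N'1: "N' \<ge> 1" using N N' by (cases N') auto
  define c where "c = Min ((\<lambda>s. a (r * s) / S ^ (r * s)) ` {n0..<n0 + N'})"
  have c: "c > 0" unfolding c_def using N'1 n0 S by (subst Min_gr_iff) auto
  have lower: "a (r * n) \<ge> S ^ (r * n) * c" if n: "n \<ge> n0" for n
  proof -
    define q where "q = (n - n0) div N'"
    define s where "s = n0 + (n - n0) mod N'"
    have s: "s \<in> {n0..<n0 + N'}" and ns: "n = q * N' + s"
      using N'1 n by (auto simp: s_def q_def)
    have rn: "r * n = q * N + r * s" unfolding ns N' by (simp add: algebra_simps)
    have "c \<le> a (r * s) / S ^ (r * s)" unfolding c_def using s by (intro Min_le) auto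
    hence "S ^ (r * s) * c \<le> a (r * s)" using S by (simp add: field_simps)
    moreover have "S ^ (q * N) \<le> a (q * N)"
    proof (cases "q = 0")
      case False
      have "S ^ (q * N) = (S ^ N) ^ q" by (metis mult.commute power_mult)
      also have "\<dots> \<le> a N ^ q" using N S by (intro power_mono) auto
      also have "\<dots> \<le> a (q * N)" using power_le[of N q] False by simp
      finally show ?thesis .
    next
      case True
      thus ?thesis using a_0 by simp
    qed
    ultimately have "S ^ (q * N) * (S ^ (r * s) * c) \<le> a (q * N) * a (r * s)"
      using S c a_nonneg by (intro mult_mono) auto
    also have "\<dots> \<le> a (r * n)" unfolding rn by (rule a_mult)
    finally show ?thesis unfolding rn by (simp add: power_add mult_ac)
  qed
  have "filterlim (\<lambda>n. r * n) at_top sequentially"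
    using r1 by (intro filterlim_at_top_mono[OF filterlim_ident]) (auto intro!: always_eventually)
  hence "(\<lambda>n. 1 / real (r * n)) \<longlonglongrightarrow> 0"
    by (intro tendsto_divide_0[OF tendsto_const] filterlim_at_top_imp_at_infinity filterlim_compose[OF filterlim_real_sequentially])
  hence "(\<lambda>n. S * c powr (1 / real (r * n))) \<longlonglongrightarrow> S * c powr 0"
    using c by (intro tendsto_intros) auto
  hence "\<forall>\<^sub>F n in sequentially. l < S * c powr (1 / real (r * n))"
    using S c by (intro order_tendstoD(1)) auto
  thus "\<forall>\<^sub>F n in sequentially. l < a (r * n) powr (1 / real (r * n))"
    using eventually_ge_at_top[of n0] eventually_gt_at_top[of 0]
  proof eventually_elim
    case (elim n)
    have "S * c powr (1 / real (r * n)) = (S ^ (r * n) * c) powr (1 / real (r * n))"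
      using S c elim r1 by (simp add: powr_mult powr_realpow[symmetric] powr_powr)
    also have "\<dots> \<le> a (r * n) powr (1 / real (r * n))"
      using lower[OF elim(2)] S c by (intro powr_mono2) auto
    finally show ?case using elim by simp
  qed
qed

end

section \<open>Laurent polynomials\<close>

text \<open>
  The value of a Laurent polynomial at a point of the complex torus, given by its character \<open>ch\<close> on the lattice of
  exponents.
\<close>

definition character_sum :: "(int ^ 'm \<Rightarrow> complex) \<Rightarrow> 'm::finite laurent_poly \<Rightarrow> complex" where
  "character_sum ch f = (\<Sum>k\<in>Poly_Mapping.keys f. of_real (Poly_Mapping.lookup f k) * ch k)"

lemma character_sum_superset:
  assumes "finite A" "Poly_Mapping.keys f \<subseteq> A"
  shows "character_sum ch f = (\<Sum>k\<in>A. of_real (Poly_Mapping.lookup f k) * ch k)"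
  unfolding character_sum_def using assms by (intro sum.mono_neutral_left) (auto simp: in_keys_iff)

lemma character_sum_add: "character_sum ch (f + g) = character_sum ch f + character_sum ch g"
proof -
  let ?A = "Poly_Mapping.keys f \<union> Poly_Mapping.keys g"
  have "Poly_Mapping.keys (f + g) \<subseteq> ?A" by (rule Poly_Mapping.keys_add)
  thus ?thesis
    using character_sum_superset[of ?A f ch] character_sum_superset[of ?A g ch] character_sum_superset[of ?A "f + g" ch]
    by (simp add: lookup_add distrib_right sum.distrib)
qed

lemma character_sum_sum: "character_sum ch (\<Sum>i\<in>I. F i) = (\<Sum>i\<in>I. character_sum ch (F i))"
proof -
  have "character_sum ch 0 = 0" by (simp add: character_sum_def)
  thus ?thesis by (induction I rule: infinite_finite_induct) (auto simp: character_sum_add)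
qed

lemma character_sum_single: "character_sum ch (Poly_Mapping.single k c) = of_real c * ch k"
  by (simp add: character_sum_def)

lemma sum_of_monomials:
  fixes f :: "'m::finite laurent_poly"
  shows "f = (\<Sum>k\<in>Poly_Mapping.keys f. Poly_Mapping.single k (Poly_Mapping.lookup f k))"
proof (rule poly_mapping_eqI)
  fix i
  show "Poly_Mapping.lookup f i = Poly_Mapping.lookup (\<Sum>k\<in>Poly_Mapping.keys f. Poly_Mapping.single k (Poly_Mapping.lookup f k)) i"
    by (simp add: lookup_sum lookup_single when_def in_keys_iff)
qed

lemma product_of_monomials:
  fixes f g :: "'m::finite laurent_poly"
  shows "f * g = (\<Sum>k\<in>Poly_Mapping.keys f. \<Sum>l\<in>Poly_Mapping.keys g.
    Poly_Mapping.single (k + l) (Poly_Mapping.lookup f k * Poly_Mapping.lookup g l))"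
  by (subst sum_of_monomials[of f], subst sum_of_monomials[of g]) (simp add: sum_product mult_single)

lemma character_sum_mult:
  assumes "\<And>k l. ch (k + l) = ch k * ch l"
  shows "character_sum ch (f * g) = character_sum ch f * character_sum ch g"
  unfolding product_of_monomials character_sum_sum character_sum_single
  by (simp add: character_sum_def assms sum_product mult_ac)

lemma character_sum_power:
  assumes "\<And>k l. ch (k + l) = ch k * ch l" "ch 0 = 1"
  shows "character_sum ch (f ^ n) = character_sum ch f ^ n"
  by (induction n) (auto simp: character_sum_mult[OF assms(1)] character_sum_single[of ch 0 1, simplified] assms(2))

lemma lookup_mult_nonneg:
  fixes f g :: "'m::finite laurent_poly"
  assumes "\<And>k. Poly_Mapping.lookup f k \<ge> 0" "\<And>k. Poly_Mapping.lookup g k \<ge> 0"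
  shows "Poly_Mapping.lookup (f * g) k \<ge> 0"
  unfolding product_of_monomials lookup_sum lookup_single
  using assms by (intro sum_nonneg) (auto simp: when_def)

lemma lookup_power_nonneg:
  fixes f :: "'m::finite laurent_poly"
  assumes "\<And>k. Poly_Mapping.lookup f k \<ge> 0"
  shows "Poly_Mapping.lookup (f ^ n) k \<ge> 0"
  using assms by (induction n arbitrary: k) (auto simp: lookup_mult_nonneg lookup_one when_def)

lemma Cst_mult_ge:
  fixes f g :: "'m::finite laurent_poly"
  assumes "\<And>k. Poly_Mapping.lookup f k \<ge> 0" "\<And>k. Poly_Mapping.lookup g k \<ge> 0"
  shows "Cst f * Cst g \<le> Cst (f * g)"
proof (cases "0 \<in> Poly_Mapping.keys f \<and> 0 \<in> Poly_Mapping.keys g")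
  case True
  let ?t = "\<lambda>k l. Poly_Mapping.lookup (Poly_Mapping.single (k + l) (Poly_Mapping.lookup f k * Poly_Mapping.lookup g l)) 0"
  have nn: "?t k l \<ge> 0" for k l using assms by (simp add: lookup_single when_def)
  have "Cst f * Cst g = ?t 0 0" by (simp add: Cst_def)
  also have "\<dots> \<le> (\<Sum>l\<in>Poly_Mapping.keys g. ?t 0 l)"
    using True by (intro member_le_sum nn) auto
  also have "\<dots> \<le> (\<Sum>k\<in>Poly_Mapping.keys f. \<Sum>l\<in>Poly_Mapping.keys g. ?t k l)"
    using True by (intro nn member_le_sum[of 0 _ "\<lambda>k. \<Sum>l\<in>Poly_Mapping.keys g. ?t k l"] sum_nonneg) auto
  also have "\<dots> = Cst (f * g)" by (simp add: Cst_def product_of_monomials lookup_sum)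
  finally show ?thesis .
next
  case False
  hence "Cst f * Cst g = 0" by (auto simp: Cst_def in_keys_iff)
  moreover have "0 \<le> Cst (f * g)" unfolding Cst_def by (rule lookup_mult_nonneg[OF assms])
  ultimately show ?thesis by linarith
qed

section \<open>Fourier coefficients on the torus\<close>

definition real_vec :: "int ^ 'm \<Rightarrow> real ^ 'm" where
  "real_vec k = (\<chi> i. real_of_int (k $ i))"

lemma real_vec_add: "real_vec (k + l) = real_vec k + real_vec l"
  by (simp add: real_vec_def vec_eq_iff)

lemma real_vec_0: "real_vec 0 = 0"
  by (simp add: real_vec_def vec_eq_iff)

lemma inj_real_vec: "inj real_vec"
  by (auto simp: inj_def real_vec_def vec_eq_iff)

definition torus_cell :: "real \<Rightarrow> (real ^ 'm::finite) set" where
  "torus_cell t = cbox (\<chi> i. t - pi) (\<chi> i. t + pi)"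

lemma integral_full_period:
  fixes n :: int
  assumes "n \<noteq> 0"
  shows "(\<integral>s. indicat_real {t-pi..t+pi} s *\<^sub>R exp (\<i> * of_real (of_int n * s)) \<partial>lborel) = 0"
proof -
  let ?F = "\<lambda>s::complex. exp (\<i> * of_int n * s) / (\<i> * of_int n)"
  have "(\<integral>s. indicat_real {t-pi..t+pi} s *\<^sub>R exp (\<i> * of_real (of_int n * s)) \<partial>lborel)
     = ?F (of_real (t + pi)) - ?F (of_real (t - pi))"
  proof (rule integral_FTC_Icc)
    fix s :: real
    have "(?F has_field_derivative exp (\<i> * of_real (of_int n * s))) (at (of_real s))"
      using assms by (auto intro!: derivative_eq_intros simp: mult_ac)
    thus "((\<lambda>s. ?F (of_real s)) has_vector_derivative exp (\<i> * of_real (of_int n * s))) (at s within {t-pi..t+pi})"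
      by (rule has_vector_derivative_real_field)
  qed (auto intro!: continuous_intros)
  also have "exp (\<i> * of_int n * complex_of_real (t + pi)) = exp (\<i> * of_int n * complex_of_real (t - pi))"
  proof -
    have "\<i> * of_int n * complex_of_real (t + pi) = \<i> * of_int n * complex_of_real (t - pi) + of_int (2 * n) * of_real pi * \<i>"
      by (simp add: algebra_simps)
    thus ?thesis unfolding exp_eq by auto
  qed
  finally show ?thesis by simp
qed

lemma integral_character_torus:
  fixes k :: "int ^ 'm::finite"
  assumes "k \<noteq> 0"
  shows "(\<integral>\<theta>. indicat_real (torus_cell t) \<theta> *\<^sub>R exp (\<i> * of_real (real_vec k \<bullet> \<theta>)) \<partial>lborel) = 0"
proof -
  interpret product_sigma_finite "\<lambda>_. lborel :: real measure" by standard
  let ?H = "\<lambda>\<theta>::real^'m. indicat_real (torus_cell t) \<theta> *\<^sub>R exp (\<i> * of_real (real_vec k \<bullet> \<theta>))"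
  let ?h = "\<lambda>b s. indicat_real {t-pi..t+pi} s *\<^sub>R exp (\<i> * of_real (real_vec k \<bullet> b * s))"
  let ?E = "\<lambda>f. \<Sum>b\<in>Basis. f b *\<^sub>R (b :: real ^ 'm)"
  have [measurable]: "?H \<in> borel_measurable borel"
    unfolding torus_cell_def by measurable
  have coord: "(?E f) \<bullet> b = f b" if "b \<in> Basis" for f b
    using that by (simp add: inner_sum_left inner_Basis if_distrib cong: if_cong)
  have corner: "(\<chi> i. c) \<bullet> b = c" if "b \<in> Basis" for c and b :: "real ^ 'm"
    using that by (auto simp: Basis_vec_def inner_axis)
  have mem: "?E f \<in> torus_cell t \<longleftrightarrow> (\<forall>b\<in>Basis. f b \<in> {t-pi..t+pi})" for f
    unfolding torus_cell_def mem_box using coord corner by auto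
  have factor: "?H (?E f) = (\<Prod>b\<in>Basis. ?h b (f b))" for f
  proof -
    have "real_vec k \<bullet> ?E f = (\<Sum>b\<in>Basis. real_vec k \<bullet> b * f b)"
      by (simp add: inner_sum_right mult.commute)
    hence "exp (\<i> * of_real (real_vec k \<bullet> ?E f)) = (\<Prod>b\<in>Basis. exp (\<i> * of_real (real_vec k \<bullet> b * f b)))"
      by (simp add: sum_distrib_left exp_sum)
    moreover have "complex_of_real (indicat_real (torus_cell t) (?E f)) = (\<Prod>b\<in>Basis. of_real (indicat_real {t-pi..t+pi} (f b)))"
    proof (cases "?E f \<in> torus_cell t")
      case True
      hence "indicat_real {t-pi..t+pi} (f b) = 1" if "b \<in> Basis" for b :: "real ^ 'm" using that mem by (simp add: indicator_def)
      thus ?thesis using True by simp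
    next
      case False
      then obtain b :: "real ^ 'm" where "b \<in> Basis" "indicat_real {t-pi..t+pi} (f b) = 0" using mem[of f] by (auto simp: indicator_def)
      thus ?thesis using False by (auto simp: prod_zero_iff)
    qed
    ultimately show ?thesis by (simp add: scaleR_conv_of_real prod.distrib)
  qed
  have "(\<integral>\<theta>. ?H \<theta> \<partial>lborel) = (\<integral>f. ?H (?E f) \<partial>(\<Pi>\<^sub>M b\<in>Basis. lborel))"
    by (subst lborel_eq, subst integral_distr) measurable
  also have "\<dots> = (\<Prod>b\<in>Basis. (\<integral>s. ?h b s \<partial>lborel))"
    unfolding factor
  proof (rule product_integral_prod)
    show "integrable lborel (?h b)" for b :: "real ^ 'm"
      by (rule integrable_weighted[OF integrable_indicator_unit, where K = "{t-pi..t+pi}"]) (auto intro!: continuous_intros)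
  qed simp
  also have "\<dots> = 0"
  proof -
    obtain i where i: "k $ i \<noteq> 0" using assms by (auto simp: vec_eq_iff)
    have "real_vec k \<bullet> axis i 1 = of_int (k $ i)" by (simp add: inner_axis real_vec_def)
    hence "(\<integral>s. ?h (axis i 1) s \<partial>lborel) = 0" using integral_full_period[OF i] by simp
    moreover have "axis i (1::real) \<in> Basis" by (auto simp: Basis_vec_def)
    ultimately show ?thesis by (intro prod_zero) auto
  qed
  finally show ?thesis .
qed

text \<open>
  Only the constant monomial survives integration over a period cell, on the real torus through the point \<open>exp u\<close> as well
  as on the unit torus.
\<close>

lemma Cst_eq_torus_integral:
  fixes f :: "'m::finite laurent_poly" and u :: "real ^ 'm"
  shows "of_real (measure lborel (torus_cell t :: (real ^ 'm) set) * Cst f)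
    = (\<integral>\<theta>. indicat_real (torus_cell t) \<theta> *\<^sub>R
        character_sum (\<lambda>k. exp (of_real (real_vec k \<bullet> u) + \<i> * of_real (real_vec k \<bullet> \<theta>))) f \<partial>lborel)"
proof -
  let ?C = "torus_cell t :: (real ^ 'm) set"
  let ?e = "\<lambda>k \<theta>. exp (\<i> * of_real (real_vec k \<bullet> \<theta>))"
  let ?c = "\<lambda>k. complex_of_real (Poly_Mapping.lookup f k) * exp (of_real (real_vec k \<bullet> u))"
  have cpt: "compact ?C" by (simp add: torus_cell_def)
  have i1: "integrable lborel (indicat_real ?C)"
    using emeasure_compact_finite[OF cpt] by (simp add: integrable_indicator_iff borel_compact[OF cpt])
  have int: "integrable lborel (\<lambda>\<theta>. indicat_real ?C \<theta> *\<^sub>R ?e k \<theta>)" for k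
    by (rule integrable_weighted[OF i1, where K = ?C]) (auto intro!: continuous_intros cpt)
  have val: "(\<integral>\<theta>. indicat_real ?C \<theta> *\<^sub>R ?e k \<theta> \<partial>lborel) = (if k = 0 then of_real (measure lborel ?C) else 0)" for k
  proof (cases "k = 0")
    case True
    have "(\<integral>\<theta>. indicat_real ?C \<theta> *\<^sub>R (1::complex) \<partial>lborel) = of_real (\<integral>\<theta>. indicat_real ?C \<theta> \<partial>lborel)"
      unfolding integral_complex_of_real[symmetric] by (simp add: scaleR_conv_of_real)
    thus ?thesis using True by (simp add: real_vec_0)
  qed (use integral_character_torus in auto)
  have "(\<integral>\<theta>. indicat_real ?C \<theta> *\<^sub>R character_sum (\<lambda>k. exp (of_real (real_vec k \<bullet> u) + \<i> * of_real (real_vec k \<bullet> \<theta>))) f \<partial>lborel)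
    = (\<integral>\<theta>. (\<Sum>k\<in>Poly_Mapping.keys f. ?c k * (indicat_real ?C \<theta> *\<^sub>R ?e k \<theta>)) \<partial>lborel)"
    by (rule Bochner_Integration.integral_cong[OF refl])
       (simp add: character_sum_def exp_add scaleR_sum_right mult.assoc)
  also have "\<dots> = (\<Sum>k\<in>Poly_Mapping.keys f. \<integral>\<theta>. ?c k * (indicat_real ?C \<theta> *\<^sub>R ?e k \<theta>) \<partial>lborel)"
    by (intro Bochner_Integration.integral_sum integrable_mult_right int)
  also have "\<dots> = (\<Sum>k\<in>Poly_Mapping.keys f. ?c k * (if k = 0 then of_real (measure lborel ?C) else 0))"
    by (simp only: integral_mult_right_zero val)
  also have "\<dots> = of_real (measure lborel ?C * Cst f)"
    by (simp add: Cst_def in_keys_iff real_vec_0 if_distrib cong: if_cong)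
  finally show ?thesis ..
qed

section \<open>The walk attached to a convenient Laurent polynomial\<close>

locale convenient_laurent =
  fixes f :: "'m::finite laurent_poly"
  assumes coeff_nonneg: "\<And>k. Poly_Mapping.lookup f k \<ge> 0" and convenient: "convenient f"
begin

definition on_log_scale :: "real ^ 'm \<Rightarrow> real" where
  "on_log_scale u = (\<Sum>k\<in>Poly_Mapping.keys f. Poly_Mapping.lookup f k * exp (real_vec k \<bullet> u))"

lemma laurent_eval_exp: "laurent_eval f (\<chi> i. exp (u $ i)) = on_log_scale u"
  unfolding laurent_eval_def on_log_scale_def
proof (intro sum.cong refl arg_cong2[of _ _ _ _ "(*)"])
  fix k :: "int ^ 'm"
  have "(\<Prod>i\<in>UNIV. (\<chi> i. exp (u $ i)) $ i powi k $ i) = (\<Prod>i\<in>UNIV. exp (of_int (k $ i) * u $ i))"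
    by (simp add: exp_power_int)
  also have "\<dots> = exp (real_vec k \<bullet> u)"
    by (simp add: exp_sum real_vec_def inner_vec_def)
  finally show "(\<Prod>i\<in>UNIV. (\<chi> i. exp (u $ i)) $ i powi k $ i) = exp (real_vec k \<bullet> u)" .
qed

lemma image_positive_orthant: "laurent_eval f ` {x. \<forall>i. x $ i > 0} = range on_log_scale"
proof (intro equalityI subsetI)
  fix y assume "y \<in> laurent_eval f ` {x. \<forall>i. x $ i > 0}"
  then obtain x :: "real ^ 'm" where x: "\<And>i. x $ i > 0" "y = laurent_eval f x" by auto
  have "x = (\<chi> i. exp ((\<chi> i. ln (x $ i)) $ i))" using x(1) by (simp add: vec_eq_iff)
  thus "y \<in> range on_log_scale" using x(2) laurent_eval_exp by (metis rangeI)
next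
  fix y assume "y \<in> range on_log_scale"
  then obtain u where "y = on_log_scale u" by auto
  hence "y = laurent_eval f (\<chi> i. exp (u $ i))" by (simp add: laurent_eval_exp)
  thus "y \<in> laurent_eval f ` {x. \<forall>i. x $ i > 0}" by (intro image_eqI[of _ _ "\<chi> i. exp (u $ i)"]) auto
qed

lemma coeff_pos: "k \<in> Poly_Mapping.keys f \<Longrightarrow> Poly_Mapping.lookup f k > 0"
  using coeff_nonneg[of k] by (simp add: in_keys_iff)

lemma keys_nonempty: "Poly_Mapping.keys f \<noteq> {}"
  using convenient by (auto simp: convenient_def newton_polytope_def)

text \<open>
  If all exponents were below \<open>\<rho> \<bar>u\<bar>\<close> in direction \<open>u\<close>, the Newton polytope would lie in the same half-space and could not
  contain a ball of radius \<open>\<rho>\<close>.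
\<close>

lemma support_grows:
  obtains \<rho> where "\<rho> > 0" "\<And>u. \<exists>k\<in>Poly_Mapping.keys f. \<rho> * norm u \<le> real_vec k \<bullet> u"
proof -
  have "0 \<in> interior (convex hull (real_vec ` Poly_Mapping.keys f))"
    using convenient by (simp add: convenient_def newton_polytope_def real_vec_def[abs_def])
  then obtain \<rho> where \<rho>: "\<rho> > 0" "cball 0 \<rho> \<subseteq> convex hull (real_vec ` Poly_Mapping.keys f)"
    by (auto simp: mem_interior_cball)
  have "\<exists>k\<in>Poly_Mapping.keys f. \<rho> * norm u \<le> real_vec k \<bullet> u" for u
  proof (cases "u = 0")
    case True
    obtain k where "k \<in> Poly_Mapping.keys f" using keys_nonempty by blast
    thus ?thesis using True by auto
  next
    case False
    show ?thesis
    proof (rule ccontr)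
      assume "\<not> ?thesis"
      hence "real_vec ` Poly_Mapping.keys f \<subseteq> {v. u \<bullet> v < \<rho> * norm u}" by (auto simp: inner_commute not_le)
      hence "convex hull (real_vec ` Poly_Mapping.keys f) \<subseteq> {v. u \<bullet> v < \<rho> * norm u}"
        by (intro hull_minimal convex_halfspace_lt)
      moreover have "(\<rho> / norm u) *\<^sub>R u \<in> cball 0 \<rho>" using \<rho>(1) False by simp
      ultimately have "u \<bullet> ((\<rho> / norm u) *\<^sub>R u) < \<rho> * norm u" using \<rho>(2) by blast
      thus False using False by (simp add: power2_norm_eq_inner[symmetric] power2_eq_square)
    qed
  qed
  with \<rho>(1) that show thesis by blast
qed

lemma minimum_exists: "\<exists>u0. \<forall>u. on_log_scale u0 \<le> on_log_scale u"
proof -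
  obtain \<rho> where \<rho>: "\<rho> > 0" "\<And>u. \<exists>k\<in>Poly_Mapping.keys f. \<rho> * norm u \<le> real_vec k \<bullet> u"
    using support_grows by metis
  define c where "c = Min (Poly_Mapping.lookup f ` Poly_Mapping.keys f)"
  have c: "c > 0" unfolding c_def using keys_nonempty coeff_pos by (subst Min_gr_iff) auto
  have lower: "c * (\<rho> * norm u) \<le> on_log_scale u" for u
  proof -
    obtain k where k: "k \<in> Poly_Mapping.keys f" "\<rho> * norm u \<le> real_vec k \<bullet> u" using \<rho>(2) by blast
    have "\<rho> * norm u \<le> exp (real_vec k \<bullet> u)" using k(2) exp_ge_add_one_self[of "real_vec k \<bullet> u"] by linarith
    moreover have "c \<le> Poly_Mapping.lookup f k" unfolding c_def using k(1) by (intro Min_le) auto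
    ultimately have "c * (\<rho> * norm u) \<le> Poly_Mapping.lookup f k * exp (real_vec k \<bullet> u)"
      using c \<rho>(1) by (intro mult_mono) auto
    also have "\<dots> \<le> on_log_scale u"
      unfolding on_log_scale_def using k(1) coeff_nonneg
      by (intro member_le_sum[of k _ "\<lambda>k. Poly_Mapping.lookup f k * exp (real_vec k \<bullet> u)"]) auto
    finally show ?thesis .
  qed
  \<comment> \<open>Outside the ball of radius \<open>M\<close> the function exceeds its value at \<open>0\<close>.\<close>
  define M where "M = on_log_scale 0 / (c * \<rho>)"
  have M: "M \<ge> 0" unfolding M_def on_log_scale_def using c \<rho>(1) coeff_nonneg
    by (intro divide_nonneg_pos sum_nonneg mult_nonneg_nonneg mult_pos_pos) auto
  have "continuous_on (cball 0 M) on_log_scale"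
    unfolding on_log_scale_def by (intro continuous_intros)
  then obtain u0 where u0: "u0 \<in> cball 0 M" "\<And>u. u \<in> cball 0 M \<Longrightarrow> on_log_scale u0 \<le> on_log_scale u"
    using continuous_attains_inf[of "cball 0 M" on_log_scale] M by auto
  have "on_log_scale u0 \<le> on_log_scale u" for u
  proof (cases "u \<in> cball 0 M")
    case False
    hence "M < norm u" by simp
    hence "on_log_scale 0 < c * (\<rho> * norm u)" using c \<rho>(1) by (simp add: M_def field_simps)
    moreover have "on_log_scale u0 \<le> on_log_scale 0" using M by (intro u0) auto
    ultimately show ?thesis using lower[of u] by linarith
  qed (use u0 in auto)
  thus ?thesis by blast
qed

definition u0 :: "real ^ 'm" where "u0 = (SOME u0. \<forall>u. on_log_scale u0 \<le> on_log_scale u)"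
definition T :: real where "T = on_log_scale u0"

lemma u0_min: "T \<le> on_log_scale u"
  using someI_ex[OF minimum_exists] by (auto simp: u0_def T_def)

lemma conifold_value_eq: "conifold_value f = T"
  unfolding conifold_value_def image_positive_orthant
  using u0_min by (intro Least_equality) (auto simp: T_def)

lemma T_pos: "T > 0"
  unfolding T_def on_log_scale_def using keys_nonempty coeff_pos by (intro sum_pos) auto

lemma critical: "(\<Sum>k\<in>Poly_Mapping.keys f. Poly_Mapping.lookup f k * exp (real_vec k \<bullet> u0) * (real_vec k \<bullet> v)) = 0"
proof -
  let ?h = "\<lambda>s. \<Sum>k\<in>Poly_Mapping.keys f. Poly_Mapping.lookup f k * exp (real_vec k \<bullet> u0 + s * (real_vec k \<bullet> v))"
  have "(?h has_real_derivative (\<Sum>k\<in>Poly_Mapping.keys f. Poly_Mapping.lookup f k * (exp (real_vec k \<bullet> u0 + 0 * (real_vec k \<bullet> v)) * (real_vec k \<bullet> v)))) (at 0)"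
    by (intro DERIV_sum DERIV_cmult) (auto intro!: derivative_eq_intros)
  moreover have "?h s = on_log_scale (u0 + s *\<^sub>R v)" for s
    by (simp add: on_log_scale_def inner_add_right)
  hence "?h 0 \<le> ?h s" for s using u0_min[of "u0 + s *\<^sub>R v"] by (metis T_def add.right_neutral scaleR_zero_left)
  ultimately have "(\<Sum>k\<in>Poly_Mapping.keys f. Poly_Mapping.lookup f k * (exp (real_vec k \<bullet> u0 + 0 * (real_vec k \<bullet> v)) * (real_vec k \<bullet> v))) = 0"
    by (intro DERIV_local_min[of ?h _ 0 1]) auto
  thus ?thesis by (simp add: mult.assoc)
qed

text \<open>
  The lattice of exponents is embedded in \<open>real ^ 'm\<close>, where the distribution of the steps lives.
\<close>

definition step_prob :: "real ^ 'm \<Rightarrow> real" where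
  "step_prob v = Poly_Mapping.lookup f (inv real_vec v) * exp (v \<bullet> u0) / T"

lemma step_prob_real_vec: "step_prob (real_vec k) = Poly_Mapping.lookup f k * exp (real_vec k \<bullet> u0) / T"
  by (simp add: step_prob_def inv_f_f[OF inj_real_vec])

lemma sum_steps: "(\<Sum>v\<in>real_vec ` Poly_Mapping.keys f. F v) = (\<Sum>k\<in>Poly_Mapping.keys f. F (real_vec k))"
  by (subst sum.reindex) (auto intro: inj_on_subset[OF inj_real_vec])

sublocale centred_walk "real_vec ` Poly_Mapping.keys f" step_prob
proof unfold_locales
  show "step_prob v > 0" if "v \<in> real_vec ` Poly_Mapping.keys f" for v
    using that coeff_pos T_pos by (auto simp: step_prob_real_vec)
  show "sum step_prob (real_vec ` Poly_Mapping.keys f) = 1"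
    using T_pos unfolding sum_steps step_prob_real_vec sum_divide_distrib[symmetric]
    by (simp add: T_def on_log_scale_def)
  show "(\<Sum>v\<in>real_vec ` Poly_Mapping.keys f. step_prob v *\<^sub>R v) = 0"
  proof (rule vector_eq_rdot[THEN iffD1], intro allI)
    fix w :: "real ^ 'm"
    have "(\<Sum>v\<in>real_vec ` Poly_Mapping.keys f. step_prob v *\<^sub>R v) \<bullet> w
      = (\<Sum>k\<in>Poly_Mapping.keys f. Poly_Mapping.lookup f k * exp (real_vec k \<bullet> u0) * (real_vec k \<bullet> w) / T)"
      unfolding sum_steps by (simp add: inner_sum_left step_prob_real_vec)
    also have "\<dots> = 0" unfolding sum_divide_distrib[symmetric] critical by simp
    finally show "(\<Sum>v\<in>real_vec ` Poly_Mapping.keys f. step_prob v *\<^sub>R v) \<bullet> w = 0 \<bullet> w" by simp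
  qed
  show "\<exists>v\<in>real_vec ` Poly_Mapping.keys f. v \<bullet> u \<noteq> 0" if "u \<noteq> 0" for u
  proof -
    obtain \<rho> where "\<rho> > 0" "\<exists>k\<in>Poly_Mapping.keys f. \<rho> * norm u \<le> real_vec k \<bullet> u"
      using support_grows by metis
    moreover from this(1) that have "\<rho> * norm u > 0" by simp
    ultimately show ?thesis by force
  qed
qed simp

lemma char_power:
  "character_sum (\<lambda>k. exp (of_real (real_vec k \<bullet> u0) + \<i> * of_real (real_vec k \<bullet> \<theta>))) (f ^ n) = of_real (T ^ n) * char \<theta> ^ n"
proof -
  let ?ch = "\<lambda>k. exp (of_real (real_vec k \<bullet> u0) + \<i> * of_real (real_vec k \<bullet> \<theta>))"
  have "character_sum ?ch f = of_real T * char \<theta>"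
    using T_pos unfolding char_def sum_steps character_sum_def sum_distrib_left
    by (intro sum.cong refl) (simp add: step_prob_real_vec exp_add flip: exp_of_real)
  moreover have "character_sum ?ch (f ^ n) = character_sum ?ch f ^ n"
    by (rule character_sum_power) (simp_all add: real_vec_add real_vec_0 inner_add_left distrib_left flip: exp_add add: algebra_simps)
  ultimately show ?thesis by (simp add: power_mult_distrib)
qed

abbreviation "a n \<equiv> Cst (f ^ n)"

text \<open>
  The quotient \<open>Cst (f ^ n) / T ^ n\<close> is the probability that the walk returns to the origin at time \<open>n\<close>.
\<close>

lemma return_probability:
  "complex_of_real (measure lborel (torus_cell t :: (real ^ 'm) set) * (a n / T ^ n))
    = (\<integral>\<theta>. indicat_real (torus_cell t) \<theta> *\<^sub>R char \<theta> ^ n \<partial>lborel)"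
proof -
  have "of_real (T ^ n) * (\<integral>\<theta>. indicat_real (torus_cell t) \<theta> *\<^sub>R char \<theta> ^ n \<partial>lborel)
      = (\<integral>\<theta>. of_real (T ^ n) * (indicat_real (torus_cell t) \<theta> *\<^sub>R char \<theta> ^ n) \<partial>lborel)"
    by (rule integral_mult_right_zero[symmetric])
  also have "\<dots> = of_real (measure lborel (torus_cell t :: (real ^ 'm) set) * a n)"
    unfolding Cst_eq_torus_integral[where u = u0] char_power by (simp add: mult_scaleR_right)
  finally show ?thesis using T_pos by (simp add: field_simps)
qed

lemma compact_torus_cell: "compact (torus_cell t :: (real ^ 'm) set)"
  by (simp add: torus_cell_def)

lemma integrable_torus_cell: "integrable lborel (indicat_real (torus_cell t :: (real ^ 'm) set))"
  using emeasure_compact_finite[OF compact_torus_cell]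
  by (simp add: integrable_indicator_iff borel_compact[OF compact_torus_cell])

lemma measure_torus_cell_pos: "measure lborel (torus_cell t :: (real ^ 'm) set) > 0"
proof -
  have "(\<chi> i. t + pi) \<bullet> b - (\<chi> i. t - pi) \<bullet> b > 0" "(\<chi> i. t - pi) \<bullet> b \<le> (\<chi> i. t + pi) \<bullet> b" if "b \<in> Basis" for b :: "real ^ 'm"
    using that pi_gt_zero by (auto simp: Basis_vec_def inner_axis)
  thus ?thesis unfolding torus_cell_def
    by (subst measure_lborel_cbox_eq) (auto intro!: prod_pos simp: inner_diff_left)
qed

lemma integrable_char_power: "integrable lborel (\<lambda>\<theta>. indicat_real (torus_cell t) \<theta> *\<^sub>R char \<theta> ^ n)"
  by (rule integrable_weighted[OF integrable_torus_cell _ compact_torus_cell, of t t])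
     (auto intro!: continuous_intros continuous_on_char)

lemma norm_char_power: "norm (char \<theta> ^ n) \<le> 1"
  using norm_char[of \<theta>] by (simp add: norm_power power_le_one)

lemma a_nonneg: "a n \<ge> 0"
  unfolding Cst_def by (rule lookup_power_nonneg[OF coeff_nonneg])

lemma a_le: "a n \<le> T ^ n"
proof -
  let ?V = "measure lborel (torus_cell 0 :: (real ^ 'm) set)"
  have "?V * (a n / T ^ n) = norm (complex_of_real (?V * (a n / T ^ n)))"
    unfolding norm_of_real using a_nonneg[of n] T_pos measure_torus_cell_pos[of 0] by (intro abs_of_nonneg[symmetric]) simp
  also have "\<dots> \<le> (\<integral>\<theta>. norm (indicat_real (torus_cell 0) \<theta> *\<^sub>R char \<theta> ^ n) \<partial>lborel)"
    by (subst return_probability) (rule integral_norm_bound)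
  also have "\<dots> \<le> (\<integral>\<theta>. indicat_real (torus_cell 0 :: (real ^ 'm) set) \<theta> \<partial>lborel)"
    using norm_char_power
    by (intro integral_mono integrable_norm integrable_char_power integrable_torus_cell) (auto simp: indicator_def)
  also have "\<dots> = ?V * 1" using borel_compact[OF compact_torus_cell[of 0]] by simp
  finally have "a n / T ^ n \<le> 1"
    using measure_torus_cell_pos[of 0] by (rule mult_left_le_imp_le)
  thus ?thesis using T_pos by (simp add: field_simps)
qed

lemma resolvent_series:
  assumes x: "0 < x" "x < 1"
  shows "(\<lambda>n. of_real (measure lborel (torus_cell t :: (real ^ 'm) set) * (a n / T ^ n)) * of_real x ^ n)
    sums (\<integral>\<theta>. indicat_real (torus_cell t) \<theta> *\<^sub>R (1 / (1 - of_real x * char \<theta>)) \<partial>lborel)"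
proof -
  let ?I = "indicat_real (torus_cell t :: (real ^ 'm) set)"
  define F where "F n \<theta> = of_real x ^ n * (?I \<theta> *\<^sub>R char \<theta> ^ n)" for n \<theta>
  have bound: "norm (F n \<theta>) \<le> x ^ n * ?I \<theta>" for n \<theta>
    using norm_char_power[of \<theta> n] x by (auto simp: F_def indicator_def norm_mult norm_power intro!: mult_left_le)
  have int: "integrable lborel (F n)" for n
    unfolding F_def by (intro integrable_mult_right integrable_char_power)
  have geo: "summable (\<lambda>n. x ^ n * c)" for c using x by (intro summable_mult2 summable_geometric) auto
  have 1: "AE \<theta> in lborel. summable (\<lambda>n. norm (F n \<theta>))"
    using bound by (intro AE_I2 summable_comparison_test[OF _ geo]) (auto intro!: exI[of _ 0])
  have 2: "summable (\<lambda>n. \<integral>\<theta>. norm (F n \<theta>) \<partial>lborel)"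
  proof (rule summable_comparison_test[OF _ geo])
    have "(\<integral>\<theta>. norm (F n \<theta>) \<partial>lborel) \<le> (\<integral>\<theta>. x ^ n * ?I \<theta> \<partial>lborel)" for n
      using bound integrable_norm[OF int[of n]] integrable_torus_cell by (intro integral_mono) auto
    thus "\<exists>N. \<forall>n\<ge>N. norm (\<integral>\<theta>. norm (F n \<theta>) \<partial>lborel) \<le> x ^ n * (\<integral>\<theta>. ?I \<theta> \<partial>lborel)"
      by (intro exI[of _ 0]) (simp add: integral_nonneg_AE)
  qed
  have "(\<lambda>n. \<integral>\<theta>. F n \<theta> \<partial>lborel) sums (\<integral>\<theta>. suminf (\<lambda>n. F n \<theta>) \<partial>lborel)"
    by (rule sums_integral[OF int 1 2])
  moreover have "(\<integral>\<theta>. F n \<theta> \<partial>lborel) = of_real (measure lborel (torus_cell t :: (real ^ 'm) set) * (a n / T ^ n)) * of_real x ^ n" for n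
    unfolding F_def integral_mult_right_zero return_probability by (rule mult.commute)
  moreover have "suminf (\<lambda>n. F n \<theta>) = ?I \<theta> *\<^sub>R (1 / (1 - of_real x * char \<theta>))" for \<theta>
  proof -
    have "norm (of_real x * char \<theta>) \<le> x * 1"
      unfolding norm_mult using norm_char[of \<theta>] x by (intro mult_mono) auto
    hence "(\<lambda>n. (of_real x * char \<theta>) ^ n) sums (1 / (1 - of_real x * char \<theta>))"
      using x by (intro geometric_sums) simp
    hence "(\<lambda>n. ?I \<theta> *\<^sub>R (of_real x * char \<theta>) ^ n) sums (?I \<theta> *\<^sub>R (1 / (1 - of_real x * char \<theta>)))"
      by (rule sums_scaleR_right)
    thus ?thesis by (simp add: F_def power_mult_distrib sums_iff)
  qed
  ultimately show ?thesis by simp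
qed

text \<open>
  There are only countably many periods, so a translate of the cell \<open>[-\<pi>, \<pi>]\<^sup>m\<close> along the diagonal has no period on
  its boundary. As the translation is by less than \<open>\<pi>\<close>, the cell still contains the period \<open>0\<close>.
\<close>

lemma good_cell_exists:
  obtains t where "\<bar>t\<bar> < pi" "\<And>\<theta>. \<theta> \<in> torus_cell t \<Longrightarrow> char \<theta> = 1 \<Longrightarrow> \<theta> \<in> interior (torus_cell t)"
proof -
  define \<Lambda> where "\<Lambda> = {\<theta>. char \<theta> = 1}"
  have "\<Lambda> \<subseteq> (\<Union>n. {\<theta>\<in>cball 0 (real n). char \<theta> = 1})"
  proof
    fix \<theta> assume "\<theta> \<in> \<Lambda>"
    moreover obtain n where "norm \<theta> \<le> real n" using real_arch_simple by blast
    ultimately show "\<theta> \<in> (\<Union>n. {\<theta>\<in>cball 0 (real n). char \<theta> = 1})"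
      by (intro UN_I[of n]) (auto simp: \<Lambda>_def)
  qed
  moreover have "countable (\<Union>n. {\<theta>\<in>cball 0 (real n). char \<theta> = 1})"
    by (intro countable_UN[OF countableI_type] countable_finite[OF finite_periods] bounded_cball)
  ultimately have "countable \<Lambda>" by (rule countable_subset)
  hence "countable (\<Union>i. (\<lambda>\<theta>. \<theta> $ i - pi) ` \<Lambda> \<union> (\<lambda>\<theta>. \<theta> $ i + pi) ` \<Lambda>)" by auto
  moreover have "uncountable {-pi<..<pi}" by (rule uncountable_open_interval[THEN iffD2]) simp
  ultimately obtain t where t: "t \<in> {-pi<..<pi}" "t \<notin> (\<Union>i. (\<lambda>\<theta>. \<theta> $ i - pi) ` \<Lambda> \<union> (\<lambda>\<theta>. \<theta> $ i + pi) ` \<Lambda>)"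
    by (meson countable_subset subsetI)
  show thesis
  proof (rule that[of t])
    show "\<bar>t\<bar> < pi" using t(1) by auto
    fix \<theta> assume \<theta>: "\<theta> \<in> torus_cell t" "char \<theta> = 1"
    have "t \<noteq> \<theta> $ i - pi" "t \<noteq> \<theta> $ i + pi" for i
      using t(2) \<theta>(2) by (auto simp: \<Lambda>_def)
    moreover have "t - pi \<le> \<theta> $ i" "\<theta> $ i \<le> t + pi" for i
      using \<theta>(1) by (auto simp: torus_cell_def mem_box_cart)
    ultimately have "t - pi < \<theta> $ i \<and> \<theta> $ i < t + pi" for i
      by (smt (verit))
    thus "\<theta> \<in> interior (torus_cell t)"
      by (auto simp: torus_cell_def interior_cbox mem_box_cart)
  qed
qed

lemma cst_series_sums:
  assumes "t \<in> ball 0 (inverse T)"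
  shows "(\<lambda>n. of_real (a n) * t ^ n) sums cst_series f t"
proof -
  have "norm t * T < inverse T * T" using assms T_pos by (intro mult_strict_right_mono) auto
  hence "norm t * T < 1" using T_pos by simp
  hence geo: "summable (\<lambda>n. (norm t * T) ^ n)" using T_pos by (intro summable_geometric) simp
  have "norm (of_real (a n) * t ^ n) \<le> (norm t * T) ^ n" for n
  proof -
    have "norm (of_real (a n) * t ^ n) = a n * norm t ^ n"
      using a_nonneg[of n] by (simp add: norm_mult norm_power)
    also have "\<dots> \<le> T ^ n * norm t ^ n" using a_le[of n] by (intro mult_right_mono) auto
    finally show ?thesis by (simp add: power_mult_distrib mult.commute)
  qed
  hence "summable (\<lambda>n. of_real (a n) * t ^ n)"
    by (intro summable_comparison_test[OF _ geo] exI[of _ 0]) simp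
  thus ?thesis unfolding cst_series_def by (rule summable_sums)
qed

lemma cst_series_holomorphic: "cst_series f holomorphic_on ball 0 (inverse T)"
  by (rule power_series_holomorphic[of 0 _ "\<lambda>n. of_real (a n)"]) (simp add: cst_series_sums)

text \<open>
  The expansion of the Green function holds for real arguments below \<open>1\<close>. Both sides are holomorphic on the intersection of
  the disc of convergence with a disc around \<open>1 / T\<close>, so they agree there. The change of variable \<open>z = T t\<close> and division by the
  volume of the cell give the constant term series.
\<close>

lemma singularity:
  obtains \<epsilon> A B C where "log_sqrt_singularity (inverse T) \<epsilon> A B C (cst_series f)"
proof -
  obtain t where t: "\<bar>t\<bar> < pi" "\<And>\<theta>. \<theta> \<in> torus_cell t \<Longrightarrow> char \<theta> = 1 \<Longrightarrow> \<theta> \<in> interior (torus_cell t)"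
    using good_cell_exists by metis
  define V where "V = measure lborel (torus_cell t :: (real ^ 'm) set)"
  have V: "V > 0" using measure_torus_cell_pos by (simp add: V_def)
  have "0 \<in> torus_cell t" using t(1) by (auto simp: torus_cell_def mem_box_cart)
  hence ex: "\<exists>\<theta>\<in>torus_cell t. char \<theta> = 1" using char_0 by blast
  obtain \<epsilon> A B C where \<epsilon>: "\<epsilon> > 0" and hol: "A holomorphic_on ball 1 \<epsilon>" "B holomorphic_on ball 1 \<epsilon>" "C holomorphic_on ball 1 \<epsilon>"
    and nontriv: "\<exists>z\<in>ball 1 \<epsilon> - {1}. B z \<noteq> 0 \<or> C z \<noteq> 0"
    and eq: "\<And>x. x \<in> {1-\<epsilon><..<1} \<Longrightarrow> (\<integral>\<theta>. indicat_real (torus_cell t) \<theta> *\<^sub>R (1 / (1 - of_real x * char \<theta>)) \<partial>lborel)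
       = A (of_real x) + B (of_real x) / csqrt (1 - of_real x) + C (of_real x) * Ln (1 - of_real x)"
    by (rule resolvent_integral_expansion[OF compact_torus_cell t(2) ex]) (assumption, assumption, (rule that; assumption))
  define t0 where "t0 = inverse T"
  have t0: "t0 > 0" "T = inverse t0" using T_pos by (auto simp: t0_def)
  define \<delta> where "\<delta> = \<epsilon> * t0"
  have \<delta>: "\<delta> > 0" using \<epsilon> t0 by (simp add: \<delta>_def)
  have scale: "w / t0 \<in> ball 1 \<epsilon> \<longleftrightarrow> w \<in> ball (of_real t0) \<delta>" for w :: complex
  proof -
    have "dist 1 (w / t0) = dist (of_real t0) w / t0"
    proof -
      have "1 - w / t0 = (of_real t0 - w) / t0" using t0 by (simp add: diff_divide_distrib)
      thus ?thesis using t0 by (simp add: dist_norm norm_divide)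
    qed
    thus ?thesis unfolding mem_ball \<delta>_def by (simp only: pos_divide_less_eq[OF t0(1)])
  qed
  have hol': "(\<lambda>w. F (w / t0) / V) holomorphic_on ball (of_real t0) \<delta>" if "F holomorphic_on ball 1 \<epsilon>" for F :: "complex \<Rightarrow> complex"
  proof -
    have "(\<lambda>w. w / t0) holomorphic_on ball (of_real t0) \<delta>" using t0 by (intro holomorphic_intros) auto
    from holomorphic_on_compose_gen[OF this that] scale
    have "(\<lambda>w. F (w / t0)) holomorphic_on ball (of_real t0) \<delta>" by (auto simp: o_def image_subset_iff)
    thus ?thesis using V by (intro holomorphic_intros) auto
  qed
  let ?R = "\<lambda>w::complex. A (w / t0) / V + B (w / t0) / V / csqrt (1 - w / t0) + C (w / t0) / V * Ln (1 - w / t0)"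
  let ?\<Omega> = "ball 0 t0 \<inter> ball (complex_of_real t0) \<delta>"
  have np: "1 - w / t0 \<notin> \<real>\<^sub>\<le>\<^sub>0" if "w \<in> ball 0 t0" for w :: complex
  proof -
    have "norm (w / t0) < 1" using that t0 by (simp add: norm_divide)
    hence "Re (w / t0) < 1" using complex_Re_le_cmod[of "w / t0"] by linarith
    thus ?thesis by (auto simp: complex_nonpos_Reals_iff)
  qed
  have sq: "csqrt (1 - w / t0) \<noteq> 0" if "w \<in> ball 0 t0" for w :: complex
    using np[OF that] by auto
  have aff: "(\<lambda>w. 1 - w / t0) holomorphic_on ?\<Omega>" using t0 by (intro holomorphic_intros) auto
  have "(\<lambda>w. csqrt (1 - w / t0)) holomorphic_on ?\<Omega>"
    by (rule holomorphic_on_compose_gen[OF aff holomorphic_on_csqrt, unfolded o_def]) (use np in blast)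
  moreover have "(\<lambda>w. Ln (1 - w / t0)) holomorphic_on ?\<Omega>"
    by (rule holomorphic_on_compose_gen[OF aff holomorphic_on_Ln[of "- \<real>\<^sub>\<le>\<^sub>0"], unfolded o_def]) (use np in blast)+
  moreover have "(\<lambda>w. F (w / t0) / V) holomorphic_on ?\<Omega>" if "F holomorphic_on ball 1 \<epsilon>" for F :: "complex \<Rightarrow> complex"
    by (rule holomorphic_on_subset[OF hol'[OF that]]) auto
  ultimately have holR: "?R holomorphic_on ?\<Omega>"
    using sq hol by (intro holomorphic_on_add holomorphic_on_mult holomorphic_on_divide[where g = "\<lambda>w. csqrt (1 - w / t0)"]) auto
  have holG: "cst_series f holomorphic_on ?\<Omega>"
    by (rule holomorphic_on_subset[OF cst_series_holomorphic]) (auto simp: t0_def)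
  \<comment> \<open>On the real interval between \<open>lo\<close> and \<open>t0\<close> both expansions are available.\<close>
  define lo where "lo = max 0 (t0 - \<delta>)"
  have lo: "0 \<le> lo" "lo < t0" "t0 - \<delta> \<le> lo" using t0 \<delta> by (auto simp: lo_def)
  have on_reals: "cst_series f (of_real s) = ?R (of_real s)" if s: "s \<in> {lo<..<t0}" for s
  proof -
    define x where "x = s / t0"
    have x: "0 < x" "x < 1" "x \<in> {1-\<epsilon><..<1}"
      using s lo t0 by (auto simp: x_def \<delta>_def field_simps)
    have "complex_of_real s \<in> ball 0 (inverse T)" using s lo by (auto simp: t0_def)
    from cst_series_sums[OF this]
    have "(\<lambda>n. of_real V * (of_real (a n) * of_real s ^ n)) sums (of_real V * cst_series f (of_real s))"
      by (rule sums_mult)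
    moreover have "of_real V * (of_real (a n) * of_real s ^ n) = complex_of_real (V * (a n / T ^ n)) * of_real x ^ n" for n
    proof -
      have "x = s * T" using t0 by (simp add: x_def divide_inverse)
      thus ?thesis using T_pos by (simp add: power_mult_distrib)
    qed
    ultimately have "of_real V * cst_series f (of_real s) = A (of_real x) + B (of_real x) / csqrt (1 - of_real x) + C (of_real x) * Ln (1 - of_real x)"
      using sums_unique2[OF _ resolvent_series[OF x(1,2), of t]] eq[OF x(3)] by (simp add: V_def)
    hence "cst_series f (of_real s) = (A (of_real x) + B (of_real x) / csqrt (1 - of_real x) + C (of_real x) * Ln (1 - of_real x)) / V"
      using V by (metis nonzero_mult_div_cancel_left of_real_eq_0_iff less_irrefl)
    thus ?thesis by (simp add: x_def add_divide_distrib mult.commute)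
  qed
  have mem_\<Omega>: "complex_of_real s \<in> ?\<Omega>" if "s \<in> {lo<..<t0}" for s
  proof -
    have "dist (complex_of_real t0) (of_real s) = \<bar>t0 - s\<bar>" unfolding dist_of_real by (simp add: dist_real_def)
    thus ?thesis using that lo by auto
  qed
  define m where "m = (lo + t0) / 2"
  have m: "m \<in> {lo<..<t0}" using lo by (auto simp: m_def)
  have lim: "complex_of_real m islimpt of_real ` {lo<..<t0}"
    unfolding islimpt_approachable
  proof (intro allI impI)
    fix e :: real assume e: "e > 0"
    define s where "s = m + min (e / 2) ((t0 - m) / 2)"
    have "s \<in> {lo<..<t0}" "s \<noteq> m" "\<bar>s - m\<bar> < e" using e m by (auto simp: s_def min_def field_simps)
    thus "\<exists>x'\<in>complex_of_real ` {lo<..<t0}. x' \<noteq> of_real m \<and> dist x' (of_real m) < e"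
      by (intro bexI[of _ "of_real s"]) (auto simp: dist_of_real dist_real_def)
  qed
  have G_eq: "cst_series f w = ?R w" if "w \<in> ball 0 t0" "w \<in> ball (of_real t0) \<delta>" for w
  proof -
    have "cst_series f w - ?R w = 0"
    proof (rule analytic_continuation[of "\<lambda>w. cst_series f w - ?R w" ?\<Omega> "of_real ` {lo<..<t0}" "of_real m"])
      show "(\<lambda>w. cst_series f w - ?R w) holomorphic_on ?\<Omega>" by (intro holomorphic_on_diff holG holR)
      show "connected ?\<Omega>" by (intro convex_connected convex_Int convex_ball)
      show "complex_of_real ` {lo<..<t0} \<subseteq> ?\<Omega>" using mem_\<Omega> by blast
      show "complex_of_real m \<in> ?\<Omega>" by (rule mem_\<Omega>[OF m])
      show "cst_series f z - ?R z = 0" if "z \<in> complex_of_real ` {lo<..<t0}" for z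
        using that on_reals by auto
      show "w \<in> ?\<Omega>" using that by simp
    qed (use lim in auto)
    thus ?thesis by simp
  qed
  have "log_sqrt_singularity t0 \<delta> (\<lambda>w. A (w / t0) / V) (\<lambda>w. B (w / t0) / V) (\<lambda>w. C (w / t0) / V) (cst_series f)"
  proof
    obtain z where z: "z \<in> ball 1 \<epsilon> - {1}" "B z \<noteq> 0 \<or> C z \<noteq> 0" using nontriv by blast
    have zt: "z * t0 / t0 = z" using t0 by simp
    hence "z * t0 \<in> ball (of_real t0) \<delta>" using scale[of "z * t0"] z by simp
    moreover have "z * t0 \<noteq> of_real t0" using z t0 by auto
    ultimately show "\<exists>w\<in>ball (complex_of_real t0) \<delta> - {of_real t0}. B (w / t0) / V \<noteq> 0 \<or> C (w / t0) / V \<noteq> 0"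
      using z(2) V zt by (intro bexI[of _ "z * t0"]) auto
  qed (use t0 \<delta> hol' hol G_eq in auto)
  thus thesis using that by (simp add: t0_def)
qed

text \<open>
  The bound \<open>Cst (f ^ n) \<le> T ^ n\<close> gives one inequality. If the radius were larger, the series would be a holomorphic
  extension across its singularity.
\<close>

lemma conv_radius_cst: "conv_radius a = ereal (inverse T)"
proof (rule antisym)
  show "conv_radius a \<ge> ereal (inverse T)"
  proof (rule conv_radius_geI_ex)
    fix r :: real assume r: "0 < r" "ereal r < ereal (inverse T)"
    hence "r * T < 1" using T_pos by (simp add: field_simps)
    hence "summable (\<lambda>n. (r * T) ^ n)" using T_pos r by (intro summable_geometric) simp
    hence "summable (\<lambda>n. a n * r ^ n)"
    proof (rule summable_comparison_test[rotated])
      have "norm (a n * r ^ n) \<le> (r * T) ^ n" for n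
        using mult_right_mono[OF a_le[of n], of "r ^ n"] a_nonneg[of n] r
        by (simp add: power_mult_distrib mult.commute abs_mult)
      thus "\<exists>N. \<forall>n\<ge>N. norm (a n * r ^ n) \<le> (r * T) ^ n" by blast
    qed
    thus "\<exists>z. norm z = r \<and> summable (\<lambda>n. a n * z ^ n)" using r by (intro exI[of _ r]) auto
  qed
next
  show "conv_radius a \<le> ereal (inverse T)"
  proof (rule ccontr)
    assume "\<not> ?thesis"
    hence "ereal (inverse T) < conv_radius a" by simp
    then obtain s where "ereal (inverse T) < ereal s" "ereal s < conv_radius a" using ereal_dense2 by blast
    hence s: "inverse T < s" "ereal s < conv_radius a" by auto
    have cr: "conv_radius (\<lambda>n. complex_of_real (a n)) = conv_radius a"
      unfolding conv_radius_def by simp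
    have "(\<lambda>n. of_real (a n) * t ^ n) sums cst_series f t" if "t \<in> ball 0 s" for t
      unfolding cst_series_def
    proof (intro summable_sums summable_in_conv_radius)
      have "ereal (norm t) < ereal s" using that by simp
      thus "ereal (norm t) < conv_radius (\<lambda>n. complex_of_real (a n))" unfolding cr using s(2) by (rule less_trans)
    qed
    hence hol_s: "cst_series f holomorphic_on ball 0 s"
      by (intro power_series_holomorphic[of 0 _ "\<lambda>n. of_real (a n)"]) simp
    obtain \<epsilon> A B C where "log_sqrt_singularity (inverse T) \<epsilon> A B C (cst_series f)" by (rule singularity)
    then interpret log_sqrt_singularity "inverse T" \<epsilon> A B C "cst_series f" .
    have "ball (of_real (inverse T)) (s - inverse T) \<subseteq> ball (0 :: complex) s"
    proof
      fix w :: complex assume "w \<in> ball (of_real (inverse T)) (s - inverse T)"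
      hence "norm (of_real (inverse T) - w) < s - inverse T" by (simp add: dist_norm)
      moreover have "norm (complex_of_real (inverse T)) = inverse T" unfolding norm_of_real using T_pos by simp
      ultimately have "norm w < s"
        using norm_triangle_ineq2[of w "of_real (inverse T)"] by (simp add: norm_minus_commute)
      thus "w \<in> ball 0 s" by simp
    qed
    from no_holomorphic_extension[OF _ holomorphic_on_subset[OF hol_s this]] s show False by simp
  qed
qed

sublocale cst: supermultiplicative a
proof
  show "a 0 = 1" by (simp add: Cst_def lookup_one)
  show "a n \<ge> 0" for n by (rule a_nonneg)
  show "a m * a n \<le> a (m + n)" for m n
    unfolding power_add by (intro Cst_mult_ge lookup_power_nonneg coeff_nonneg)
qed

lemma cst_period: "cst.is_period (cst_period f)"
proof -
  have "\<exists>n\<ge>1. a n > 0"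
  proof (rule ccontr)
    assume "\<not> ?thesis"
    hence "a n = 0" if "n \<notin> {0}" for n
    proof -
      have "n \<ge> 1" using that by simp
      hence "\<not> a n > 0" using \<open>\<not> (\<exists>n\<ge>1. a n > 0)\<close> by blast
      thus ?thesis using a_nonneg[of n] by linarith
    qed
    hence "summable (\<lambda>n. a n * (2 * inverse T) ^ n)" by (intro summable_finite[of "{0}"]) auto
    from conv_radius_geI[OF this] have "ereal (2 * inverse T) \<le> ereal (inverse T)"
      using T_pos by (simp add: conv_radius_cst abs_mult)
    thus False using T_pos by simp
  qed
  then obtain r where r: "cst.is_period r" using cst.period_exists by blast
  have "is_cst_period f = cst.is_period"
    by (simp add: fun_eq_iff is_cst_period_def cst.is_period_def)
  hence "cst_period f = r"
    unfolding cst_period_def using r cst.period_unique by (intro the_equality) auto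
  thus ?thesis using r by simp
qed

end

theorem theorem5p9:
  fixes f :: "'m::finite laurent_poly"
  assumes "\<And>k. Poly_Mapping.lookup f k \<ge> 0"
    and "convenient f"
  shows "let r = cst_period f; T = conifold_value f in
    (\<lambda>n. Cst (f ^ (r * n)) powr (1 / real (r * n))) \<longlonglongrightarrow> T
    \<and> conv_radius (\<lambda>n. Cst (f ^ n)) = ereal (inverse T)
    \<and> (\<exists>\<epsilon>>0.
          let D = ball 0 (inverse T); U = ball (of_real (inverse T)) \<epsilon> - {of_real (inverse T)}
          in extends_multivalued (cst_series f) D U \<and> nontrivial_monodromy (cst_series f) D U)"
proof -
  interpret convenient_laurent f by standard (use assms in auto)
  obtain \<epsilon> A B C where "log_sqrt_singularity (inverse T) \<epsilon> A B C (cst_series f)" by (rule singularity)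
  then interpret log_sqrt_singularity "inverse T" \<epsilon> A B C "cst_series f" .
  show ?thesis
    unfolding Let_def conifold_value_eq
    using cst.root_limit[OF cst_period T_pos a_le conv_radius_cst] conv_radius_cst eps_pos extends monodromy by blast
qed

end
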